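(* Let $s\ge t\ge u\ge 1$ and let $\lambda=(\lambda_1,\lambda_2,\lambda_3)$ be a composition which is a permutation of $(s,t,u)$. For $C\subseteq\{1,\ldots,s-t+u\}$ with $|C|=u$ put $$G_C=\{(1,i) : i\in C\cup\{s-t+u+1,\ldots,s\}\}\cup\{(2,i) : 1\le i\le s\}\cup\{(3,i) : i\in C\},$$ and for $C\subseteq\{s-t+1,\ldots,s\}$ with $|C|=u$ put $$H_C=\{(1,i) : s-t+1\le i\le s\}\cup\{(2,i) : i\in C\}\cup\{(3,i) : 1\le i\le s\}.$$ Then $$\mathcal E^{(\lambda)}=\begin{cases}\{V(\lambda)\} & \text{if }\lambda=(s,t,u),\\ \{G_C : C\subseteq\{1,\ldots,s-t+u\},\ |C|=u\} & \text{if }\lambda=(t,s,u),\\ \{H_C : C\subseteq\{s-t+1,\ldots,s\},\ |C|=u\} & \text{if }\lambda=(t,u,s),\\ \{\dot M : M\in\mathcal E^{(\dot\lambda)}\} & \text{if }\lambda=(u,t,s),\ (u,s,t)\text{ or }(s,u,t).\end{cases}$$ Moreover, in all cases $\mathcal E^{(\lambda)}=\mathcal E_s^{(\lambda)}$, and $|\mathcal E^{(\lambda)}|$ equals $1$ if $\lambda=(s,t,u)$; $\binom{t}{u}$ if $\lambda=(s,u,t)$; $\binom{s-t+u}{u}$ if $\lambda=(t,s,u)$; $\binom{t}{u}$ if $\lambda=(t,u,s)$; $\binom{s-t+u}{u}$ if $\lambda=(u,s,t)$; and $1$ if $\lambda=(u,t,s)$.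
   Context: A composition $\lambda=(\lambda_1,\ldots,\lambda_r)$ of $n$ is a finite sequence of positive integers with sum $n$. Its reverse is $\dot\lambda=(\lambda_r,\ldots,\lambda_1)$. For a partition $\lambda$, $V(\lambda)=\{(i,j) : 1\le i\le r,\ 1\le j\le\lambda_i\}$ is its Young diagram. $S_n$ acts on the right on $\{1,\ldots,n\}$ (products are composed left to right), with Coxeter generators $S=\{s_1,\ldots,s_{n-1}\}$, $s_i=(i,i+1)$, and Coxeter length $l$. An element $x$ is a prefix of $y$ if $y$ has a reduced expression beginning with a reduced expression for $x$ (equivalently $l(y)=l(x)+l(x^{-1}y)$). For a composition $\lambda$ of $n$ let $J(\lambda)=S\setminus\{s_{\lambda_1},s_{\lambda_1+\lambda_2},\ldots,s_{\lambda_1+\cdots+\lambda_{r-1}}\}$, let $W_{J(\lambda)}=\langle J(\lambda)\rangle$, let $w_{J(\lambda)}$ be its longest element, and let $\mathfrak{X}_{J(\lambda)}$ be the set of minimum length representatives of the right cosets $W_{J(\lambda)}w$. $\sim_R$ is the Kazhdan-Lusztig right cell equivalence on $S_n$; explicitly, $w\sim_R w'$ if and only if the Robinson-Schensted recording tableaux agree, $\mathcal Q(w)=\mathcal Q(w')$, where $w$ is inserted via its row-form $[1w,\ldots,nw]$. $Z(\lambda)=\{e\in\mathfrak{X}_{J(\lambda)} : w_{J(\lambda)}e\sim_R w_{J(\lambda)}\}$ and $Y(\lambda)=\{x\in Z(\lambda) : x\text{ is not a prefix of any other }y\in Z(\lambda)\}$. A diagram $D$ is a non-empty finite subset of $\mathbb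 Z^2$ whose nodes $(a,b)$ have row index $a$ and column index $b$ (rows top to bottom, columns left to right), with no empty rows or columns, and both rows and columns indexed consecutively from $1$. $\mathcal D^{(\lambda)}$ is the set of diagrams whose $k$-th row has exactly $\lambda_k$ nodes for each $k$ (and having exactly $r$ rows). For a diagram $D$, $\dot D$ is the diagram obtained by rotating $D$ through $180^\circ$ (re-indexed so that rows and columns start from $1$). For a diagram $D$ of size $n$, $t^D$ and $t_D$ are the bijections $D\to\{1,\ldots,n\}$ filling the nodes of $D$ with $1,\ldots,n$ by rows and by columns respectively, and $w_D\in S_n$ is defined by $t^Dw_D=t_D$, where $tw$ is obtained from $t$ by replacing each entry $i$ by $iw$. For $d\in\mathfrak{X}_{J(\lambda)}$, $D(d,\lambda)$ is the unique diagram with the minimum number of columns among all $E\in\mathcal D^{(\lambda)}$ with $w_E=d$ (such diagrams exist, and the minimal one is known to be unique). A diagram is special if it is obtained from a Young diagram by permuting rows and columns. $\mathcal E^{(\lambda)}=\{D(y,\lambda) : y\in Y(\lambda)\}$ and $\mathcal E_s^{(\lambda)}=\{D\in\mathcal E^{(\lambda)} : D\text{ is special}\}$. *)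

theory Defs
  imports
    "HOL-Algebra.Sym_Groups"
    "HOL-Combinatorics.Permutations"
    "HOL-Library.Multiset"
begin

section \<open>Compositions and partitions\<close>

definition composition :: "nat list \<Rightarrow> bool" where
  "composition lam \<longleftrightarrow> (\<forall>x\<in>set lam. 0 < x)"

definition is_partition :: "nat list \<Rightarrow> bool" where
  "is_partition lam \<longleftrightarrow> composition lam \<and> sorted_wrt (\<ge>) lam"


section \<open>The symmetric group as a Coxeter group\<close>

text \<open>Elements of $S_n$ are functions \<open>w\<close> with \<open>w permutes {1..n}\<close>, and the value \<open>w i\<close> is the image
  $iw$ of \<open>i\<close> under the right action. Products are composed from left to right, so the
  product of \<open>x\<close> and \<open>y\<close> sends \<open>i\<close> to \<open>y (x i)\<close>.\<close>

abbreviation rprod :: "(nat \<Rightarrow> nat) \<Rightarrow> (nat \<Rightarrow> nat) \<Rightarrow> (nat \<Rightarrow> nat)" (infixl "\<cdot>" 70) where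
  "x \<cdot> y \<equiv> y \<circ> x"

definition simple_refl :: "nat \<Rightarrow> (nat \<Rightarrow> nat)" where
  "simple_refl i = Transposition.transpose i (Suc i)"

definition cox_gens :: "nat \<Rightarrow> (nat \<Rightarrow> nat) set" where
  "cox_gens n = {simple_refl i | i. 1 \<le> i \<and> i < n}"

definition word_prod :: "(nat \<Rightarrow> nat) list \<Rightarrow> (nat \<Rightarrow> nat)" where
  "word_prod ws = foldr (\<cdot>) ws id"

definition cox_length :: "nat \<Rightarrow> (nat \<Rightarrow> nat) \<Rightarrow> nat" where
  "cox_length n w = (LEAST k. \<exists>ws. set ws \<subseteq> cox_gens n \<and> word_prod ws = w \<and> length ws = k)"

definition reduced_expr :: "nat \<Rightarrow> (nat \<Rightarrow> nat) list \<Rightarrow> (nat \<Rightarrow> nat) \<Rightarrow> bool" where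
  "reduced_expr n ws w \<longleftrightarrow>
     set ws \<subseteq> cox_gens n \<and> word_prod ws = w \<and> length ws = cox_length n w"

definition cox_prefix :: "nat \<Rightarrow> (nat \<Rightarrow> nat) \<Rightarrow> (nat \<Rightarrow> nat) \<Rightarrow> bool" where
  "cox_prefix n x y \<longleftrightarrow> (\<exists>us vs. reduced_expr n us x \<and> reduced_expr n (us @ vs) y)"

definition J_of :: "nat list \<Rightarrow> (nat \<Rightarrow> nat) set" where
  "J_of lam = cox_gens (sum_list lam) -
     {simple_refl (sum_list (take k lam)) | k. 1 \<le> k \<and> k < length lam}"

text \<open>The multiplication of \<open>sym_group\<close> is composition from right to left, but the subgroup generated
  by a set does not depend on the order of composition.\<close>

definition W_J :: "nat list \<Rightarrow> (nat \<Rightarrow> nat) set" where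
  "W_J lam = generate (sym_group (sum_list lam)) (J_of lam)"

definition longest_J :: "nat list \<Rightarrow> (nat \<Rightarrow> nat)" where
  "longest_J lam = (THE w. w \<in> W_J lam \<and>
     (\<forall>v\<in>W_J lam. cox_length (sum_list lam) v \<le> cox_length (sum_list lam) w))"

definition min_reps :: "nat list \<Rightarrow> (nat \<Rightarrow> nat) set" where
  "min_reps lam = {d. d permutes {1..sum_list lam} \<and>
     (\<forall>v\<in>W_J lam. cox_length (sum_list lam) d \<le> cox_length (sum_list lam) (v \<cdot> d))}"


section \<open>Robinson--Schensted and right cells\<close>

text \<open>Tableaux are lists of rows. Inserting \<open>x\<close> into an increasing row either appends \<open>x\<close>
  (result \<open>None\<close>) or replaces the leftmost entry \<open>y\<close> greater than \<open>x\<close> (result \<open>Some y\<close>).\<close>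

fun row_insert :: "nat \<Rightarrow> nat list \<Rightarrow> nat list \<times> nat option" where
  "row_insert x [] = ([x], None)"
| "row_insert x (y # ys) =
     (if x < y then (x # ys, Some y)
      else (case row_insert x ys of (zs, b) \<Rightarrow> (y # zs, b)))"

text \<open>The second component is the (0-based) index of the row that has become longer.\<close>

fun tab_insert :: "nat \<Rightarrow> nat list list \<Rightarrow> nat list list \<times> nat" where
  "tab_insert x [] = ([[x]], 0)"
| "tab_insert x (r # rs) =
     (case row_insert x r of
        (r', None) \<Rightarrow> (r' # rs, 0)
      | (r', Some y) \<Rightarrow> (case tab_insert y rs of (rs', i) \<Rightarrow> (r' # rs', Suc i)))"

fun record_at :: "nat \<Rightarrow> nat \<Rightarrow> nat list list \<Rightarrow> nat list list" where
  "record_at k i [] = [[k]]"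
| "record_at k 0 (r # rs) = (r @ [k]) # rs"
| "record_at k (Suc i) (r # rs) = r # record_at k i rs"

text \<open>The pair (insertion tableau, recording tableau) obtained by inserting $1w, \ldots, nw$.\<close>

fun RS :: "nat \<Rightarrow> (nat \<Rightarrow> nat) \<Rightarrow> nat list list \<times> nat list list" where
  "RS 0 w = ([], [])"
| "RS (Suc n) w =
     (case RS n w of (P, Q) \<Rightarrow>
        (case tab_insert (w (Suc n)) P of (P', i) \<Rightarrow> (P', record_at (Suc n) i Q)))"

definition recording_tableau :: "nat \<Rightarrow> (nat \<Rightarrow> nat) \<Rightarrow> nat list list" where
  "recording_tableau n w = snd (RS n w)"

text \<open>The Kazhdan--Lusztig right cells of $S_n$, in their explicit description: the fibres of the
  recording tableau.\<close>

definition right_cell_equiv :: "nat \<Rightarrow> (nat \<Rightarrow> nat) \<Rightarrow> (nat \<Rightarrow> nat) \<Rightarrow> bool" where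
  "right_cell_equiv n w w' \<longleftrightarrow> recording_tableau n w = recording_tableau n w'"

definition Z_set :: "nat list \<Rightarrow> (nat \<Rightarrow> nat) set" where
  "Z_set lam = {e \<in> min_reps lam.
     right_cell_equiv (sum_list lam) (longest_J lam \<cdot> e) (longest_J lam)}"

definition Y_set :: "nat list \<Rightarrow> (nat \<Rightarrow> nat) set" where
  "Y_set lam = {x \<in> Z_set lam. \<not> (\<exists>y\<in>Z_set lam. y \<noteq> x \<and> cox_prefix (sum_list lam) x y)}"


section \<open>Diagrams\<close>

text \<open>A node is a pair (row index, column index). Both indices run consecutively from 1, so natural
  numbers suffice.\<close>

type_synonym diagram = "(nat \<times> nat) set"

definition is_diagram :: "diagram \<Rightarrow> bool" where
  "is_diagram D \<longleftrightarrow> finite D \<and> D \<noteq> {} \<and> (\<exists>r. fst ` D = {1..r}) \<and> (\<exists>c. snd ` D = {1..c})"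

definition nrows :: "diagram \<Rightarrow> nat" where
  "nrows D = card (fst ` D)"

definition ncols :: "diagram \<Rightarrow> nat" where
  "ncols D = card (snd ` D)"

text \<open>List entries are indexed from 0: the \<open>i\<close>-th part is \<open>lam ! (i - 1)\<close>.\<close>

definition young_diagram :: "nat list \<Rightarrow> diagram" where
  "young_diagram lam = {(i, j). 1 \<le> i \<and> i \<le> length lam \<and> 1 \<le> j \<and> j \<le> lam ! (i - 1)}"

definition diagrams_of :: "nat list \<Rightarrow> diagram set" where
  "diagrams_of lam = {D. is_diagram D \<and> nrows D = length lam \<and>
     (\<forall>k\<in>{1..length lam}. card {b. (k, b) \<in> D} = lam ! (k - 1))}"

definition rotate_diagram :: "diagram \<Rightarrow> diagram" where
  "rotate_diagram D = (\<lambda>(a, b). (nrows D + 1 - a, ncols D + 1 - b)) ` D"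

text \<open>The fillings $t^D$ (by rows) and $t_D$ (by columns): the entry at a node is its position in the
  row reading order, respectively the column reading order, of the nodes of \<open>D\<close>.\<close>

definition row_filling :: "diagram \<Rightarrow> nat \<times> nat \<Rightarrow> nat" where
  "row_filling D = (\<lambda>(a, b). card {(a', b') \<in> D. a' < a \<or> (a' = a \<and> b' \<le> b)})"

definition col_filling :: "diagram \<Rightarrow> nat \<times> nat \<Rightarrow> nat" where
  "col_filling D = (\<lambda>(a, b). card {(a', b') \<in> D. b' < b \<or> (b' = b \<and> a' \<le> a)})"

definition diagram_perm :: "diagram \<Rightarrow> (nat \<Rightarrow> nat)" where
  "diagram_perm D =
     (THE w. w permutes {1..card D} \<and> (\<forall>x\<in>D. w (row_filling D x) = col_filling D x))"

definition min_diagram :: "(nat \<Rightarrow> nat) \<Rightarrow> nat list \<Rightarrow> diagram" where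
  "min_diagram d lam = (THE D. D \<in> diagrams_of lam \<and> diagram_perm D = d \<and>
     (\<forall>E\<in>diagrams_of lam. diagram_perm E = d \<longrightarrow> ncols D \<le> ncols E))"

definition special_diagram :: "diagram \<Rightarrow> bool" where
  "special_diagram D \<longleftrightarrow> is_diagram D \<and>
     (\<exists>\<mu> \<sigma> \<tau>. is_partition \<mu> \<and>
        \<sigma> permutes (fst ` young_diagram \<mu>) \<and> \<tau> permutes (snd ` young_diagram \<mu>) \<and>
        D = (\<lambda>(a, b). (\<sigma> a, \<tau> b)) ` young_diagram \<mu>)"

definition E_set :: "nat list \<Rightarrow> diagram set" where
  "E_set lam = (\<lambda>y. min_diagram y lam) ` Y_set lam"

definition Es_set :: "nat list \<Rightarrow> diagram set" where
  "Es_set lam = {D \<in> E_set lam. special_diagram D}"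


section \<open>The diagrams for three-part compositions\<close>

definition G_diagram :: "nat \<Rightarrow> nat \<Rightarrow> nat \<Rightarrow> nat set \<Rightarrow> diagram" where
  "G_diagram s t u C =
     {(1, i) | i. i \<in> C \<union> {s - t + u + 1..s}} \<union> {(2, i) | i. i \<in> {1..s}} \<union> {(3, i) | i. i \<in> C}"

definition H_diagram :: "nat \<Rightarrow> nat \<Rightarrow> nat set \<Rightarrow> diagram" where
  "H_diagram s t C =
     {(1, i) | i. i \<in> {s - t + 1..s}} \<union> {(2, i) | i. i \<in> C} \<union> {(3, i) | i. i \<in> {1..s}}"

end

theory Submission
  imports Defs "HOL-Library.Product_Lexorder" "HOL-Library.Infinite_Set"
begin

text \<open>
  Let \<open>n = s + t + u\<close>. An element \<open>e\<close> of \<open>min_reps lam\<close> increases on each of the three blocks of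
  positions, and the longest element of the parabolic subgroup reverses the blocks. So the word \<open>w\<close> of
  \<open>longest_J lam \<cdot> e\<close> consists of three decreasing runs, and the question is when its recording
  tableau agrees with that of \<open>longest_J lam\<close>. Each run adds a vertical strip to the shape. As the
  lengths of the runs are the column lengths \<open>s\<close>, \<open>t\<close>, \<open>u\<close> in some order, the recording tableau
  agrees if and only if the final shape has first column of length at most \<open>s\<close> and first two columns
  of total length at most \<open>s + t\<close> (\<open>column_content_unique\<close>, \<open>new_row_three_runs\<close>). By Greene's theorem,
  which is proved from Knuth relations (\<open>greene_le\<close>, \<open>greene_ex\<close>), this says that a decreasing subsequence
  of \<open>w\<close> has length at most \<open>s\<close>, and two disjoint ones have total length at most \<open>s + t\<close>
  (\<open>Z_set_iff\<close>). The description is invariant under rotation by a half turn, which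
  reduces the six orders of the parts to three (\<open>Z_set_rotate\<close>).

  The bound holds for the permutation of a diagram with nested rows of lengths \<open>s\<close>, \<open>t\<close>, \<open>u\<close>, because
  its \<open>s\<close> columns become increasing subsequences, exactly \<open>u\<close> of them of length 3
  (\<open>diagram_perm_Z_set\<close>). Conversely, explicit families of decreasing
  subsequences turn the bounds into inequalities between the numbers of small values in the
  three blocks (\<open>Z_set_ineq1\<close>, \<open>Z_set_ineq2\<close>). The prefix order is inclusion of inversion sets
  (\<open>cox_prefix_iff\<close>), and the inversions of the permutation of a diagram are visible in the diagram
  (\<open>inversions_diagram_perm\<close>). So the inequalities allow a greedy choice of the set \<open>C\<close> of columns for
  which \<open>G_diagram\<close> or \<open>H_diagram\<close> dominates \<open>e\<close>, and different sets \<open>C\<close> give incomparable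
  permutations (\<open>rim_family_G\<close>, \<open>rim_family_H\<close>). Hence the permutations of these diagrams are the
  maximal elements. Finally, a diagram with a full row is the unique one with the
  fewest columns for its permutation (\<open>min_diagram_full_row\<close>).
\<close>

(* The literal 1 is kept, so that intervals {1..n} are not rewritten by the simplifier. *)
declare One_nat_def [simp del]

section \<open>Knuth relations and decreasing colourings\<close>

text \<open>The two outcomes of inserting \<open>x\<close> into an increasing row: it is appended, or it bumps the
  leftmost larger entry \<open>y\<close>.\<close>

lemma row_insert_cases:
  assumes "sorted_wrt (<) r" "x \<notin> set r"
  obtains (append) "row_insert x r = (r @ [x], None)" "\<forall>y\<in>set r. y < x"
  | (bump) p y q where "r = p @ y # q" "row_insert x r = (p @ x # q, Some y)"
      "\<forall>z\<in>set p. z < x" "x < y"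
proof -
  have "(row_insert x r = (r @ [x], None) \<and> (\<forall>y\<in>set r. y < x)) \<or>
    (\<exists>p y q. r = p @ y # q \<and> row_insert x r = (p @ x # q, Some y) \<and> (\<forall>z\<in>set p. z < x) \<and> x < y)"
    using assms
  proof (induction r)
    case (Cons a r)
    show ?case
    proof (cases "x < a")
      case True
      have "a # r = [] @ a # r \<and> row_insert x (a # r) = ([] @ x # r, Some a)"
        using True by simp
      then show ?thesis using True
        by (metis empty_iff list.set(1))
    next
      case False
      then have ax: "a < x" using Cons.prems by auto
      have "(row_insert x r = (r @ [x], None) \<and> (\<forall>y\<in>set r. y < x)) \<or>
        (\<exists>p y q. r = p @ y # q \<and> row_insert x r = (p @ x # q, Some y) \<and> (\<forall>z\<in>set p. z < x) \<and> x < y)"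
        using Cons by auto
      then show ?thesis
      proof
        assume "row_insert x r = (r @ [x], None) \<and> (\<forall>y\<in>set r. y < x)"
        then show ?thesis using False ax by auto
      next
        assume "\<exists>p y q. r = p @ y # q \<and> row_insert x r = (p @ x # q, Some y) \<and> (\<forall>z\<in>set p. z < x) \<and> x < y"
        then obtain p y q where "r = p @ y # q" "row_insert x r = (p @ x # q, Some y)"
          "\<forall>z\<in>set p. z < x" "x < y" by blast
        then have "a # r = (a # p) @ y # q \<and> row_insert x (a # r) = ((a # p) @ x # q, Some y) \<and>
          (\<forall>z\<in>set (a # p). z < x) \<and> x < y" using False ax by auto
        then show ?thesis by blast
      qed
    qed
  qed simp
  then show ?thesis using append bump by blast
qed

text \<open>The Knuth (plactic) equivalence on words. The two generating relations are named after the
  left-hand side, where \<open>x < y < z\<close>.\<close>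

inductive knuth :: "nat list \<Rightarrow> nat list \<Rightarrow> bool" where
  yxz: "x < y \<Longrightarrow> y < z \<Longrightarrow> knuth (p @ [y, x, z] @ q) (p @ [y, z, x] @ q)"
| xzy: "x < y \<Longrightarrow> y < z \<Longrightarrow> knuth (p @ [x, z, y] @ q) (p @ [z, x, y] @ q)"
| same: "knuth xs xs"
| flip: "knuth xs ys \<Longrightarrow> knuth ys xs"
| chain: "knuth xs ys \<Longrightarrow> knuth ys zs \<Longrightarrow> knuth xs zs"

lemma knuth_context: "knuth xs ys \<Longrightarrow> knuth (u @ xs @ v) (u @ ys @ v)"
proof (induction rule: knuth.induct)
  case (yxz x y z p q)
  then show ?case using knuth.yxz[of x y z "u @ p" "q @ v"] by simp
next
  case (xzy x y z p q)
  then show ?case using knuth.xzy[of x y z "u @ p" "q @ v"] by simp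
qed (blast intro: knuth.intros)+

lemma knuth_mset: "knuth xs ys \<Longrightarrow> mset xs = mset ys"
  by (induction rule: knuth.induct) auto

text \<open>A colouring \<open>c\<close> of the letters of a word picks out \<open>k\<close> disjoint decreasing subsequences, namely the
  letters of colour \<open>0, \<dots>, k - 1\<close>; any colour \<open>\<ge> k\<close> means that the letter is not used. Letters are
  identified with their values, which is adequate for words without repetitions.\<close>

definition dec_colouring :: "nat \<Rightarrow> (nat \<Rightarrow> nat) \<Rightarrow> nat list \<Rightarrow> bool" where
  "dec_colouring k c xs \<longleftrightarrow> sorted_wrt (\<lambda>x y. c x = c y \<longrightarrow> c x < k \<longrightarrow> y < x) xs"

definition num_coloured :: "nat \<Rightarrow> (nat \<Rightarrow> nat) \<Rightarrow> nat list \<Rightarrow> nat" where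
  "num_coloured k c xs = length (filter (\<lambda>x. c x < k) xs)"

definition has_colouring :: "nat \<Rightarrow> nat \<Rightarrow> nat list \<Rightarrow> bool" where
  "has_colouring k m xs \<longleftrightarrow> (\<exists>c. dec_colouring k c xs \<and> num_coloured k c xs = m)"

lemma num_coloured_cong:
  assumes "\<And>x. x \<in> set xs \<Longrightarrow> c x < k \<longleftrightarrow> c' x < k"
  shows "num_coloured k c xs = num_coloured k c' xs"
  unfolding num_coloured_def using assms by (metis (no_types, lifting) filter_cong)

lemma num_coloured_mset: "mset xs = mset ys \<Longrightarrow> num_coloured k c xs = num_coloured k c ys"
  unfolding num_coloured_def by (metis mset_filter size_mset)

text \<open>The letters covered by \<open>k\<close> disjoint decreasing subsequences are not changed in number by a Knuth
  relation. The only obstacle is a subsequence that uses both \<open>z\<close> and \<open>x\<close>, whose order is exchanged: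
  if \<open>y\<close> is unused, it replaces one of them, and if \<open>y\<close> lies on another subsequence, the two
  subsequences exchange their tails (here) or their heads (in the next lemma).\<close>

lemma colouring_yxz:
  assumes "x < y" "y < z" and d: "distinct (p @ [y, x, z] @ q)"
  shows "has_colouring k m (p @ [y, x, z] @ q) \<longleftrightarrow> has_colouring k m (p @ [y, z, x] @ q)"
    (is "has_colouring k m ?w \<longleftrightarrow> has_colouring k m ?w'")
proof
  assume "has_colouring k m ?w"
  then obtain c where c: "dec_colouring k c ?w" "num_coloured k c ?w = m"
    by (auto simp: has_colouring_def)
  have "dec_colouring k c ?w'"
    using c(1) assms by (auto simp: dec_colouring_def sorted_wrt_append)
  moreover have "num_coloured k c ?w' = m" using c(2) num_coloured_mset[of ?w ?w'] by simp
  ultimately show "has_colouring k m ?w'" by (auto simp: has_colouring_def)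
next
  assume "has_colouring k m ?w'"
  then obtain c where c: "dec_colouring k c ?w'" "num_coloured k c ?w' = m"
    by (auto simp: has_colouring_def)
  have cnt: "num_coloured k c ?w = m" using c(2) num_coloured_mset[of ?w ?w'] by simp
  consider (ok) "c x \<noteq> c z \<or> k \<le> c x" | (free) "c x = c z" "c x < k" "k \<le> c y"
    | (both) "c x = c z" "c x < k" "c y < k"
    by linarith
  then show "has_colouring k m ?w"
  proof cases
    case ok
    then have "dec_colouring k c ?w"
      using c(1) assms by (auto simp: dec_colouring_def sorted_wrt_append)
    with cnt show ?thesis by (auto simp: has_colouring_def)
  next
    case free
    \<comment> \<open>The unused letter \<open>y\<close> takes the place of \<open>z\<close>.\<close>
    define c' where "c' = c(z := c y, y := c x)"
    have old: "\<And>e. e \<in> set p \<union> set q \<union> {x} \<Longrightarrow> c' e = c e" using d assms by (auto simp: c'_def)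
    have new: "c' z = c y" "c' y = c x" using assms by (auto simp: c'_def)
    have "sorted_wrt (\<lambda>x y. c' x = c' y \<longrightarrow> c' x < k \<longrightarrow> y < x) p"
      using c(1) old by (auto simp: dec_colouring_def sorted_wrt_append intro: sorted_wrt_mono_rel[rotated])
    moreover have "sorted_wrt (\<lambda>x y. c' x = c' y \<longrightarrow> c' x < k \<longrightarrow> y < x) q"
      using c(1) old by (auto simp: dec_colouring_def sorted_wrt_append intro: sorted_wrt_mono_rel[rotated])
    ultimately have "dec_colouring k c' ?w"
      using c(1) assms old new free
      by (fastforce simp: dec_colouring_def sorted_wrt_append)
    moreover have "num_coloured k c' ?w = num_coloured k c ?w"
      using old new free num_coloured_cong[of p c' k c] num_coloured_cong[of q c' k c]
      by (auto simp: num_coloured_def)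
    ultimately show ?thesis using cnt by (auto simp: has_colouring_def)
  next
    case both
    then have ne: "c y \<noteq> c x" using c(1) assms
      by (auto simp: dec_colouring_def sorted_wrt_append)
    \<comment> \<open>The tails of the two subsequences after the window are exchanged.\<close>
    define c' where "c' = (\<lambda>e. if e \<in> set q \<union> {x} then Transposition.transpose (c x) (c y) (c e) else c e)"
    have old: "\<And>e. e \<in> set p \<union> {y, z} \<Longrightarrow> c' e = c e" using d assms by (auto simp: c'_def)
    have new: "c' x = c y" "\<And>e. e \<in> set q \<Longrightarrow> c' e = Transposition.transpose (c x) (c y) (c e)"
      by (auto simp: c'_def)
    have lt: "c' e < k \<longleftrightarrow> c e < k" for e using both
      by (auto simp: c'_def Transposition.transpose_def)
    have cz: "c' y = c y" "c' z = c x" using old both by auto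
    have cq: "c' e = (if c e = c x then c y else if c e = c y then c x else c e)" if "e \<in> set q" for e
      using new(2)[OF that] by (auto simp: Transposition.transpose_def)
    have P: "c e = c x \<longrightarrow> z < e" "c e = c y \<longrightarrow> y < e" if "e \<in> set p" for e
      using c(1) both that by (auto simp: dec_colouring_def sorted_wrt_append)
    have Q: "c e = c x \<longrightarrow> e < x" "c e = c y \<longrightarrow> e < y" if "e \<in> set q" for e
      using c(1) both that by (auto simp: dec_colouring_def sorted_wrt_append)
    have PQ: "c e = c g \<longrightarrow> c e < k \<longrightarrow> g < e" if "e \<in> set p" "g \<in> set q" for e g
      using c(1) that by (auto simp: dec_colouring_def sorted_wrt_append)
    have "sorted_wrt (\<lambda>x y. c x = c y \<longrightarrow> c x < k \<longrightarrow> y < x) q"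
      using c(1) by (auto simp: dec_colouring_def sorted_wrt_append)
    then have "sorted_wrt (\<lambda>x y. c' x = c' y \<longrightarrow> c' x < k \<longrightarrow> y < x) q"
      by (rule sorted_wrt_mono_rel[rotated]) (use cq both in \<open>auto split: if_splits\<close>)
    moreover have "sorted_wrt (\<lambda>x y. c x = c y \<longrightarrow> c x < k \<longrightarrow> y < x) p"
      using c(1) by (auto simp: dec_colouring_def sorted_wrt_append)
    then have "sorted_wrt (\<lambda>x y. c' x = c' y \<longrightarrow> c' x < k \<longrightarrow> y < x) p"
      by (rule sorted_wrt_mono_rel[rotated]) (use old in auto)
    moreover have "g < e" if "e \<in> set p" "g \<in> set q" "c' e = c' g" "c' e < k" for e g
      using P[OF that(1)] Q[OF that(2)] PQ[OF that(1,2)] old[of e] cq[OF that(2)] that assms(1,2) lt[of e]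
      by (auto split: if_splits)
    moreover have "c' e = c y \<longrightarrow> x < e \<and> y < e" "c' e = c x \<longrightarrow> z < e" if "e \<in> set p" for e
      using P[OF that] old[of e] that assms(1,2) by auto
    moreover have "c' e = c y \<longrightarrow> e < x \<and> e < y" "c' e = c x \<longrightarrow> e < z" if "e \<in> set q" for e
      using Q[OF that] cq[OF that] ne assms(1,2) by (auto split: if_splits)
    ultimately have "dec_colouring k c' ?w"
      using assms(1,2) cz new(1) ne unfolding dec_colouring_def sorted_wrt_append
      by simp
    moreover have "num_coloured k c' ?w = num_coloured k c ?w"
      using lt by (intro num_coloured_cong) auto
    ultimately show ?thesis using cnt by (auto simp: has_colouring_def)
  qed
qed

lemma colouring_xzy:
  assumes "x < y" "y < z" and d: "distinct (p @ [x, z, y] @ q)"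
  shows "has_colouring k m (p @ [x, z, y] @ q) \<longleftrightarrow> has_colouring k m (p @ [z, x, y] @ q)"
    (is "has_colouring k m ?w \<longleftrightarrow> has_colouring k m ?w'")
proof
  assume "has_colouring k m ?w"
  then obtain c where c: "dec_colouring k c ?w" "num_coloured k c ?w = m"
    by (auto simp: has_colouring_def)
  have "dec_colouring k c ?w'"
    using c(1) assms by (auto simp: dec_colouring_def sorted_wrt_append)
  moreover have "num_coloured k c ?w' = m" using c(2) num_coloured_mset[of ?w ?w'] by simp
  ultimately show "has_colouring k m ?w'" by (auto simp: has_colouring_def)
next
  assume "has_colouring k m ?w'"
  then obtain c where c: "dec_colouring k c ?w'" "num_coloured k c ?w' = m"
    by (auto simp: has_colouring_def)
  have cnt: "num_coloured k c ?w = m" using c(2) num_coloured_mset[of ?w ?w'] by simp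
  consider (ok) "c x \<noteq> c z \<or> k \<le> c x" | (free) "c x = c z" "c x < k" "k \<le> c y"
    | (both) "c x = c z" "c x < k" "c y < k"
    by linarith
  then show "has_colouring k m ?w"
  proof cases
    case ok
    then have "dec_colouring k c ?w"
      using c(1) assms by (auto simp: dec_colouring_def sorted_wrt_append)
    with cnt show ?thesis by (auto simp: has_colouring_def)
  next
    case free
    \<comment> \<open>The unused letter \<open>y\<close> takes the place of \<open>x\<close>.\<close>
    define c' where "c' = c(x := c y, y := c x)"
    have old: "\<And>e. e \<in> set p \<union> set q \<union> {z} \<Longrightarrow> c' e = c e" using d assms by (auto simp: c'_def)
    have new: "c' x = c y" "c' y = c x" using assms by (auto simp: c'_def)
    have "sorted_wrt (\<lambda>x y. c' x = c' y \<longrightarrow> c' x < k \<longrightarrow> y < x) p"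
      using c(1) old by (auto simp: dec_colouring_def sorted_wrt_append intro: sorted_wrt_mono_rel[rotated])
    moreover have "sorted_wrt (\<lambda>x y. c' x = c' y \<longrightarrow> c' x < k \<longrightarrow> y < x) q"
      using c(1) old by (auto simp: dec_colouring_def sorted_wrt_append intro: sorted_wrt_mono_rel[rotated])
    ultimately have "dec_colouring k c' ?w"
      using c(1) assms old new free
      by (fastforce simp: dec_colouring_def sorted_wrt_append)
    moreover have "num_coloured k c' ?w = num_coloured k c ?w"
      using old new free num_coloured_cong[of p c' k c] num_coloured_cong[of q c' k c]
      by (auto simp: num_coloured_def)
    ultimately show ?thesis using cnt by (auto simp: has_colouring_def)
  next
    case both
    then have ne: "c y \<noteq> c x" using c(1) assms
      by (auto simp: dec_colouring_def sorted_wrt_append)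
    \<comment> \<open>The heads of the two subsequences before the window are exchanged.\<close>
    define c' where "c' = (\<lambda>e. if e \<in> set p \<union> {z} then Transposition.transpose (c x) (c y) (c e) else c e)"
    have old: "\<And>e. e \<in> set q \<union> {y, x} \<Longrightarrow> c' e = c e" using d assms by (auto simp: c'_def)
    have new: "c' z = c y" "\<And>e. e \<in> set p \<Longrightarrow> c' e = Transposition.transpose (c x) (c y) (c e)"
      using both by (auto simp: c'_def)
    have lt: "c' e < k \<longleftrightarrow> c e < k" for e using both
      by (auto simp: c'_def Transposition.transpose_def)
    have cz: "c' y = c y" "c' x = c x" using old both by auto
    have cp: "c' e = (if c e = c x then c y else if c e = c y then c x else c e)" if "e \<in> set p" for e
      using new(2)[OF that] by (auto simp: Transposition.transpose_def)
    have P: "c e = c x \<longrightarrow> z < e" "c e = c y \<longrightarrow> y < e" if "e \<in> set p" for e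
      using c(1) both that by (auto simp: dec_colouring_def sorted_wrt_append)
    have Q: "c e = c x \<longrightarrow> e < x" "c e = c y \<longrightarrow> e < y" if "e \<in> set q" for e
      using c(1) both that by (auto simp: dec_colouring_def sorted_wrt_append)
    have PQ: "c e = c g \<longrightarrow> c e < k \<longrightarrow> g < e" if "e \<in> set p" "g \<in> set q" for e g
      using c(1) that by (auto simp: dec_colouring_def sorted_wrt_append)
    have "sorted_wrt (\<lambda>x y. c x = c y \<longrightarrow> c x < k \<longrightarrow> y < x) p"
      using c(1) by (auto simp: dec_colouring_def sorted_wrt_append)
    then have "sorted_wrt (\<lambda>x y. c' x = c' y \<longrightarrow> c' x < k \<longrightarrow> y < x) p"
      by (rule sorted_wrt_mono_rel[rotated]) (use cp both in \<open>auto split: if_splits\<close>)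
    moreover have "sorted_wrt (\<lambda>x y. c x = c y \<longrightarrow> c x < k \<longrightarrow> y < x) q"
      using c(1) by (auto simp: dec_colouring_def sorted_wrt_append)
    then have "sorted_wrt (\<lambda>x y. c' x = c' y \<longrightarrow> c' x < k \<longrightarrow> y < x) q"
      by (rule sorted_wrt_mono_rel[rotated]) (use old in auto)
    moreover have "g < e" if "e \<in> set p" "g \<in> set q" "c' e = c' g" "c' e < k" for e g
      using P[OF that(1)] Q[OF that(2)] PQ[OF that(1,2)] old[of g] cp[OF that(1)] that assms(1,2) lt[of e]
      by (auto split: if_splits)
    moreover have "c' e = c y \<longrightarrow> y < e \<and> z < e" "c' e = c x \<longrightarrow> x < e" if "e \<in> set p" for e
      using P[OF that] cp[OF that] ne assms(1,2) by (auto split: if_splits)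
    moreover have "c' e = c y \<longrightarrow> e < y \<and> e < z" "c' e = c x \<longrightarrow> e < x" if "e \<in> set q" for e
      using Q[OF that] old[of e] that assms(1,2) by auto
    ultimately have "dec_colouring k c' ?w"
      using assms(1,2) cz new(1) ne unfolding dec_colouring_def sorted_wrt_append
      by simp
    moreover have "num_coloured k c' ?w = num_coloured k c ?w"
      using lt by (intro num_coloured_cong) auto
    ultimately show ?thesis using cnt by (auto simp: has_colouring_def)
  qed
qed

lemma knuth_colouring:
  assumes "knuth xs ys" "distinct xs"
  shows "has_colouring k m xs \<longleftrightarrow> has_colouring k m ys"
  using assms
proof (induction rule: knuth.induct)
  case (flip xs ys)
  then show ?case by (metis knuth_mset mset_eq_imp_distinct_iff)
next
  case (chain xs ys zs)
  then show ?case by (metis knuth_mset mset_eq_imp_distinct_iff)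
next
  case (yxz x y z p q)
  then show ?case by (rule colouring_yxz)
next
  case (xzy x y z p q)
  then show ?case by (rule colouring_xzy)
qed simp

section \<open>Row insertion\<close>

lemma knuth_move_left:
  "sorted_wrt (<) (y # q) \<Longrightarrow> x < y \<Longrightarrow> knuth (y # q @ [x]) (y # x # q)"
proof (induction q arbitrary: y)
  case (Cons z q)
  have "knuth (z # q @ [x]) (z # x # q)" using Cons by auto
  then have "knuth (y # z # q @ [x]) (y # z # x # q)" using knuth_context[of _ _ "[y]" "[]"] by fastforce
  moreover have "knuth (y # z # x # q) (y # x # z # q)"
    using knuth.flip[OF knuth.yxz[of x y z "[]" q]] Cons.prems by simp
  ultimately show ?case using knuth.chain by fastforce
qed (simp add: knuth.same)

lemma knuth_move_front:
  "sorted_wrt (<) (p @ [x]) \<Longrightarrow> x < y \<Longrightarrow> knuth (p @ y # x # q) (y # p @ x # q)"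
proof (induction p arbitrary: x q rule: rev_induct)
  case (snoc z p)
  then have zx: "z < x" by (auto simp: sorted_wrt_append)
  have "knuth (p @ z # y # x # q) (p @ y # z # x # q)"
    using knuth.xzy[of z x y p q] zx snoc.prems by simp
  moreover have "knuth (p @ y # z # x # q) (y # p @ z # x # q)"
    using snoc.IH[of z "x # q"] snoc.prems zx by (auto simp: sorted_wrt_append)
  ultimately show ?case using knuth.chain by fastforce
qed (simp add: knuth.same)

text \<open>Bumping \<open>y\<close> by \<open>x\<close> is a Knuth equivalence between the row followed by \<open>x\<close> and \<open>y\<close> followed by
  the new row: \<open>x\<close> moves left past \<open>q\<close>, and then \<open>y\<close> moves left past \<open>p\<close>.\<close>

lemma knuth_row_insert:
  assumes "sorted_wrt (<) (p @ y # q)" "\<forall>z\<in>set p. z < x" "x < y"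
  shows "knuth (p @ y # q @ [x]) (y # p @ x # q)"
proof -
  have "knuth (y # q @ [x]) (y # x # q)"
    using assms by (intro knuth_move_left) (auto simp: sorted_wrt_append)
  then have "knuth (p @ y # q @ [x]) (p @ y # x # q)" using knuth_context[of _ _ p "[]"] by fastforce
  moreover have "knuth (p @ y # x # q) (y # p @ x # q)"
    using assms by (intro knuth_move_front) (auto simp: sorted_wrt_append)
  ultimately show ?thesis using knuth.chain by blast
qed

text \<open>\<open>row_below r r'\<close>: the row \<open>r'\<close> fits below \<open>r\<close>, that is, it is not longer and columns increase
  downwards.\<close>

definition row_below :: "nat list \<Rightarrow> nat list \<Rightarrow> bool" where
  "row_below r r' \<longleftrightarrow> length r' \<le> length r \<and> (\<forall>i<length r'. r ! i < r' ! i)"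

text \<open>Fillings of partition shapes that increase along rows and down columns. The entries need not be
  consecutive.\<close>

fun tableau :: "nat list list \<Rightarrow> bool" where
  "tableau [] \<longleftrightarrow> True"
| "tableau (r # rs) \<longleftrightarrow> sorted_wrt (<) r \<and> r \<noteq> [] \<and> (rs \<noteq> [] \<longrightarrow> row_below r (hd rs)) \<and> tableau rs"

text \<open>The row reading word: the rows are read from bottom to top.\<close>

definition reading_word :: "nat list list \<Rightarrow> nat list" where
  "reading_word T = concat (rev T)"

lemma reading_word_simps [simp]:
  "reading_word [] = []" "reading_word (r # rs) = reading_word rs @ r"
  by (auto simp: reading_word_def)

text \<open>The classical bumping argument: an entry bumped out of a row enters the next row weakly further
  to the left, so that columns stay increasing.\<close>

lemma row_below_bump:
  assumes s: "sorted_wrt (<) (p @ y # q)" "\<forall>z\<in>set p. z < x" "x < y"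
    and b: "row_below (p @ y # q) r" "sorted_wrt (<) r" "y \<notin> set r"
  shows "row_below (p @ x # q) (fst (row_insert y r))"
  using b(2,3)
proof (cases rule: row_insert_cases)
  case append
  have len: "length r \<le> length p"
  proof (rule ccontr)
    assume "\<not> length r \<le> length p"
    then have "(p @ y # q) ! length p < r ! length p" using b(1)
      by (meson not_le row_below_def)
    moreover have "r ! length p < y" using append(2) \<open>\<not> length r \<le> length p\<close> by simp
    ultimately show False by simp
  qed
  have "(p @ x # q) ! i < (r @ [y]) ! i" if "i < length (r @ [y])" for i
  proof (cases "i = length r")
    case True
    moreover have "p ! i < y" if "i < length p" using s that by (meson less_trans nth_mem)
    ultimately have "(p @ x # q) ! i < y" using len s(3) by (cases "i = length p") (auto simp: nth_append)
    then show ?thesis using True by simp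
  next
    case False
    then have "i < length r" using that by simp
    then have "(p @ y # q) ! i < r ! i" using b(1) unfolding row_below_def by blast
    then show ?thesis using \<open>i < length r\<close> len by (simp add: nth_append)
  qed
  moreover have "length (r @ [y]) \<le> length (p @ x # q)" using len by simp
  ultimately show ?thesis using append(1) unfolding row_below_def by simp
next
  case (bump p2 y2 q2)
  have len: "length p2 \<le> length p"
  proof (rule ccontr)
    assume "\<not> length p2 \<le> length p"
    then have "length p < length r" using bump(1) by simp
    then have "(p @ y # q) ! length p < r ! length p" using b(1) unfolding row_below_def by blast
    moreover have "r ! length p < y" using bump(1,3) \<open>\<not> length p2 \<le> length p\<close>
      by (simp add: nth_append)
    ultimately show False by simp
  qed
  have "(p @ x # q) ! i < (p2 @ y # q2) ! i" if "i < length r" for i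
  proof (cases "i = length p2")
    case True
    moreover have "p ! i < y" if "i < length p" using s that by (meson less_trans nth_mem)
    ultimately have "(p @ x # q) ! i < y" using len s(3) by (cases "i = length p") (auto simp: nth_append)
    then show ?thesis using True by simp
  next
    case False
    have "(p @ y # q) ! i < r ! i" using b(1) that unfolding row_below_def by blast
    moreover have "r ! i = (p2 @ y # q2) ! i" using False bump(1) by (auto simp: nth_append nth_Cons')
    moreover have "(p @ x # q) ! i \<le> (p @ y # q) ! i" using s(3) by (cases "i = length p") (simp_all add: nth_append nth_Cons')
    ultimately show ?thesis by simp
  qed
  moreover have "length r \<le> length (p @ x # q)" using b(1) by (simp add: row_below_def)
  ultimately show ?thesis using bump(1,2) unfolding row_below_def by simp
qed

lemma tab_insert_row: "tab_insert x T = (T', i) \<Longrightarrow> T \<noteq> [] \<Longrightarrow> T' \<noteq> [] \<and> hd T' = fst (row_insert x (hd T))"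
  by (cases T) (auto split: prod.splits option.splits)

lemma tab_insert_knuth_tableau:
  assumes "tableau T" "distinct (reading_word T)" "x \<notin> set (reading_word T)" "tab_insert x T = (T', i)"
  shows "tableau T' \<and> knuth (reading_word T @ [x]) (reading_word T')"
  using assms
proof (induction T arbitrary: x T' i)
  case Nil
  then show ?case by (auto intro: knuth.same)
next
  case (Cons r rs)
  have r: "sorted_wrt (<) r" "x \<notin> set r" using Cons.prems by auto
  then show ?case
  proof (cases rule: row_insert_cases)
    case append
    then have T': "T' = (r @ [x]) # rs" using Cons.prems by auto
    have "row_below (r @ [x]) (hd rs)" if "rs \<noteq> []"
      using Cons.prems that by (auto simp: row_below_def nth_append)
    then show ?thesis using T' Cons.prems append by (auto simp: sorted_wrt_append intro: knuth.same)
  next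
    case (bump p y q)
    obtain rs' j where ins: "tab_insert y rs = (rs', j)" by fastforce
    have T': "T' = (p @ x # q) # rs'" using bump ins Cons.prems by auto
    have y: "y \<notin> set (reading_word rs)" using Cons.prems bump by auto
    have IH: "tableau rs' \<and> knuth (reading_word rs @ [y]) (reading_word rs')"
      using Cons.IH[OF _ _ y ins] Cons.prems by auto
    have below: "row_below (p @ x # q) (hd rs')"
    proof (cases rs)
      case Nil
      then show ?thesis using ins bump by (cases p) (auto simp: row_below_def)
    next
      case (Cons r2 rs2)
      then have "hd rs' = fst (row_insert y r2)" using tab_insert_row[OF ins] by simp
      moreover have "row_below (p @ x # q) (fst (row_insert y r2))"
        using Cons.prems bump Cons r y by (intro row_below_bump) auto
      ultimately show ?thesis by simp
    qed
    have "sorted_wrt (<) (p @ x # q)" using r bump by (force simp: sorted_wrt_append)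
    moreover have "knuth (reading_word rs @ r @ [x]) (reading_word rs @ y # p @ x # q)"
      using knuth_context[OF knuth_row_insert[of p y q x], of "reading_word rs" "[]"] r bump by simp
    moreover have "knuth (reading_word rs @ y # p @ x # q) (reading_word rs' @ p @ x # q)"
      using knuth_context[OF conjunct2[OF IH], of "[]" "p @ x # q"] by simp
    ultimately show ?thesis using IH T' below knuth.chain by fastforce
  qed
qed

lemma row_below_trans: "row_below r s \<Longrightarrow> row_below s u \<Longrightarrow> row_below r u"
  unfolding row_below_def by (meson less_le_trans less_trans order_trans)

lemma tableau_row_below: "tableau (r # rs) \<Longrightarrow> r' \<in> set rs \<Longrightarrow> row_below r r'"
proof (induction rs arbitrary: r)
  case (Cons a rs)
  then show ?case using row_below_trans by auto
qed simp

lemma tableau_colouring: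
  assumes "tableau T" and "\<And>r j. r \<in> set T \<Longrightarrow> j < length r \<Longrightarrow> c (r ! j) = j"
  shows "dec_colouring k c (reading_word T)"
    and "num_coloured k c (reading_word T) = (\<Sum>r\<leftarrow>T. min k (length r))"
proof -
  show "dec_colouring k c (reading_word T)"
    using assms
  proof (induction T)
    case (Cons r rs)
    have "sorted_wrt (\<lambda>x y. c x = c y \<longrightarrow> c x < k \<longrightarrow> y < x) r"
      using Cons.prems(2)[of r] by (auto simp: sorted_wrt_iff_nth_less)
    moreover have "y < x" if "x \<in> set (reading_word rs)" "y \<in> set r" "c x = c y" for x y
    proof -
      obtain r' where "r' \<in> set rs" "x \<in> set r'"
        using \<open>x \<in> set (reading_word rs)\<close> by (auto simp: reading_word_def)
      then obtain j where r': "r' \<in> set rs" "x = r' ! j" "j < length r'"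
        by (auto simp: in_set_conv_nth)
      obtain i where i: "y = r ! i" "i < length r" using \<open>y \<in> set r\<close> by (auto simp: in_set_conv_nth)
      have "c y = i" "c x = j" using Cons.prems(2)[of r i] Cons.prems(2)[of r' j] r' i by simp_all
      then have "i = j" using that(3) by simp
      then show ?thesis using tableau_row_below[OF Cons.prems(1) r'(1)] r' i unfolding row_below_def by blast
    qed
    moreover have "dec_colouring k c (reading_word rs)" using Cons by simp
    ultimately show ?case unfolding dec_colouring_def reading_word_simps sorted_wrt_append by blast
  qed (simp add: dec_colouring_def)
  show "num_coloured k c (reading_word T) = (\<Sum>r\<leftarrow>T. min k (length r))"
    using assms(2)
  proof (induction T)
    case (Cons r rs)
    have "{i. i < length r \<and> c (r ! i) < k} = {..<min k (length r)}"
      using Cons.prems[of r] by auto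
    then have "length (filter (\<lambda>x. c x < k) r) = min k (length r)"
      by (simp add: length_filter_conv_card)
    moreover have "num_coloured k c (reading_word rs) = (\<Sum>r\<leftarrow>rs. min k (length r))"
      using Cons by simp
    ultimately show ?case by (simp add: num_coloured_def)
  qed (simp add: num_coloured_def)
qed

text \<open>The columns of a tableau are decreasing subsequences of its reading word.\<close>

lemma tableau_has_colouring:
  assumes "tableau T" "distinct (reading_word T)"
  shows "has_colouring k (\<Sum>r\<leftarrow>T. min k (length r)) (reading_word T)"
proof -
  define c where "c v = (LEAST j. \<exists>r\<in>set T. j < length r \<and> r ! j = v)" for v
  have "c (r ! j) = j" if "r \<in> set T" "j < length r" for r j
  proof -
    have "j' = j" if "r' \<in> set T" "j' < length r'" "r' ! j' = r ! j" for r' j'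
    proof -
      have "distinct (concat (rev T))" using assms(2) by (simp add: reading_word_def)
      then have d: "distinct r" "r' \<noteq> r \<Longrightarrow> set r' \<inter> set r = {}"
        using that(1) \<open>r \<in> set T\<close> unfolding distinct_concat_iff by auto
      have "r' = r" using that \<open>j < length r\<close> d(2) by (metis disjoint_iff nth_mem)
      then show ?thesis using that \<open>j < length r\<close> d(1) by (auto simp: nth_eq_iff_index_eq)
    qed
    then show ?thesis unfolding c_def using that by (intro Least_equality) auto
  qed
  from tableau_colouring[OF assms(1) this] show ?thesis unfolding has_colouring_def by blast
qed

text \<open>Rows are increasing, so a decreasing subsequence of the reading word meets each row at most once.\<close>

lemma tableau_colouring_le:
  assumes "tableau T" "distinct (reading_word T)" "dec_colouring k c (reading_word T)"
  shows "num_coloured k c (reading_word T) \<le> (\<Sum>r\<leftarrow>T. min k (length r))"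
  using assms
proof (induction T)
  case (Cons r rs)
  have "length (filter (\<lambda>x. c x < k) r) = card {x \<in> set r. c x < k}"
    using Cons.prems by (simp add: distinct_length_filter Collect_conj_eq Int_commute)
  also have "\<dots> \<le> card {..<k}"
  proof (rule card_inj_on_le[of c])
    have "sorted_wrt (<) r" "sorted_wrt (\<lambda>x y. c x = c y \<longrightarrow> c x < k \<longrightarrow> y < x) r"
      using Cons.prems by (auto simp: dec_colouring_def sorted_wrt_append)
    then have *: "\<And>i j. i < j \<Longrightarrow> j < length r \<Longrightarrow> c (r ! i) < k \<Longrightarrow> c (r ! i) \<noteq> c (r ! j)"
      unfolding sorted_wrt_iff_nth_less by (meson less_asym)
    show "inj_on c {x \<in> set r. c x < k}"
    proof (rule inj_onI)
      fix x y assume h: "x \<in> {x \<in> set r. c x < k}" "y \<in> {x \<in> set r. c x < k}" "c x = c y"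
      then obtain i j where "x = r ! i" "i < length r" "y = r ! j" "j < length r"
        by (auto simp: in_set_conv_nth)
      with h show "x = y" using *[of i j] *[of j i] by (metis linorder_neqE_nat mem_Collect_eq)
    qed
  qed auto
  finally have "length (filter (\<lambda>x. c x < k) r) \<le> k" by simp
  then have "length (filter (\<lambda>x. c x < k) r) \<le> min k (length r)" using length_filter_le by simp
  moreover have "num_coloured k c (reading_word rs) \<le> (\<Sum>r\<leftarrow>rs. min k (length r))"
    using Cons by (auto simp: dec_colouring_def sorted_wrt_append)
  ultimately have "num_coloured k c (reading_word rs) + length (filter (\<lambda>x. c x < k) r)
      \<le> (\<Sum>r\<leftarrow>rs. min k (length r)) + min k (length r)" by (rule add_mono[rotated])
  then show ?case by (simp add: num_coloured_def add.commute del: min.bounded_iff)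
qed (simp add: num_coloured_def)

section \<open>Shapes of the Robinson--Schensted tableaux\<close>

text \<open>The length of row \<open>r\<close> of a tableau, counted from 0, and 0 beyond the last row.\<close>

definition row_length :: "nat list list \<Rightarrow> nat \<Rightarrow> nat" where
  "row_length T r = (if r < length T then length (T ! r) else 0)"

lemma row_length_Nil [simp]: "row_length [] r = 0"
  by (simp add: row_length_def)

lemma row_length_Cons: "row_length (q # T) r = (case r of 0 \<Rightarrow> length q | Suc r' \<Rightarrow> row_length T r')"
  by (auto simp: row_length_def split: nat.splits)

lemma row_insert_length:
  "row_insert x r = (r', b) \<Longrightarrow> length r' = (if b = None then Suc (length r) else length r)"
  by (induction r arbitrary: r' b) (auto split: if_splits prod.splits)

lemma tab_insert_shape:
  "tab_insert x T = (T', i) \<Longrightarrow> i \<le> length T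
    \<and> length T' = (if i = length T then Suc (length T) else length T)
    \<and> row_length T' r = row_length T r + (if r = i then 1 else 0)"
proof (induction T arbitrary: x T' i r)
  case Nil
  then show ?case by (auto simp: row_length_Cons split: nat.splits)
next
  case (Cons q T)
  obtain q' b where q: "row_insert x q = (q', b)" by fastforce
  show ?case
  proof (cases b)
    case None
    then show ?thesis using Cons.prems q row_insert_length[OF q]
      by (auto simp: row_length_Cons split: nat.splits)
  next
    case (Some y)
    obtain T2 j where T2: "tab_insert y T = (T2, j)" by fastforce
    then have "T' = q' # T2" "i = Suc j" using Cons.prems q Some by auto
    then show ?thesis using Cons.IH[OF T2, of "r - 1"] row_insert_length[OF q] Some
      by (auto simp: row_length_Cons split: nat.splits)
  qed
qed

lemma record_at_shape:
  "i \<le> length Q \<Longrightarrow> length (record_at k i Q) = (if i = length Q then Suc (length Q) else length Q)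
    \<and> row_length (record_at k i Q) r = row_length Q r + (if r = i then 1 else 0)"
proof (induction k i Q arbitrary: r rule: record_at.induct)
  case (3 k i q Q)
  then show ?case using "3.IH"[of "r - 1"] by (auto simp: row_length_Cons split: nat.splits)
qed (auto simp: row_length_Cons split: nat.splits)

text \<open>The index of the row that grows when the \<open>i\<close>-th letter of \<open>w\<close> is inserted. These indices determine
  the recording tableau.\<close>

definition new_row :: "(nat \<Rightarrow> nat) \<Rightarrow> nat \<Rightarrow> nat" where
  "new_row w i = snd (tab_insert (w i) (fst (RS (i - 1) w)))"

text \<open>The length of row \<open>r\<close> after \<open>n\<close> insertions, expressed through the growing rows.\<close>

definition row_count :: "nat \<Rightarrow> (nat \<Rightarrow> nat) \<Rightarrow> nat \<Rightarrow> nat" where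
  "row_count n w r = card {i \<in> {1..n}. new_row w i = r}"

lemma RS_Suc_new_row:
  "RS (Suc n) w = (fst (tab_insert (w (Suc n)) (fst (RS n w))),
     record_at (Suc n) (new_row w (Suc n)) (snd (RS n w)))"
  by (simp add: new_row_def split: prod.splits)

lemma row_count_Suc: "row_count (Suc n) w r = row_count n w r + (if r = new_row w (Suc n) then 1 else 0)"
proof -
  have "{i \<in> {1..Suc n}. new_row w i = r} =
    (if r = new_row w (Suc n) then insert (Suc n) {i \<in> {1..n}. new_row w i = r}
     else {i \<in> {1..n}. new_row w i = r})"
    by (auto simp: le_Suc_eq)
  then show ?thesis unfolding row_count_def by auto
qed

lemma RS_shape:
  "length (fst (RS n w)) \<le> n \<and> length (snd (RS n w)) = length (fst (RS n w))
   \<and> row_length (fst (RS n w)) r = row_count n w r \<and> row_length (snd (RS n w)) r = row_count n w r"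
proof (induction n)
  case 0
  then show ?case by (simp add: row_count_def)
next
  case (Suc n)
  let ?T = "fst (RS n w)"
  have "tab_insert (w (Suc n)) ?T = (fst (tab_insert (w (Suc n)) ?T), new_row w (Suc n))"
    by (simp add: new_row_def)
  from tab_insert_shape[OF this]
  have *: "new_row w (Suc n) \<le> length ?T"
    "length (fst (tab_insert (w (Suc n)) ?T)) = (if new_row w (Suc n) = length ?T then Suc (length ?T) else length ?T)"
    "\<And>r. row_length (fst (tab_insert (w (Suc n)) ?T)) r = row_length ?T r + (if r = new_row w (Suc n) then 1 else 0)"
    by blast+
  have "new_row w (Suc n) \<le> length (snd (RS n w))" using * Suc by simp
  from record_at_shape[OF this, of "Suc n" r] show ?case
    using * Suc unfolding RS_Suc_new_row row_count_Suc by simp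
qed

lemma new_row_less: "1 \<le> i \<Longrightarrow> new_row w i < i"
proof -
  assume i: "1 \<le> i"
  have "tab_insert (w i) (fst (RS (i - 1) w)) = (fst (tab_insert (w i) (fst (RS (i - 1) w))), new_row w i)"
    by (simp add: new_row_def)
  from tab_insert_shape[OF this] have "new_row w i \<le> length (fst (RS (i - 1) w))" by blast
  also have "\<dots> \<le> i - 1" using RS_shape by blast
  finally show ?thesis using i by simp
qed

lemma recording_tableau_cong:
  "(\<And>i. 1 \<le> i \<Longrightarrow> i \<le> n \<Longrightarrow> new_row w i = new_row w' i) \<Longrightarrow> recording_tableau n w = recording_tableau n w'"
proof (induction n)
  case (Suc n)
  then have "recording_tableau n w = recording_tableau n w'" by simp
  then show ?case using Suc.prems[of "Suc n"] unfolding recording_tableau_def RS_Suc_new_row by simp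
qed (simp add: recording_tableau_def)

lemma distinct_set_map_upt: "distinct (map w [1..<Suc n]) \<longleftrightarrow> inj_on w {1..n}"
    "set (map w [1..<Suc n]) = w ` {1..n}"
  by (simp_all add: distinct_map atLeastLessThanSuc_atLeastAtMost del: upt_Suc)

lemma RS_tableau:
  assumes "inj_on w {1..n}"
  shows "tableau (fst (RS n w)) \<and> knuth (map w [1..<Suc n]) (reading_word (fst (RS n w)))"
  using assms
proof (induction n)
  case 0
  then show ?case by (simp add: knuth.same)
next
  case (Suc n)
  let ?T = "fst (RS n w)"
  have IH: "tableau ?T" "knuth (map w [1..<Suc n]) (reading_word ?T)"
    using Suc inj_on_subset[OF Suc.prems, of "{1..n}"] by auto
  have d: "inj_on w {1..n}" "w (Suc n) \<notin> w ` {1..n}"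
    using Suc.prems by (auto simp: atLeastAtMostSuc_conv)
  have m: "mset (reading_word ?T) = mset (map w [1..<Suc n])" using knuth_mset[OF IH(2)] by simp
  have d1: "distinct (reading_word ?T)"
    using d(1) mset_eq_imp_distinct_iff[OF m] distinct_set_map_upt(1) by blast
  have d2: "w (Suc n) \<notin> set (reading_word ?T)"
    using d(2) mset_eq_setD[OF m] distinct_set_map_upt(2) by metis
  have ins: "tab_insert (w (Suc n)) ?T = (fst (tab_insert (w (Suc n)) ?T), new_row w (Suc n))"
    by (simp add: new_row_def)
  have "knuth (map w [1..<Suc (Suc n)]) (reading_word ?T @ [w (Suc n)])"
    using knuth_context[OF IH(2), of "[]" "[w (Suc n)]"] by simp
  then show ?case
    using tab_insert_knuth_tableau[OF IH(1) d1 d2 ins] unfolding RS_Suc_new_row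
    by (auto intro: knuth.chain)
qed

lemma RS_distinct:
  assumes "inj_on w {1..n}"
  shows "distinct (reading_word (fst (RS n w)))" "set (reading_word (fst (RS n w))) = w ` {1..n}"
proof -
  have m: "mset (reading_word (fst (RS n w))) = mset (map w [1..<Suc n])"
    using knuth_mset RS_tableau[OF assms] by metis
  show "set (reading_word (fst (RS n w))) = w ` {1..n}" using mset_eq_setD[OF m] distinct_set_map_upt(2) by metis
  show "distinct (reading_word (fst (RS n w)))"
    using mset_eq_imp_distinct_iff[OF m] assms distinct_set_map_upt(1) by blast
qed

text \<open>Row bumping: a smaller letter inserted next lengthens a lower row.\<close>

lemma tab_insert_descent:
  assumes "tableau T" "distinct (reading_word T)" "x \<notin> set (reading_word T)" "y < x"
    and "tab_insert x T = (T', i)" "tab_insert y T' = (T'', j)"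
  shows "i < j"
  using assms
proof (induction T arbitrary: x y T' T'' i j)
  case Nil
  then show ?case by auto
next
  case (Cons r rs)
  have r: "sorted_wrt (<) r" "x \<notin> set r" using Cons.prems by auto
  then show ?case
  proof (cases rule: row_insert_cases)
    case append
    then have T': "T' = (r @ [x]) # rs" "i = 0" using Cons.prems by auto
    have "\<exists>r' y'. row_insert y (r @ [x]) = (r', Some y')"
      using \<open>y < x\<close> by (induction r) (auto split: prod.splits)
    then show ?thesis using T' Cons.prems by (auto split: prod.splits)
  next
    case (bump p x' q)
    obtain rs' i' where ins: "tab_insert x' rs = (rs', i')" by fastforce
    have T': "T' = (p @ x # q) # rs'" "i = Suc i'" using bump ins Cons.prems by auto
    have "\<exists>r' y'. row_insert y (p @ x # q) = (r', Some y') \<and> y' \<le> x"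
      using \<open>y < x\<close> bump(3) by (induction p) (auto split: prod.splits)
    then obtain r' y' where y': "row_insert y (p @ x # q) = (r', Some y')" "y' \<le> x" by blast
    obtain rs'' j' where ins': "tab_insert y' rs' = (rs'', j')" by fastforce
    have "j = Suc j'" using y' ins' T' Cons.prems by auto
    moreover have "i' < j'"
      using Cons.IH[OF _ _ _ _ ins ins'] Cons.prems bump y' by auto
    ultimately show ?thesis using T' by simp
  qed
qed

lemma new_row_descent:
  assumes "inj_on w {1..n}" "1 \<le> i" "i < n" "w (Suc i) < w i"
  shows "new_row w i < new_row w (Suc i)"
proof -
  obtain m where m: "i = Suc m" using assms(2) by (cases i) auto
  have inj: "inj_on w {1..m}" using assms(1) by (rule inj_on_subset) (use assms m in auto)
  have "w i \<notin> w ` {1..m}"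
  proof
    assume "w i \<in> w ` {1..m}"
    then obtain j where "j \<in> {1..m}" "w i = w j" by blast
    then show False using inj_onD[OF assms(1), of i j] assms(2,3) m by simp
  qed
  then have "w i \<notin> set (reading_word (fst (RS m w)))"
    using RS_distinct(2)[OF inj] by simp
  moreover have "tab_insert (w i) (fst (RS m w)) = (fst (RS i w), new_row w i)"
    unfolding m RS_Suc_new_row by (simp add: new_row_def)
  moreover have "tab_insert (w (Suc i)) (fst (RS i w)) = (fst (RS (Suc i) w), new_row w (Suc i))"
    unfolding RS_Suc_new_row by (simp add: new_row_def)
  ultimately show ?thesis
    using tab_insert_descent RS_tableau[OF inj] RS_distinct(1)[OF inj] assms(4) by blast
qed

section \<open>Greene's theorem for decreasing subsequences\<close>

text \<open>As \<open>dec_colouring\<close>, but for the word \<open>w 1, \<dots>, w n\<close> and with positions instead of letters coloured.\<close>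

definition pos_colouring :: "nat \<Rightarrow> nat \<Rightarrow> (nat \<Rightarrow> nat) \<Rightarrow> (nat \<Rightarrow> nat) \<Rightarrow> bool" where
  "pos_colouring n k w c \<longleftrightarrow>
     (\<forall>i j. 1 \<le> i \<and> i < j \<and> j \<le> n \<and> c i = c j \<and> c i < k \<longrightarrow> w j < w i)"

text \<open>The sum of the lengths of the first \<open>k\<close> columns of the insertion tableau.\<close>

definition column_sum :: "nat \<Rightarrow> nat \<Rightarrow> (nat \<Rightarrow> nat) \<Rightarrow> nat" where
  "column_sum n k w = (\<Sum>r<n. min k (row_count n w r))"

lemma dec_colouring_map:
  "dec_colouring k c (map w [1..<Suc n]) \<longleftrightarrow> pos_colouring n k w (c \<circ> w)"
proof -
  have "sorted_wrt R [1..<Suc n] \<longleftrightarrow> (\<forall>i j. 1 \<le> i \<and> i < j \<and> j \<le> n \<longrightarrow> R i j)" for R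
  proof (induction n)
    case (Suc n)
    have "[1..<Suc (Suc n)] = [1..<Suc n] @ [Suc n]" by simp
    then show ?case using Suc by (auto simp: sorted_wrt_append le_Suc_eq simp del: upt_Suc)
  qed simp
  then show ?thesis by (auto simp: dec_colouring_def pos_colouring_def sorted_wrt_map simp del: upt_Suc)
qed

lemma num_coloured_map: "num_coloured k c (map w [1..<Suc n]) = card {i \<in> {1..n}. c (w i) < k}"
proof -
  have "num_coloured k c (map w [1..<Suc n]) = length (filter (\<lambda>i. c (w i) < k) [1..<Suc n])"
    by (simp add: num_coloured_def filter_map o_def del: upt_Suc)
  also have "\<dots> = card (set (filter (\<lambda>i. c (w i) < k) [1..<Suc n]))"
    by (intro distinct_card[symmetric] distinct_filter distinct_upt)
  also have "set (filter (\<lambda>i. c (w i) < k) [1..<Suc n]) = {i \<in> {1..n}. c (w i) < k}" by auto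
  finally show ?thesis .
qed

lemma column_sum_RS: "(\<Sum>r\<leftarrow>fst (RS n w). min k (length r)) = column_sum n k w"
proof -
  let ?T = "fst (RS n w)"
  have "(\<Sum>r\<leftarrow>?T. min k (length r)) = (\<Sum>r<length ?T. min k (row_length ?T r))"
    by (simp add: sum_list_sum_nth row_length_def atLeast0LessThan)
  also have "\<dots> = (\<Sum>r<n. min k (row_length ?T r))"
    using RS_shape[of n w] by (intro sum.mono_neutral_left) (auto simp: row_length_def)
  also have "\<dots> = column_sum n k w" using RS_shape[of n w] by (simp add: column_sum_def)
  finally show ?thesis .
qed

text \<open>Greene's theorem, in two halves: the maximal number of letters covered by \<open>k\<close> disjoint decreasing
  subsequences is the sum of the lengths of the first \<open>k\<close> columns.\<close>

lemma greene_le: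
  assumes inj: "inj_on w {1..n}" and c: "pos_colouring n k w c"
  shows "card {i \<in> {1..n}. c i < k} \<le> column_sum n k w"
proof -
  let ?ws = "map w [1..<Suc n]" and ?T = "fst (RS n w)"
  define c' where "c' = c \<circ> inv_into {1..n} w"
  have c': "c' (w i) = c i" if "1 \<le> i" "i \<le> n" for i using that inj by (simp add: c'_def)
  have "pos_colouring n k w (c' \<circ> w)" using c c' by (auto simp: pos_colouring_def)
  then have "has_colouring k (card {i \<in> {1..n}. c' (w i) < k}) ?ws"
    unfolding has_colouring_def dec_colouring_map[symmetric] num_coloured_map by blast
  then have "has_colouring k (card {i \<in> {1..n}. c' (w i) < k}) (reading_word ?T)"
    using knuth_colouring[OF conjunct2[OF RS_tableau[OF inj]]] inj distinct_set_map_upt(1) by blast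
  then have "card {i \<in> {1..n}. c' (w i) < k} \<le> (\<Sum>r\<leftarrow>?T. min k (length r))"
    using tableau_colouring_le[OF conjunct1[OF RS_tableau[OF inj]] RS_distinct(1)[OF inj]]
    unfolding has_colouring_def by metis
  also have "{i \<in> {1..n}. c' (w i) < k} = {i \<in> {1..n}. c i < k}" using c' by auto
  finally show ?thesis unfolding column_sum_RS .
qed

lemma greene_ex:
  assumes inj: "inj_on w {1..n}"
  obtains c where "pos_colouring n k w c" "card {i \<in> {1..n}. c i < k} = column_sum n k w"
proof -
  let ?T = "fst (RS n w)"
  have "has_colouring k (\<Sum>r\<leftarrow>?T. min k (length r)) (reading_word ?T)"
    using tableau_has_colouring RS_tableau[OF inj] RS_distinct(1)[OF inj] by blast
  then have "has_colouring k (\<Sum>r\<leftarrow>?T. min k (length r)) (map w [1..<Suc n])"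
    using knuth_colouring[OF conjunct2[OF RS_tableau[OF inj]]] inj distinct_set_map_upt(1) by blast
  then obtain c where "dec_colouring k c (map w [1..<Suc n])"
    "num_coloured k c (map w [1..<Suc n]) = column_sum n k w"
    unfolding has_colouring_def column_sum_RS by blast
  then show ?thesis using that[of "c \<circ> w"] unfolding dec_colouring_map num_coloured_map by simp
qed

lemma column_sum_recording_tableau:
  "recording_tableau n w = recording_tableau n w' \<Longrightarrow> column_sum n k w = column_sum n k w'"
  using RS_shape[of n w] RS_shape[of n w'] by (simp add: column_sum_def recording_tableau_def)

lemma row_count_antimono:
  assumes "inj_on w {1..n}"
  shows "row_count n w (Suc r) \<le> row_count n w r"
proof -
  have "row_length T (Suc r) \<le> row_length T r" if "tableau T" for T
    using that
  proof (induction T arbitrary: r)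
    case (Cons q T)
    show ?case
    proof (cases r)
      case 0
      then show ?thesis using Cons.prems by (cases T) (auto simp: row_length_def row_below_def)
    next
      case (Suc r')
      then show ?thesis using Cons by (simp add: row_length_Cons)
    qed
  qed simp
  then show ?thesis using RS_tableau[OF assms] RS_shape by metis
qed

text \<open>A colour class contains at most one position of each increasing chain.\<close>

lemma chain_bound:
  assumes c: "pos_colouring n k w c"
    and h: "\<And>i j. 1 \<le> i \<Longrightarrow> i < j \<Longrightarrow> j \<le> n \<Longrightarrow> h i = h j \<Longrightarrow> w i < w j"
  shows "card {i \<in> {1..n}. c i < k} \<le> (\<Sum>x\<in>h ` {1..n}. min k (card {i \<in> {1..n}. h i = x}))"
proof -
  have le: "card {i \<in> {1..n}. h i = x \<and> c i < k} \<le> min k (card {i \<in> {1..n}. h i = x})" for x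
  proof -
    have "inj_on c {i \<in> {1..n}. h i = x \<and> c i < k}"
    proof (rule inj_onI)
      fix i j assume ij: "i \<in> {i \<in> {1..n}. h i = x \<and> c i < k}" "j \<in> {i \<in> {1..n}. h i = x \<and> c i < k}" "c i = c j"
      show "i = j"
      proof (rule ccontr)
        assume "i \<noteq> j"
        then consider "i < j" | "j < i" by linarith
        then show False
        proof cases
          case 1
          then have "w i < w j" "w j < w i" using c h[of i j] ij unfolding pos_colouring_def by auto
          then show False by simp
        next
          case 2
          then have "w j < w i" "w i < w j" using c h[of j i] ij unfolding pos_colouring_def by auto
          then show False by simp
        qed
      qed
    qed
    then have "card {i \<in> {1..n}. h i = x \<and> c i < k} \<le> card {..<k}"
      by (rule card_inj_on_le) auto
    moreover have "card {i \<in> {1..n}. h i = x \<and> c i < k} \<le> card {i \<in> {1..n}. h i = x}"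
      by (intro card_mono) auto
    ultimately show ?thesis by simp
  qed
  have "{i \<in> {1..n}. c i < k} = (\<Union>x\<in>h ` {1..n}. {i \<in> {1..n}. h i = x \<and> c i < k})" by auto
  then have "card {i \<in> {1..n}. c i < k} \<le> (\<Sum>x\<in>h ` {1..n}. card {i \<in> {1..n}. h i = x \<and> c i < k})"
    by (simp only:) (rule card_UN_le, simp)
  also have "\<dots> \<le> (\<Sum>x\<in>h ` {1..n}. min k (card {i \<in> {1..n}. h i = x}))"
    using le by (intro sum_mono) blast
  finally show ?thesis .
qed

section \<open>Words made of three decreasing runs\<close>

lemma antimono_level_set:
  fixes f :: "nat \<Rightarrow> nat"
  assumes "\<And>r. f (Suc r) \<le> f r" "{r. j \<le> f r} \<subseteq> {..<N}"
  shows "{r. j \<le> f r} = {..<card {r. j \<le> f r}}"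
proof -
  have "f r' \<le> f r" if "r \<le> r'" for r r' using lift_Suc_antimono_le[of f] assms(1) that by blast
  then have down: "r \<in> {r. j \<le> f r}" if "r' \<in> {r. j \<le> f r}" "r \<le> r'" for r r'
    using that le_trans by blast
  have fin: "finite {r. j \<le> f r}" using assms(2) finite_subset by blast
  show ?thesis
  proof (cases "{r. j \<le> f r} = {}")
    case False
    define m where "m = Max {r. j \<le> f r}"
    have "{r. j \<le> f r} = {..m}"
    proof
      show "{r. j \<le> f r} \<subseteq> {..m}" unfolding m_def using fin by auto
      have "m \<in> {r. j \<le> f r}" unfolding m_def using Max_in[OF fin False] .
      then show "{..m} \<subseteq> {r. j \<le> f r}" using down by blast
    qed
    then show ?thesis by (simp add: lessThan_Suc_atMost)
  qed simp
qed

text \<open>The uniqueness of the semistandard tableau whose weight is a permutation of its shape, in the form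
  needed here: \<open>S\<close>, \<open>T\<close> and \<open>U\<close> are the sets of rows touched by three vertical strips, and the first
  column and the first two columns of the resulting shape are as short as they can be.\<close>

lemma column_content_unique:
  fixes S T U :: "nat set" and f :: "nat \<Rightarrow> nat"
  assumes f: "\<And>r. f r = of_bool (r \<in> S) + of_bool (r \<in> T) + of_bool (r \<in> U)"
    and mono: "\<And>r. f (Suc r) \<le> f r"
    and sub: "S \<subseteq> {..<N}" "T \<subseteq> {..<N}" "U \<subseteq> {..<N}"
    and sum1: "(\<Sum>r<N. min 1 (f r)) \<le> card S"
    and sum2: "(\<Sum>r<N. min 2 (f r)) \<le> card S + card T"
  shows "S = {..<card S}" "T = {..<card T}" "U = {..<card U}"
proof -
  \<comment> \<open>\<open>L j\<close> is the set of rows that meet column \<open>j\<close>.\<close>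
  define L where "L j = {r. j \<le> f r}" for j
  have fin: "finite S" "finite T" "finite U" using sub finite_subset by blast+
  have LN: "L j \<subseteq> {..<N}" if "1 \<le> j" for j
    using sub that by (auto simp: L_def f of_bool_def split: if_splits)
  have Lf: "finite (L j)" if "1 \<le> j" for j using LN[OF that] finite_subset by blast
  have L: "L j = {..<card (L j)}" if "1 \<le> j" for j
    using antimono_level_set[of f j N] mono LN[OF that] unfolding L_def by blast
  have ind: "card (L j) = (\<Sum>r<N. of_bool (j \<le> f r))" if "1 \<le> j" for j
  proof -
    have "(\<Sum>r<N. of_bool (j \<le> f r)) = card ({..<N} \<inter> {r. j \<le> f r})"
      by (simp add: sum.If_cases of_bool_def)
    also have "{..<N} \<inter> {r. j \<le> f r} = L j" using LN[OF that] by (auto simp: L_def)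
    finally show ?thesis by simp
  qed
  have ind1: "card (L 1) = (\<Sum>r<N. of_bool (1 \<le> f r))" by (rule ind) simp
  have ind2: "card (L 2) = (\<Sum>r<N. of_bool (2 \<le> f r))" by (rule ind) simp
  have ind3: "card (L 3) = (\<Sum>r<N. of_bool (3 \<le> f r))" by (rule ind) simp
  have f3: "f r \<le> 3" for r by (simp add: f of_bool_def)
  have s1: "(\<Sum>r<N. min 1 (f r)) = card (L 1)"
    unfolding ind1 by (intro sum.cong) (auto simp: of_bool_def)
  have s2: "(\<Sum>r<N. min 2 (f r)) = card (L 1) + card (L 2)"
    unfolding ind1 ind2 sum.distrib[symmetric]
    by (intro sum.cong) (auto simp: of_bool_def)
  have s3: "(\<Sum>r<N. f r) = card (L 1) + card (L 2) + card (L 3)"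
    unfolding ind1 ind2 ind3 sum.distrib[symmetric]
  proof (rule sum.cong[OF refl])
    fix r show "f r = of_bool (1 \<le> f r) + of_bool (2 \<le> f r) + of_bool (3 \<le> f r)"
      using f3[of r] by (auto simp: of_bool_def)
  qed
  have cS: "(\<Sum>r<N. of_bool (r \<in> X)) = card X" if "X \<subseteq> {..<N}" for X :: "nat set"
    using that by (simp add: of_bool_def sum.If_cases Int_absorb1)
  have tot: "(\<Sum>r<N. f r) = card S + card T + card U"
    unfolding f sum.distrib using cS sub by simp
  have "S \<subseteq> L 1" by (auto simp: L_def f)
  moreover have "card (L 1) \<le> card S" using sum1 s1 by simp
  ultimately have SL: "S = L 1" using card_seteq[OF Lf[of 1]] by blast
  have "L 3 \<subseteq> U" by (auto simp: L_def f of_bool_def split: if_splits)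
  moreover have "card U \<le> card (L 3)" using sum2 s2 s3 tot by simp
  ultimately have UL: "U = L 3" using card_seteq[OF fin(3)] by blast
  have "L 2 \<subseteq> T" using UL f3 by (auto simp: L_def f of_bool_def split: if_splits)
  moreover have "card T \<le> card (L 2)" using s3 tot SL UL by simp
  ultimately have TL: "T = L 2" using card_seteq[OF fin(2)] by blast
  show "S = {..<card S}" "T = {..<card T}" "U = {..<card U}"
    using L[of 1] L[of 2] L[of 3] SL TL UL by simp_all
qed

lemma increasing_onto_initial_segment:
  fixes f :: "nat \<Rightarrow> nat"
  assumes inc: "\<And>i. p < i \<Longrightarrow> i < p + m \<Longrightarrow> f i < f (Suc i)"
    and im: "f ` {p + 1..p + m} = {..<m}" and i: "p < i" "i \<le> p + m"
  shows "f i = i - p - 1"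
proof -
  have lo: "d < m \<Longrightarrow> d \<le> f (p + Suc d)" for d
  proof (induction d)
    case (Suc d)
    then show ?case using inc[of "p + Suc d"] by simp
  qed simp
  have hi: "d < m \<Longrightarrow> f (p + m - d) \<le> m - 1 - d" for d
  proof (induction d)
    case 0
    then have "p + m \<in> {p + 1..p + m}" by simp
    then have "f (p + m) \<in> {..<m}" using im by blast
    then show ?case by simp
  next
    case (Suc d)
    have "f (p + m - Suc d) < f (Suc (p + m - Suc d))" using Suc.prems by (intro inc) simp_all
    moreover have "Suc (p + m - Suc d) = p + m - d" using Suc.prems by simp
    ultimately show ?case using Suc by simp
  qed
  have lt: "i - p - 1 < m" "p + m - i < m" using i by linarith+
  have "p + Suc (i - p - 1) = i" "p + m - (p + m - i) = i" using i by simp_all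
  then have "i - p - 1 \<le> f i" "f i \<le> m - 1 - (p + m - i)"
    using lo[OF lt(1)] hi[OF lt(2)] by simp_all
  then show ?thesis using i by linarith
qed

text \<open>A decreasing run of length \<open>m\<close> touches \<open>m\<close> distinct rows, from top to bottom. If the first column has
  length at most \<open>s\<close> and the first two have total length at most \<open>s + t\<close>, then these are the first \<open>m\<close> rows for each of the three runs, and the recording tableau
  is determined.\<close>

lemma new_row_three_runs:
  assumes inj: "inj_on w {1..a + b + c}"
    and run1: "\<And>i. 0 < i \<Longrightarrow> i < a \<Longrightarrow> w (Suc i) < w i"
    and run2: "\<And>i. a < i \<Longrightarrow> i < a + b \<Longrightarrow> w (Suc i) < w i"
    and run3: "\<And>i. a + b < i \<Longrightarrow> i < a + b + c \<Longrightarrow> w (Suc i) < w i"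
    and lam: "mset [a, b, c] = {#s, t, u#}"
    and col: "column_sum (a + b + c) 1 w \<le> s" "column_sum (a + b + c) 2 w \<le> s + t"
    and i: "1 \<le> i" "i \<le> a + b + c"
  shows "new_row w i = (if i \<le> a then i - 1 else if i \<le> a + b then i - a - 1 else i - (a + b) - 1)"
proof -
  let ?n = "a + b + c" and ?f = "new_row w"
  define A where "A = ?f ` {1..a}"
  define B where "B = ?f ` {a + 1..a + b}"
  define C where "C = ?f ` {a + b + 1..a + b + c}"
  have inc1: "?f i < ?f (Suc i)" if "0 < i" "i < 0 + a" for i
    using that run1 by (intro new_row_descent[OF inj]) auto
  have inc2: "?f i < ?f (Suc i)" if "a < i" "i < a + b" for i
    using that run2 by (intro new_row_descent[OF inj]) auto
  have inc3: "?f i < ?f (Suc i)" if "a + b < i" "i < a + b + c" for i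
    using that run3 by (intro new_row_descent[OF inj]) auto
  have inj_run: "inj_on ?f {p + 1..p + m}"
    if "\<And>i. p < i \<Longrightarrow> i < p + m \<Longrightarrow> ?f i < ?f (Suc i)" for p m
  proof -
    have "?f i < ?f (i + Suc d)" if "p < i" "i + Suc d \<le> p + m" for i d
      using that
    proof (induction d)
      case (Suc d)
      then show ?case using \<open>\<And>i. p < i \<Longrightarrow> i < p + m \<Longrightarrow> ?f i < ?f (Suc i)\<close>[of "i + Suc d"] by simp
    qed (use that in \<open>simp add: \<open>\<And>i. p < i \<Longrightarrow> i < p + m \<Longrightarrow> ?f i < ?f (Suc i)\<close>\<close>)
    then have "strict_mono_on {p + 1..p + m} ?f"
      by (intro strict_mono_onI) (metis Suc_eq_plus1 Suc_le_eq add_Suc_right atLeastAtMost_iff less_natE)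
    then show ?thesis by (rule strict_mono_on_imp_inj_on)
  qed
  have injs: "inj_on ?f {1..a}" "inj_on ?f {a + 1..a + b}" "inj_on ?f {a + b + 1..a + b + c}"
    using inj_run[of 0 a] inj_run[of a b] inj_run[of "a + b" c] inc1 inc2 inc3 by simp_all
  have cards: "card A = a" "card B = b" "card C = c"
    unfolding A_def B_def C_def using injs by (simp_all add: card_image)
  have sub: "A \<subseteq> {..<?n}" "B \<subseteq> {..<?n}" "C \<subseteq> {..<?n}"
    unfolding A_def B_def C_def
    by (auto intro!: less_le_trans[OF new_row_less])
  have one: "card {i \<in> I. ?f i = r} = of_bool (r \<in> ?f ` I)" if "inj_on ?f I" for I r
  proof (cases "r \<in> ?f ` I")
    case True
    then obtain i where "i \<in> I" "?f i = r" by blast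
    then have "{i \<in> I. ?f i = r} = {i}" using that by (auto simp: inj_on_def)
    then show ?thesis using True by simp
  next
    case False
    then have "{i \<in> I. ?f i = r} = {}" by blast
    then have "card {i \<in> I. ?f i = r} = 0" by (simp only: card.empty)
    then show ?thesis using False by (simp only: of_bool_eq)
  qed
  have cnt: "row_count ?n w r = of_bool (r \<in> A) + of_bool (r \<in> B) + of_bool (r \<in> C)" for r
  proof -
    let ?P = "{i \<in> {1..a}. ?f i = r}" and ?Q = "{i \<in> {a + 1..a + b}. ?f i = r}"
      and ?R = "{i \<in> {a + b + 1..a + b + c}. ?f i = r}"
    have "{i \<in> {1..?n}. ?f i = r} = (?P \<union> ?Q) \<union> ?R" by auto
    moreover have "?P \<inter> ?Q = {}" "(?P \<union> ?Q) \<inter> ?R = {}" by auto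
    moreover have "finite ?P" "finite ?Q" "finite ?R" by simp_all
    ultimately have "row_count ?n w r = card ?P + card ?Q + card ?R"
      unfolding row_count_def by (simp only: card_Un_disjoint finite_Un simp_thms)
    then show ?thesis unfolding A_def B_def C_def one[OF injs(1)] one[OF injs(2)] one[OF injs(3)] .
  qed
  have uniq: "S = {..<card S} \<and> T = {..<card T} \<and> U = {..<card U}"
    if "\<And>r. row_count ?n w r = of_bool (r \<in> S) + of_bool (r \<in> T) + of_bool (r \<in> U)"
      "S \<subseteq> {..<?n}" "T \<subseteq> {..<?n}" "U \<subseteq> {..<?n}" "card S = s" "card T = t" for S T U
    using column_content_unique[of "row_count ?n w" S T U ?n, OF that(1) row_count_antimono[OF inj] that(2-4)]
      col that(5,6) unfolding column_sum_def by simp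
  define N where "N = ?n"
  note cnt' = cnt[folded N_def] and uniq' = uniq[folded N_def] and sub' = sub[folded N_def]
  have "(a = s \<and> b = t \<and> c = u) \<or> (a = s \<and> b = u \<and> c = t) \<or> (a = t \<and> b = s \<and> c = u)
      \<or> (a = t \<and> b = u \<and> c = s) \<or> (a = u \<and> b = s \<and> c = t) \<or> (a = u \<and> b = t \<and> c = s)"
    using lam by (auto simp: add_eq_conv_ex)
  then have "A = {..<a} \<and> B = {..<b} \<and> C = {..<c}"
  proof (elim disjE)
    assume "a = s \<and> b = t \<and> c = u"
    then show ?thesis using uniq'[of A B C] sub' cards by (simp add: cnt' ac_simps)
  next
    assume "a = s \<and> b = u \<and> c = t"
    then show ?thesis using uniq'[of A C B] sub' cards by (simp add: cnt' ac_simps)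
  next
    assume "a = t \<and> b = s \<and> c = u"
    then show ?thesis using uniq'[of B A C] sub' cards by (simp add: cnt' ac_simps)
  next
    assume "a = t \<and> b = u \<and> c = s"
    then show ?thesis using uniq'[of C A B] sub' cards by (simp add: cnt' ac_simps)
  next
    assume "a = u \<and> b = s \<and> c = t"
    then show ?thesis using uniq'[of B C A] sub' cards by (simp add: cnt' ac_simps)
  next
    assume "a = u \<and> b = t \<and> c = s"
    then show ?thesis using uniq'[of C B A] sub' cards by (simp add: cnt' ac_simps)
  qed
  then have ABC: "?f ` {0 + 1..0 + a} = {..<a}" "?f ` {a + 1..a + b} = {..<b}"
    "?f ` {a + b + 1..a + b + c} = {..<c}" by (simp_all add: A_def B_def C_def)
  show ?thesis
    using increasing_onto_initial_segment[OF inc1 ABC(1), of i]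
      increasing_onto_initial_segment[OF inc2 ABC(2), of i]
      increasing_onto_initial_segment[OF inc3 ABC(3), of i] i by auto
qed

section \<open>Coxeter length and inversions\<close>

text \<open>Inversions as pairs of positions.\<close>

definition inversions :: "nat \<Rightarrow> (nat \<Rightarrow> nat) \<Rightarrow> (nat \<times> nat) set" where
  "inversions n w = {(i, j). 1 \<le> i \<and> i < j \<and> j \<le> n \<and> w j < w i}"

lemma finite_inversions [simp]: "finite (inversions n w)"
  by (rule finite_subset[of _ "{1..n} \<times> {1..n}"]) (auto simp: inversions_def)

lemma inversions_id [simp]: "inversions n id = {}" "inversions n (\<lambda>x. x) = {}"
  by (auto simp: inversions_def)

lemma simple_refl_permutes: "1 \<le> i \<Longrightarrow> i < n \<Longrightarrow> simple_refl i permutes {1..n}"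
  unfolding simple_refl_def by (rule permutes_swap_id) auto

lemma simple_refl_involutive [simp]: "simple_refl i \<circ> simple_refl i = id"
  "simple_refl i (simple_refl i x) = x"
  by (auto simp: simple_refl_def)

lemma simple_refl_le: "p < q \<Longrightarrow> (p, q) \<noteq> (i, Suc i) \<Longrightarrow> simple_refl i p < simple_refl i q"
  by (auto simp: simple_refl_def Transposition.transpose_def)

lemma simple_refl_eq_iff: "simple_refl i = simple_refl j \<longleftrightarrow> i = j"
proof
  assume "simple_refl i = simple_refl j"
  then have "simple_refl i i = simple_refl j i" "simple_refl i j = simple_refl j j" by simp_all
  then show "i = j" by (auto simp: simple_refl_def Transposition.transpose_def split: if_splits)
qed simp

text \<open>Exchanging the adjacent values \<open>i\<close>, \<open>i + 1\<close>, which occur at the positions \<open>p < q\<close>.\<close>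

lemma inversions_swap_values:
  assumes w: "w permutes {1..n}" and i: "1 \<le> p" "p < q" "q \<le> n" "w p = i" "w q = Suc i"
  shows "inversions n (simple_refl i \<circ> w) = insert (p, q) (inversions n w)" "(p, q) \<notin> inversions n w"
proof -
  have inj: "w x = w y \<longleftrightarrow> x = y" for x y using permutes_inj[OF w] by (auto dest: injD)
  have "(a, b) \<in> inversions n (simple_refl i \<circ> w) \<longleftrightarrow> (a, b) \<in> insert (p, q) (inversions n w)" for a b
  proof (cases "(a, b) = (p, q)")
    case True
    then show ?thesis using i by (auto simp: inversions_def simple_refl_def)
  next
    case False
    have "simple_refl i (w b) < simple_refl i (w a) \<longleftrightarrow> w b < w a" if "a < b"
    proof (cases "w a < w b")
      case True
      then have "(w a, w b) \<noteq> (i, Suc i)" using False i inj by (metis prod.inject)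
      then show ?thesis using simple_refl_le[OF True] True by fastforce
    next
      case lt: False
      then have "w b < w a" using that inj by (metis less_irrefl linorder_neqE_nat)
      moreover have "(w b, w a) \<noteq> (i, Suc i)" using i that inj by (metis less_asym prod.inject)
      ultimately show ?thesis using simple_refl_le by blast
    qed
    then show ?thesis using False by (auto simp: inversions_def)
  qed
  then show "inversions n (simple_refl i \<circ> w) = insert (p, q) (inversions n w)" by auto
  show "(p, q) \<notin> inversions n w" using i by (auto simp: inversions_def)
qed

lemma inversions_swap_cases:
  assumes w: "w permutes {1..n}" and i: "1 \<le> i" "i < n"
  obtains (up) p q where "1 \<le> p" "p < q" "q \<le> n" "w p = i" "w q = Suc i"
      "inversions n (simple_refl i \<circ> w) = insert (p, q) (inversions n w)" "(p, q) \<notin> inversions n w"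
  | (down) p q where "inversions n w = insert (p, q) (inversions n (simple_refl i \<circ> w))"
      "(p, q) \<notin> inversions n (simple_refl i \<circ> w)"
proof -
  obtain p where p: "p \<in> {1..n}" "w p = i" using w i by (metis permutes_image atLeastAtMost_iff image_iff less_imp_le)
  obtain q where q: "q \<in> {1..n}" "w q = Suc i" using w i
    by (metis permutes_image atLeastAtMost_iff image_iff Suc_leI le_SucI)
  have ne: "p \<noteq> q" using p q by auto
  show ?thesis
  proof (cases "p < q")
    case True
    then show ?thesis using up[of p q] p q inversions_swap_values[OF w, of p q i] by auto
  next
    case False
    then have "q < p" using ne by simp
    moreover have "simple_refl i \<circ> w permutes {1..n}"
      using w simple_refl_permutes[OF i] by (rule permutes_compose)
    moreover have "simple_refl i \<circ> (simple_refl i \<circ> w) = w" by (simp add: o_assoc)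
    ultimately show ?thesis
      using down[of q p] p q inversions_swap_values[of "simple_refl i \<circ> w" n q p i]
      by (auto simp: simple_refl_def)
  qed
qed

lemma inversions_inj:
  assumes x: "x permutes {1..n}" and y: "y permutes {1..n}"
    and asc: "\<And>i. 1 \<le> i \<Longrightarrow> i < n \<Longrightarrow> y (inv_into UNIV x i) < y (inv_into UNIV x (Suc i))"
  shows "y = x"
proof -
  define z where "z = y \<circ> inv_into UNIV x"
  have z: "z permutes {1..n}" unfolding z_def by (rule permutes_compose[OF permutes_inv[OF x] y])
  have zi: "1 \<le> i \<Longrightarrow> i \<le> n \<Longrightarrow> z i \<in> {1..n}" for i using permutes_in_image[OF z, of i] by auto
  have lo: "i \<le> z i" if "1 \<le> i" "i \<le> n" for i
    using that
  proof (induction i rule: nat_induct_at_least)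
    case base
    then show ?case using zi[of 1] by auto
  next
    case (Suc i)
    then show ?case using asc[of i] by (auto simp: z_def)
  qed
  have hi: "d \<le> n - 1 \<Longrightarrow> z (n - d) \<le> n - d" for d
  proof (induction d)
    case 0
    then show ?case using zi[of n] permutes_not_in[OF z, of 0] by (cases n) auto
  next
    case (Suc d)
    have "z (n - Suc d) < z (Suc (n - Suc d))" using asc[of "n - Suc d"] Suc.prems by (auto simp: z_def)
    also have "Suc (n - Suc d) = n - d" using Suc.prems by auto
    finally show ?case using Suc by auto
  qed
  have "z i = i" for i
  proof (cases "i \<in> {1..n}")
    case True
    then show ?thesis using lo[of i] hi[of "n - i"] by auto
  next
    case False
    then show ?thesis using permutes_not_in[OF z] by auto
  qed
  then have "y (inv_into UNIV x (x i)) = x i" for i unfolding z_def by simp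
  then show ?thesis using permutes_inverses(2)[OF x] by auto
qed

text \<open>If the inversion set of \<open>x\<close> is properly contained in that of \<open>y\<close>, then this remains an inclusion
  after a suitable simple reflection has added one inversion to \<open>x\<close>.\<close>

lemma inversions_ascent:
  assumes x: "x permutes {1..n}" and y: "y permutes {1..n}"
    and sub: "inversions n x \<subseteq> inversions n y" and ne: "x \<noteq> y"
  obtains i where "1 \<le> i" "i < n" "card (inversions n (simple_refl i \<circ> x)) = Suc (card (inversions n x))"
    "inversions n (simple_refl i \<circ> x) \<subseteq> inversions n y"
proof -
  obtain i where i: "1 \<le> i" "i < n" "\<not> y (inv_into UNIV x i) < y (inv_into UNIV x (Suc i))"
    using inversions_inj[OF x y] ne by blast
  define p q where "p = inv_into UNIV x i" and "q = inv_into UNIV x (Suc i)"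
  have ip: "inv_into UNIV x permutes {1..n}" using permutes_inv[OF x] .
  have pq: "p \<in> {1..n}" "q \<in> {1..n}" "x p = i" "x q = Suc i"
    using permutes_in_image[OF ip] i permutes_inverses(1)[OF x] by (auto simp: p_def q_def)
  have "p \<noteq> q" using pq by auto
  then have lt: "y q < y p" using i permutes_inj[OF y] by (metis injD linorder_neqE_nat p_def q_def)
  have "\<not> q < p"
  proof
    assume "q < p"
    then have "(q, p) \<in> inversions n x" using pq by (auto simp: inversions_def)
    then show False using sub lt by (auto simp: inversions_def)
  qed
  then have "p < q" using \<open>p \<noteq> q\<close> by simp
  note * = inversions_swap_values[OF x _ this _ pq(3,4)]
  have "(p, q) \<in> inversions n y" using pq lt \<open>p < q\<close> by (auto simp: inversions_def)
  then show ?thesis using that[of i] * i sub pq by auto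
qed

lemma word_prod_append: "word_prod (us @ vs) = word_prod us \<cdot> word_prod vs"
  by (induction us) (auto simp: word_prod_def)

lemma word_prod_simps [simp]: "word_prod [] = id" "word_prod [s] = s"
  by (auto simp: word_prod_def)

lemma word_prod_permutes: "set ws \<subseteq> cox_gens n \<Longrightarrow> word_prod ws permutes {1..n}"
proof (induction ws rule: rev_induct)
  case (snoc s ws)
  then obtain i where "s = simple_refl i" "1 \<le> i" "i < n" by (auto simp: cox_gens_def)
  moreover have "word_prod ws permutes {1..n}" using snoc by simp
  moreover have "word_prod (ws @ [simple_refl i]) = simple_refl i \<circ> word_prod ws"
    by (simp add: word_prod_append)
  ultimately show ?case using permutes_compose[OF _ simple_refl_permutes] by metis
qed (auto simp: permutes_id)

lemma inversions_word_prod: "set ws \<subseteq> cox_gens n \<Longrightarrow> card (inversions n (word_prod ws)) \<le> length ws"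
proof (induction ws rule: rev_induct)
  case (snoc s ws)
  then obtain i where i: "s = simple_refl i" "1 \<le> i" "i < n" by (auto simp: cox_gens_def)
  have w: "word_prod ws permutes {1..n}" using snoc.prems by (intro word_prod_permutes) simp
  have "word_prod (ws @ [s]) = simple_refl i \<circ> word_prod ws" using i by (simp add: word_prod_append)
  moreover have "card (inversions n (simple_refl i \<circ> word_prod ws)) \<le> Suc (card (inversions n (word_prod ws)))"
    using inversions_swap_cases[OF w i(2,3)]
    by (cases, metis card_insert_disjoint finite_inversions le_refl,
        metis card_insert_disjoint finite_inversions le_SucI le_refl)
  moreover have "card (inversions n (word_prod ws)) \<le> length ws" using snoc by simp
  ultimately show ?case unfolding length_append_singleton by (metis Suc_le_mono le_trans)
qed simp

lemma word_between:
  assumes "x permutes {1..n}" "y permutes {1..n}" "inversions n x \<subseteq> inversions n y"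
  shows "\<exists>vs. set vs \<subseteq> cox_gens n \<and> y = x \<cdot> word_prod vs
    \<and> length vs + card (inversions n x) = card (inversions n y)"
  using assms
proof (induction "card (inversions n y) - card (inversions n x)" arbitrary: x rule: less_induct)
  case less
  show ?case
  proof (cases "x = y")
    case True
    then show ?thesis by (intro exI[of _ "[]"]) auto
  next
    case False
    obtain i where i: "1 \<le> i" "i < n" "card (inversions n (simple_refl i \<circ> x)) = Suc (card (inversions n x))"
      "inversions n (simple_refl i \<circ> x) \<subseteq> inversions n y"
      using inversions_ascent[OF less.prems False] .
    have le: "card (inversions n (simple_refl i \<circ> x)) \<le> card (inversions n y)"
      using i(4) by (intro card_mono) auto
    have "simple_refl i \<circ> x permutes {1..n}"
      using less.prems simple_refl_permutes[OF i(1,2)] by (auto intro: permutes_compose)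
    then obtain vs where vs: "set vs \<subseteq> cox_gens n" "y = (simple_refl i \<circ> x) \<cdot> word_prod vs"
      "length vs + card (inversions n (simple_refl i \<circ> x)) = card (inversions n y)"
      using less.hyps[of "simple_refl i \<circ> x"] less.prems(2) i(3,4) le
      by (metis Suc_le_lessD diff_less_mono2 lessI)
    have "word_prod (simple_refl i # vs) = simple_refl i \<cdot> word_prod vs" by (simp add: word_prod_def)
    then have "y = x \<cdot> word_prod (simple_refl i # vs)" using vs by (simp add: o_assoc)
    then show ?thesis using vs i by (intro exI[of _ "simple_refl i # vs"]) (auto simp: cox_gens_def)
  qed
qed

text \<open>The Coxeter length is the number of inversions.\<close>

lemma cox_length_eq:
  assumes "w permutes {1..n}"
  shows "cox_length n w = card (inversions n w)"
proof -
  obtain vs where "set vs \<subseteq> cox_gens n" "w = word_prod vs" "length vs = card (inversions n w)"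
    using word_between[of id n w] assms by (auto simp: permutes_id)
  then show ?thesis unfolding cox_length_def
    using inversions_word_prod[of _ n] by (intro Least_equality) (auto, metis)
qed

lemma inversions_reduced_append:
  assumes "set us \<subseteq> cox_gens n" "set vs \<subseteq> cox_gens n"
    and "card (inversions n (word_prod (us @ vs))) = length (us @ vs)"
  shows "inversions n (word_prod us) \<subseteq> inversions n (word_prod (us @ vs))"
  using assms
proof (induction vs rule: rev_induct)
  case (snoc s vs)
  then obtain i where i: "s = simple_refl i" "1 \<le> i" "i < n" by (auto simp: cox_gens_def)
  define w where "w = word_prod (us @ vs)"
  have w: "w permutes {1..n}" unfolding w_def using snoc.prems by (intro word_prod_permutes) auto
  have eq: "word_prod (us @ vs @ [s]) = simple_refl i \<circ> w"
    using i word_prod_append[of "us @ vs" "[s]"] by (simp add: w_def)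
  have le: "card (inversions n w) \<le> length (us @ vs)"
    unfolding w_def using snoc.prems by (intro inversions_word_prod) auto
  from w i(2,3) show ?case
  proof (cases rule: inversions_swap_cases)
    case (up p q)
    then have "card (inversions n (simple_refl i \<circ> w)) = Suc (card (inversions n w))" by simp
    then have "card (inversions n w) = length (us @ vs)" using snoc.prems(3) unfolding eq by simp
    then have "inversions n (word_prod us) \<subseteq> inversions n w" using snoc by (simp add: w_def)
    then show ?thesis using up unfolding eq by blast
  next
    case (down p q)
    then have "card (inversions n w) = Suc (card (inversions n (simple_refl i \<circ> w)))"
      by (metis card_insert_disjoint finite_inversions)
    then show ?thesis using snoc.prems(3) le unfolding eq by simp
  qed
qed simp

text \<open>The prefix order is inclusion of inversion sets.\<close>

lemma cox_prefix_iff: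
  assumes x: "x permutes {1..n}" and y: "y permutes {1..n}"
  shows "cox_prefix n x y \<longleftrightarrow> inversions n x \<subseteq> inversions n y"
proof
  assume "cox_prefix n x y"
  then obtain us vs where "reduced_expr n us x" "reduced_expr n (us @ vs) y"
    by (auto simp: cox_prefix_def)
  then show "inversions n x \<subseteq> inversions n y"
    using inversions_reduced_append[of us n vs] cox_length_eq[OF y] by (auto simp: reduced_expr_def)
next
  assume sub: "inversions n x \<subseteq> inversions n y"
  obtain us where us: "set us \<subseteq> cox_gens n" "x = word_prod us" "length us = card (inversions n x)"
    using word_between[of id n x] x by (auto simp: permutes_id)
  obtain vs where vs: "set vs \<subseteq> cox_gens n" "y = x \<cdot> word_prod vs"
    "length vs + card (inversions n x) = card (inversions n y)"
    using word_between[OF x y sub] by blast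
  have "reduced_expr n us x" using us cox_length_eq[OF x] by (auto simp: reduced_expr_def)
  moreover have "reduced_expr n (us @ vs) y"
    using us vs cox_length_eq[OF y] by (auto simp: reduced_expr_def word_prod_append)
  ultimately show "cox_prefix n x y" unfolding cox_prefix_def by blast
qed

text \<open>Exchanging the values at the adjacent positions \<open>i\<close>, \<open>i + 1\<close> of a descent.\<close>

lemma inversions_swap_positions:
  assumes w: "w permutes {1..n}" and i: "1 \<le> i" "i < n" "w (Suc i) < w i"
  shows "card (inversions n (w \<circ> simple_refl i)) < card (inversions n w)"
proof -
  let ?s = "simple_refl i"
  have s: "?s permutes {1..n}" using simple_refl_permutes i by auto
  have sn: "?s p \<in> {1..n}" if "p \<in> {1..n}" for p using permutes_in_image[OF s] that by blast
  have "map_prod ?s ?s ` inversions n (w \<circ> ?s) \<subseteq> inversions n w - {(i, Suc i)}"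
  proof (clarsimp simp only: map_prod_simp, intro DiffI)
    fix p q assume pq: "(p, q) \<in> inversions n (w \<circ> ?s)"
    have ne: "(p, q) \<noteq> (i, Suc i)" using pq i by (auto simp: inversions_def simple_refl_def)
    then have "?s p < ?s q" using pq simple_refl_le by (auto simp: inversions_def)
    then show "((?s p, ?s q)) \<in> inversions n w" using pq sn[of p] sn[of q]
      by (auto simp: inversions_def)
    have "\<not> (?s p = i \<and> ?s q = Suc i)"
    proof
      assume "?s p = i \<and> ?s q = Suc i"
      then have "p = ?s i" "q = ?s (Suc i)" by (metis simple_refl_involutive(2))+
      then show False using pq by (auto simp: inversions_def simple_refl_def)
    qed
    then show "(?s p, ?s q) \<notin> {(i, Suc i)}" by simp
  qed
  then have "card (map_prod ?s ?s ` inversions n (w \<circ> ?s)) \<le> card (inversions n w - {(i, Suc i)})"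
    by (intro card_mono) auto
  moreover have "card (map_prod ?s ?s ` inversions n (w \<circ> ?s)) = card (inversions n (w \<circ> ?s))"
    using permutes_inj[OF s] by (intro card_image inj_on_subset[OF prod.inj_map]) simp_all
  moreover have "(i, Suc i) \<in> inversions n w" using i by (auto simp: inversions_def)
  ultimately show ?thesis by (metis card_Diff1_less finite_inversions le_less_trans)
qed

section \<open>Parabolic subgroups\<close>

text \<open>The composition \<open>lam\<close> cuts the positions into consecutive blocks; \<open>block lam i\<close> is the index, from 0,
  of the block that contains \<open>i\<close>.\<close>

definition block :: "nat list \<Rightarrow> nat \<Rightarrow> nat" where
  "block lam i = card {k. 1 \<le> k \<and> k < length lam \<and> sum_list (take k lam) < i}"

lemma block_mono: "i \<le> j \<Longrightarrow> block lam i \<le> block lam j"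
  unfolding block_def by (intro card_mono) auto

lemma block_Suc: "block lam i = block lam (Suc i) \<longleftrightarrow>
    \<not> (\<exists>k. 1 \<le> k \<and> k < length lam \<and> sum_list (take k lam) = i)"
proof -
  have "{k. 1 \<le> k \<and> k < length lam \<and> sum_list (take k lam) < Suc i} =
      {k. 1 \<le> k \<and> k < length lam \<and> sum_list (take k lam) < i} \<union>
      {k. 1 \<le> k \<and> k < length lam \<and> sum_list (take k lam) = i}" by auto
  moreover have "card ({k. 1 \<le> k \<and> k < length lam \<and> sum_list (take k lam) < i} \<union>
      {k. 1 \<le> k \<and> k < length lam \<and> sum_list (take k lam) = i}) =
     card {k. 1 \<le> k \<and> k < length lam \<and> sum_list (take k lam) < i} +
      card {k. 1 \<le> k \<and> k < length lam \<and> sum_list (take k lam) = i}"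
    by (intro card_Un_disjoint) auto
  moreover have "card {k. 1 \<le> k \<and> k < length lam \<and> sum_list (take k lam) = i} = 0 \<longleftrightarrow>
      \<not> (\<exists>k. 1 \<le> k \<and> k < length lam \<and> sum_list (take k lam) = i)" by auto
  ultimately show ?thesis unfolding block_def by simp
qed

lemma J_of_iff: "simple_refl i \<in> J_of lam \<longleftrightarrow>
    1 \<le> i \<and> i < sum_list lam \<and> block lam i = block lam (Suc i)"
  unfolding J_of_def cox_gens_def block_Suc by (auto simp: simple_refl_eq_iff)

lemma J_of_gen: "g \<in> J_of lam \<Longrightarrow> \<exists>i. g = simple_refl i"
  unfolding J_of_def cox_gens_def by auto

text \<open>The parabolic subgroup consists of the permutations that preserve every block.\<close>

lemma W_J_iff: "w \<in> W_J lam \<longleftrightarrow>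
    w permutes {1..sum_list lam} \<and> (\<forall>i\<in>{1..sum_list lam}. block lam (w i) = block lam i)"
    (is "_ \<longleftrightarrow> ?blocks w")
proof
  let ?n = "sum_list lam"
  have gen: "?blocks g" if "g \<in> J_of lam" for g
  proof -
    obtain i where "g = simple_refl i" using J_of_gen[OF \<open>g \<in> J_of lam\<close>] by blast
    moreover have "1 \<le> i \<and> i < ?n \<and> block lam i = block lam (Suc i)"
      using that calculation J_of_iff[of i lam] by simp
    ultimately show ?thesis using simple_refl_permutes[of i ?n]
      by (auto simp: simple_refl_def) (auto simp: Transposition.transpose_def)
  qed
  assume "w \<in> W_J lam"
  then show "?blocks w" unfolding W_J_def
  proof (induction rule: generate.induct)
    case one
    then show ?case using permutes_id[of "{1..?n}"] by (auto simp: sym_group_def id_def)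
  next
    case (incl h)
    then show ?case by (rule gen)
  next
    case (inv h)
    then have h: "?blocks h" by (rule gen)
    then have "inv\<^bsub>sym_group ?n\<^esub> h = inv_into UNIV h"
      using sym_group_inv_equality by (simp add: sym_group_def)
    moreover have "block lam (inv_into UNIV h i) = block lam i" if "i \<in> {1..?n}" for i
    proof -
      have p: "h permutes {1..?n}" using h by blast
      have "inv_into UNIV h i \<in> {1..?n}" using permutes_in_image[OF permutes_inv[OF p]] that by blast
      then show ?thesis using h permutes_inverses(1)[OF p] by metis
    qed
    ultimately show ?case using h permutes_inv by auto
  next
    case (eng h1 h2)
    then have "h1 \<circ> h2 permutes {1..?n}" by (intro permutes_compose) simp_all
    moreover have "block lam ((h1 \<circ> h2) i) = block lam i" if "i \<in> {1..?n}" for i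
      using that eng.IH permutes_in_image[of h2 "{1..?n}" i] by simp
    moreover have "h1 \<otimes>\<^bsub>sym_group ?n\<^esub> h2 = h1 \<circ> h2" by (simp add: sym_group_def)
    ultimately show ?case by metis
  qed
next
  let ?n = "sum_list lam"
  assume "?blocks w"
  then show "w \<in> W_J lam"
  proof (induction "card (inversions ?n w)" arbitrary: w rule: less_induct)
    case less
    then have w: "w permutes {1..?n}" by blast
    show ?case
    proof (cases "\<exists>i. 1 \<le> i \<and> i < ?n \<and> w (Suc i) < w i")
      case True
      then obtain i where i: "1 \<le> i" "i < ?n" "w (Suc i) < w i" by blast
      have "block lam (Suc i) \<le> block lam i"
        using less.prems i block_mono[of "w (Suc i)" "w i" lam] by fastforce
      then have eq: "block lam i = block lam (Suc i)" using block_mono[of i "Suc i" lam] by simp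
      have J: "simple_refl i \<in> J_of lam" using J_of_iff i eq by blast
      have "w \<circ> simple_refl i permutes {1..?n}"
        using w simple_refl_permutes[of i ?n] i by (auto intro: permutes_compose)
      moreover have "\<forall>j\<in>{1..?n}. block lam ((w \<circ> simple_refl i) j) = block lam j"
        using less.prems i eq by (auto simp: simple_refl_def Transposition.transpose_def)
      ultimately have "w \<circ> simple_refl i \<in> W_J lam"
        using less.hyps inversions_swap_positions[OF w i] by blast
      then have "(w \<circ> simple_refl i) \<otimes>\<^bsub>sym_group ?n\<^esub> simple_refl i \<in> W_J lam"
        unfolding W_J_def using generate.eng[OF _ generate.incl[OF J]] by blast
      then show ?thesis by (simp add: sym_group_def o_assoc[symmetric])
    next
      case False
      have "w i < w (Suc i)" if "1 \<le> i" "i < ?n" for i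
        using False that permutes_inj[OF w] by (metis injD linorder_neqE_nat n_not_Suc_n)
      then have "w = id" using inversions_inj[of id ?n w] w by (auto simp: permutes_id)
      then show ?thesis unfolding W_J_def using generate.one[of "sym_group ?n"]
        by (simp add: sym_group_def)
    qed
  qed
qed

text \<open>The minimal coset representatives are the permutations that increase on every block.\<close>

lemma min_reps_iff: "d \<in> min_reps lam \<longleftrightarrow> d permutes {1..sum_list lam} \<and>
    (\<forall>i j. 1 \<le> i \<longrightarrow> i < j \<longrightarrow> j \<le> sum_list lam \<longrightarrow> block lam i = block lam j \<longrightarrow> d i < d j)"
proof
  let ?n = "sum_list lam"
  assume "d \<in> min_reps lam"
  then have d: "d permutes {1..?n}" and min: "\<And>v. v \<in> W_J lam \<Longrightarrow> cox_length ?n d \<le> cox_length ?n (d \<circ> v)"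
    by (auto simp: min_reps_def)
  have step: "d i < d (Suc i)" if "1 \<le> i" "i < ?n" "block lam i = block lam (Suc i)" for i
  proof (rule ccontr)
    assume "\<not> d i < d (Suc i)"
    then have lt: "d (Suc i) < d i" using permutes_inj[OF d] by (metis injD linorder_neqE_nat n_not_Suc_n)
    have "simple_refl i \<in> W_J lam" unfolding W_J_def using that by (intro generate.incl) (simp add: J_of_iff)
    from min[OF this] have "card (inversions ?n d) \<le> card (inversions ?n (d \<circ> simple_refl i))"
      using cox_length_eq d permutes_compose[OF simple_refl_permutes[OF that(1,2)] d] by metis
    then show False using inversions_swap_positions[OF d that(1,2) lt] by simp
  qed
  have "d i < d (i + Suc k)" if "1 \<le> i" "i + Suc k \<le> ?n" "block lam i = block lam (i + Suc k)" for i k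
    using that
  proof (induction k)
    case (Suc k)
    have "block lam i \<le> block lam (i + Suc k)" "block lam (i + Suc k) \<le> block lam (i + Suc (Suc k))"
      by (intro block_mono; simp)+
    then have "block lam i = block lam (i + Suc k)" "block lam (i + Suc k) = block lam (i + Suc (Suc k))"
      using Suc.prems by simp_all
    then show ?case using Suc step[of "i + Suc k"] by simp
  qed (use step in simp)
  then show "d permutes {1..?n} \<and>
    (\<forall>i j. 1 \<le> i \<longrightarrow> i < j \<longrightarrow> j \<le> ?n \<longrightarrow> block lam i = block lam j \<longrightarrow> d i < d j)"
    using d by (metis less_natE add_Suc_right)
next
  let ?n = "sum_list lam"
  assume as: "d permutes {1..?n} \<and>
    (\<forall>i j. 1 \<le> i \<longrightarrow> i < j \<longrightarrow> j \<le> ?n \<longrightarrow> block lam i = block lam j \<longrightarrow> d i < d j)"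
  then have d: "d permutes {1..?n}" by blast
  have "cox_length ?n d \<le> cox_length ?n (d \<circ> v)" if "v \<in> W_J lam" for v
  proof -
    have v: "v permutes {1..?n}" and bl: "\<And>i. i \<in> {1..?n} \<Longrightarrow> block lam (v i) = block lam i"
      using that W_J_iff by blast+
    let ?u = "inv_into UNIV v"
    have u: "?u permutes {1..?n}" using permutes_inv[OF v] .
    have un: "?u i \<in> {1..?n}" if "i \<in> {1..?n}" for i using permutes_in_image[OF u] that by blast
    have vu: "v (?u i) = i" for i using permutes_inverses(1)[OF v] .
    have "map_prod ?u ?u ` inversions ?n d \<subseteq> inversions ?n (d \<circ> v)"
    proof clarify
      fix i j assume ij: "(i, j) \<in> inversions ?n d"
      then have ne: "block lam i \<noteq> block lam j" using as by (fastforce simp: inversions_def)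
      then have "block lam i < block lam j" using ij block_mono[of i j lam] by (auto simp: inversions_def)
      moreover have "block lam (?u i) = block lam i" "block lam (?u j) = block lam j"
        using bl[OF un, of i] bl[OF un, of j] vu ij by (auto simp: inversions_def)
      ultimately have "?u i < ?u j" using block_mono[of "?u j" "?u i" lam] by (metis not_le)
      then show "(?u i, ?u j) \<in> inversions ?n (d \<circ> v)"
        using ij un[of i] un[of j] vu by (auto simp: inversions_def)
    qed
    then have "card (map_prod ?u ?u ` inversions ?n d) \<le> card (inversions ?n (d \<circ> v))"
      by (intro card_mono) auto
    moreover have "card (map_prod ?u ?u ` inversions ?n d) = card (inversions ?n d)"
      using permutes_inj[OF u] by (intro card_image inj_on_subset[OF prod.inj_map]) simp_all
    ultimately show ?thesis using cox_length_eq d permutes_compose[OF v d] by metis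
  qed
  then show "d \<in> min_reps lam" unfolding min_reps_def using d by simp
qed

text \<open>The longest element reverses every block.\<close>

lemma longest_J_eq:
  assumes w: "w permutes {1..sum_list lam}"
    and bl: "\<And>i. i \<in> {1..sum_list lam} \<Longrightarrow> block lam (w i) = block lam i"
    and dec: "\<And>i j. 1 \<le> i \<Longrightarrow> i < j \<Longrightarrow> j \<le> sum_list lam \<Longrightarrow> block lam i = block lam j \<Longrightarrow> w j < w i"
  shows "longest_J lam = w"
  unfolding longest_J_def
proof (rule the_equality)
  let ?n = "sum_list lam"
  have sub: "inversions ?n v \<subseteq> inversions ?n w" if "v \<in> W_J lam" for v
  proof clarify
    fix i j assume ij: "(i, j) \<in> inversions ?n v"
    have "block lam j \<le> block lam i"
      using that ij block_mono[of "v j" "v i" lam] by (auto simp: W_J_iff inversions_def)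
    then have "block lam i = block lam j" using block_mono[of i j lam] ij by (auto simp: inversions_def)
    then show "(i, j) \<in> inversions ?n w" using dec ij by (auto simp: inversions_def)
  qed
  have wW: "w \<in> W_J lam" using w bl W_J_iff by blast
  have len: "cox_length ?n v = card (inversions ?n v)" if "v \<in> W_J lam" for v
    using that W_J_iff cox_length_eq by blast
  show "w \<in> W_J lam \<and> (\<forall>v\<in>W_J lam. cox_length ?n v \<le> cox_length ?n w)"
    using wW len sub by (simp add: card_mono)
  fix v assume v: "v \<in> W_J lam \<and> (\<forall>u\<in>W_J lam. cox_length ?n u \<le> cox_length ?n v)"
  then have "inversions ?n v = inversions ?n w"
    using len sub wW by (metis card_seteq finite_inversions)
  then show "v = w" using inversions_ascent[of v ?n w] v w
    by (metis W_J_iff card_mono finite_inversions n_not_Suc_n le_antisym lessI not_less order_refl)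
qed

section \<open>Rank functions and fillings\<close>

text \<open>Both fillings of a diagram send a node to its rank with respect to a linear order: the
  lexicographic order for the filling by rows, and the same order after exchanging the coordinates
  for the filling by columns.\<close>

lemma rank_mono:
  fixes h :: "'a \<Rightarrow> 'b::linorder"
  assumes "finite A" "x \<in> A" "y \<in> A"
  shows "card {z \<in> A. h z \<le> h x} \<le> card {z \<in> A. h z \<le> h y} \<longleftrightarrow> h x \<le> h y"
proof
  assume "h x \<le> h y"
  then show "card {z \<in> A. h z \<le> h x} \<le> card {z \<in> A. h z \<le> h y}"
    using assms(1) by (intro card_mono) auto
next
  assume le: "card {z \<in> A. h z \<le> h x} \<le> card {z \<in> A. h z \<le> h y}"
  show "h x \<le> h y"
  proof (rule ccontr)
    assume "\<not> h x \<le> h y"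
    then have "{z \<in> A. h z \<le> h y} \<subset> {z \<in> A. h z \<le> h x}" using assms by auto
    then show False using le assms(1) psubset_card_mono[of "{z \<in> A. h z \<le> h x}" "{z \<in> A. h z \<le> h y}"]
      by (simp add: not_le)
  qed
qed

lemma rank_bij:
  fixes h :: "'a \<Rightarrow> 'b::linorder"
  assumes "finite A" "inj_on h A"
  shows "bij_betw (\<lambda>x. card {z \<in> A. h z \<le> h x}) A {1..card A}" (is "bij_betw ?r _ _")
proof -
  have inj: "inj_on ?r A"
  proof (rule inj_onI)
    fix x y assume "x \<in> A" "y \<in> A" "?r x = ?r y"
    then have "h x = h y"
      using rank_mono[OF assms(1), of x y h] rank_mono[OF assms(1), of y x h] by simp
    then show "x = y" using inj_onD[OF assms(2)] \<open>x \<in> A\<close> \<open>y \<in> A\<close> by blast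
  qed
  have "?r ` A \<subseteq> {1..card A}"
  proof clarify
    fix x assume "x \<in> A"
    then have "{x} \<subseteq> {z \<in> A. h z \<le> h x}" by auto
    then have "card {x} \<le> ?r x" using assms(1) by (intro card_mono) auto
    moreover have "?r x \<le> card A" using assms(1) by (intro card_mono) auto
    ultimately show "?r x \<in> {1..card A}" by simp
  qed
  then have "?r ` A = {1..card A}" using card_image[OF inj] by (intro card_subset_eq) auto
  then show ?thesis using inj by (simp add: bij_betw_def)
qed

lemma rank_reverse:
  fixes h :: "'a \<Rightarrow> 'b::linorder"
  assumes "finite A" "inj_on h A" "x \<in> A"
  shows "card {z \<in> A. h x \<le> h z} + card {z \<in> A. h z \<le> h x} = Suc (card A)"
proof -
  have "{z \<in> A. h x \<le> h z} \<union> {z \<in> A. h z \<le> h x} = A" by auto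
  moreover have "{z \<in> A. h x \<le> h z} \<inter> {z \<in> A. h z \<le> h x} = {x}"
    using assms by (auto dest: inj_onD)
  ultimately show ?thesis
    using card_Un_Int[of "{z \<in> A. h x \<le> h z}" "{z \<in> A. h z \<le> h x}"] assms(1) by simp
qed

lemma row_filling_rank: "row_filling D x = card {z \<in> D. z \<le> x}"
proof -
  have "{(a', b') \<in> D. a' < fst x \<or> (a' = fst x \<and> b' \<le> snd x)} = {z \<in> D. z \<le> x}"
    by (auto simp: less_eq_prod_def)
  then show ?thesis by (simp add: row_filling_def case_prod_beta)
qed

lemma col_filling_rank: "col_filling D x = card {z \<in> D. prod.swap z \<le> prod.swap x}"
proof -
  have "{(a', b') \<in> D. b' < snd x \<or> (b' = snd x \<and> a' \<le> fst x)} = {z \<in> D. prod.swap z \<le> prod.swap x}"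
    by (auto simp: less_eq_prod_def)
  then show ?thesis by (simp add: col_filling_def case_prod_beta)
qed

lemma row_filling_bij: "finite D \<Longrightarrow> bij_betw (row_filling D) D {1..card D}"
  using rank_bij[of D "\<lambda>x. x"] by (simp add: row_filling_rank[abs_def])

lemma col_filling_bij: "finite D \<Longrightarrow> bij_betw (col_filling D) D {1..card D}"
  using rank_bij[of D prod.swap] by (simp add: col_filling_rank[abs_def])

lemma row_filling_le:
  "finite D \<Longrightarrow> (a, b) \<in> D \<Longrightarrow> (a', b') \<in> D \<Longrightarrow>
    row_filling D (a, b) \<le> row_filling D (a', b') \<longleftrightarrow> a < a' \<or> a = a' \<and> b \<le> b'"
  using rank_mono[of D "(a, b)" "(a', b')" "\<lambda>x. x"] by (auto simp: row_filling_rank less_eq_prod_def)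

lemma col_filling_le:
  "finite D \<Longrightarrow> (a, b) \<in> D \<Longrightarrow> (a', b') \<in> D \<Longrightarrow>
    col_filling D (a, b) \<le> col_filling D (a', b') \<longleftrightarrow> b < b' \<or> b = b' \<and> a \<le> a'"
  using rank_mono[of D "(a, b)" "(a', b')" prod.swap] by (auto simp: col_filling_rank less_eq_prod_def)

lemma row_filling_less:
  assumes "finite D" "(a, b) \<in> D" "(a', b') \<in> D"
  shows "row_filling D (a, b) < row_filling D (a', b') \<longleftrightarrow> a < a' \<or> a = a' \<and> b < b'"
  using row_filling_le[OF assms(1,3,2)] by (auto simp: not_le[symmetric])

lemma col_filling_less:
  assumes "finite D" "(a, b) \<in> D" "(a', b') \<in> D"
  shows "col_filling D (a, b) < col_filling D (a', b') \<longleftrightarrow> b < b' \<or> b = b' \<and> a < a'"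
  using col_filling_le[OF assms(1,3,2)] by (auto simp: not_le[symmetric])

lemma diagram_perm_eqI:
  assumes D: "finite D" and w: "w permutes {1..card D}"
    and v: "\<And>x. x \<in> D \<Longrightarrow> w (row_filling D x) = col_filling D x"
  shows "diagram_perm D = w"
  unfolding diagram_perm_def
proof (rule the_equality)
  fix w' assume w': "w' permutes {1..card D} \<and> (\<forall>x\<in>D. w' (row_filling D x) = col_filling D x)"
  show "w' = w"
  proof
    fix i show "w' i = w i"
    proof (cases "i \<in> {1..card D}")
      case True
      then obtain x where "x \<in> D" "i = row_filling D x"
        using row_filling_bij[OF D] by (metis bij_betw_def imageE)
      then show ?thesis using w' v by simp
    next
      case False
      then show ?thesis using w w' by (metis permutes_not_in)
    qed
  qed
qed (use w v in blast)

lemma diagram_perm: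
  assumes "finite D"
  shows "diagram_perm D permutes {1..card D}"
    and "x \<in> D \<Longrightarrow> diagram_perm D (row_filling D x) = col_filling D x"
proof -
  define w where "w i = (if i \<in> {1..card D} then col_filling D (inv_into D (row_filling D) i) else i)" for i
  have r: "bij_betw (inv_into D (row_filling D)) {1..card D} D"
    using row_filling_bij[OF assms] by (rule bij_betw_inv_into)
  have "bij_betw (col_filling D \<circ> inv_into D (row_filling D)) {1..card D} {1..card D}"
    using r col_filling_bij[OF assms] by (rule bij_betw_trans)
  then have "bij_betw w {1..card D} {1..card D}" by (rule bij_betw_cong[THEN iffD1, rotated]) (simp add: w_def)
  then have w: "w permutes {1..card D}" by (rule bij_imp_permutes) (auto simp: w_def)
  have v: "w (row_filling D x) = col_filling D x" if "x \<in> D" for x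
  proof -
    have "row_filling D x \<in> {1..card D}" using row_filling_bij[OF assms] that by (auto simp: bij_betw_def)
    moreover have "inv_into D (row_filling D) (row_filling D x) = x"
      using row_filling_bij[OF assms] that by (auto simp: bij_betw_def)
    ultimately show ?thesis by (simp add: w_def)
  qed
  have "diagram_perm D = w" using diagram_perm_eqI[OF assms w v] .
  then show "diagram_perm D permutes {1..card D}"
    and "x \<in> D \<Longrightarrow> diagram_perm D (row_filling D x) = col_filling D x" using w v by auto
qed

section \<open>Diagrams with prescribed row lengths\<close>

lemma is_diagram_range:
  assumes "is_diagram D"
  shows "fst ` D = {1..nrows D}" "snd ` D = {1..ncols D}"
    "x \<in> D \<Longrightarrow> fst x \<in> {1..nrows D}" "x \<in> D \<Longrightarrow> snd x \<in> {1..ncols D}"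
proof -
  obtain r c where "fst ` D = {1..r}" "snd ` D = {1..c}" using assms unfolding is_diagram_def by blast
  then show *: "fst ` D = {1..nrows D}" "snd ` D = {1..ncols D}" by (simp_all add: nrows_def ncols_def)
  show "x \<in> D \<Longrightarrow> fst x \<in> {1..nrows D}" "x \<in> D \<Longrightarrow> snd x \<in> {1..ncols D}"
    unfolding *[symmetric] by blast+
qed

lemma diagrams_of_facts:
  assumes "D \<in> diagrams_of lam"
  shows "finite D" "is_diagram D" "fst ` D = {1..length lam}" "snd ` D = {1..ncols D}"
    "1 \<le> k \<Longrightarrow> k \<le> length lam \<Longrightarrow> card {b. (k, b) \<in> D} = lam ! (k - 1)"
proof -
  show D: "is_diagram D" using assms by (simp add: diagrams_of_def)
  then show "finite D" by (simp add: is_diagram_def)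
  show "fst ` D = {1..length lam}" "snd ` D = {1..ncols D}"
    using is_diagram_range[OF D] assms by (simp_all add: diagrams_of_def)
  show "1 \<le> k \<Longrightarrow> k \<le> length lam \<Longrightarrow> card {b. (k, b) \<in> D} = lam ! (k - 1)"
    using assms by (simp add: diagrams_of_def)
qed

lemma diagrams_of_range:
  assumes "D \<in> diagrams_of lam" "(a, b) \<in> D"
  shows "1 \<le> a" "a \<le> length lam" "1 \<le> b" "b \<le> ncols D"
proof -
  have "a \<in> fst ` D" "b \<in> snd ` D" using assms(2) by force+
  then show "1 \<le> a" "a \<le> length lam" "1 \<le> b" "b \<le> ncols D"
    using diagrams_of_facts(3,4)[OF assms(1)] by auto
qed

lemma finite_row: "D \<in> diagrams_of lam \<Longrightarrow> finite {b. (a, b) \<in> D}"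
  by (rule finite_subset[of _ "snd ` D"]) (use diagrams_of_facts(1) in \<open>force+\<close>)

lemma card_rows_before:
  assumes D: "D \<in> diagrams_of lam" and m: "m \<le> length lam"
  shows "card {x \<in> D. fst x \<le> m} = sum_list (take m lam)"
  using m
proof (induction m)
  case 0
  have "{x \<in> D. fst x \<le> 0} = {}" using diagrams_of_range(1)[OF D] by force
  then have "card {x \<in> D. fst x \<le> 0} = 0" by (simp only: card.empty)
  then show ?case by simp
next
  case (Suc m)
  note f = diagrams_of_facts[OF D]
  have "{x \<in> D. fst x \<le> Suc m} = {x \<in> D. fst x \<le> m} \<union> Pair (Suc m) ` {b. (Suc m, b) \<in> D}"
    by (auto simp: le_Suc_eq)
  moreover have fin: "finite {b. (Suc m, b) \<in> D}"
    by (rule finite_row[OF D])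
  ultimately have "card {x \<in> D. fst x \<le> Suc m}
      = card {x \<in> D. fst x \<le> m} + card (Pair (Suc m) ` {b. (Suc m, b) \<in> D})"
    using f(1) by (auto intro!: card_Un_disjoint)
  also have "card (Pair (Suc m) ` {b. (Suc m, b) \<in> D}) = lam ! m"
    using f(5)[of "Suc m"] Suc.prems by (simp add: card_image inj_on_def)
  finally show ?case using Suc by (simp add: take_Suc_conv_app_nth)
qed

lemma card_diagrams_of:
  assumes "D \<in> diagrams_of lam"
  shows "card D = sum_list lam"
proof -
  have "{x \<in> D. fst x \<le> length lam} = D" using diagrams_of_range(2)[OF assms] by force
  then show ?thesis using card_rows_before[OF assms order_refl] by simp
qed

lemma row_filling_eq:
  assumes D: "D \<in> diagrams_of lam" and x: "(a, b) \<in> D"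
  shows "row_filling D (a, b) = sum_list (take (a - 1) lam) + card {b'. (a, b') \<in> D \<and> b' \<le> b}"
proof -
  note f = diagrams_of_facts[OF D]
  have a: "1 \<le> a" "a \<le> length lam" using diagrams_of_range[OF D x] by simp_all
  have "{z \<in> D. z \<le> (a, b)} = {x \<in> D. fst x \<le> a - 1} \<union> Pair a ` {b'. (a, b') \<in> D \<and> b' \<le> b}"
  proof -
    have "z \<le> (a, b) \<longleftrightarrow> fst z \<le> a - 1 \<or> fst z = a \<and> snd z \<le> b" for z
      using a(1) unfolding less_eq_prod_def fst_conv snd_conv by arith
    then show ?thesis by (auto simp: image_iff)
  qed
  moreover have "finite {b'. (a, b') \<in> D \<and> b' \<le> b}" by (rule finite_subset[of _ "{..b}"]) auto
  moreover have "{x \<in> D. fst x \<le> a - 1} \<inter> Pair a ` {b'. (a, b') \<in> D \<and> b' \<le> b} = {}" using a by auto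
  ultimately have "row_filling D (a, b) = card {x \<in> D. fst x \<le> a - 1} + card (Pair a ` {b'. (a, b') \<in> D \<and> b' \<le> b})"
    using f(1) by (simp add: row_filling_rank card_Un_disjoint)
  then show ?thesis using card_rows_before[OF D, of "a - 1"] a by (simp add: card_image inj_on_def)
qed

lemma sum_list_take_mono: "i \<le> j \<Longrightarrow> sum_list (take i xs) \<le> sum_list (take j (xs :: nat list))"
proof -
  assume "i \<le> j"
  then have "take j xs = take i xs @ take (j - i) (drop i xs)" by (metis le_add_diff_inverse take_add)
  then show ?thesis by simp
qed

lemma block_row_filling:
  assumes D: "D \<in> diagrams_of lam" and x: "(a, b) \<in> D"
  shows "block lam (row_filling D (a, b)) = a - 1"
proof -
  note f = diagrams_of_facts[OF D]
  have a: "1 \<le> a" "a \<le> length lam" using diagrams_of_range[OF D x] by simp_all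
  have fin: "finite {b. (a, b) \<in> D}" by (rule finite_row[OF D])
  have "{b} \<subseteq> {b'. (a, b') \<in> D \<and> b' \<le> b}" using x by auto
  then have "card {b} \<le> card {b'. (a, b') \<in> D \<and> b' \<le> b}"
    by (intro card_mono) (auto intro: finite_subset[OF _ fin])
  then have lo: "sum_list (take (a - 1) lam) < row_filling D (a, b)"
    using row_filling_eq[OF D x] by simp
  have "card {b'. (a, b') \<in> D \<and> b' \<le> b} \<le> card {b. (a, b) \<in> D}" using fin by (intro card_mono) auto
  moreover have "take a lam = take (a - 1) lam @ [lam ! (a - 1)]"
    using a take_Suc_conv_app_nth[of "a - 1" lam] by simp
  ultimately have hi: "row_filling D (a, b) \<le> sum_list (take a lam)"
    using row_filling_eq[OF D x] f(5)[OF a] by simp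
  have "{k. 1 \<le> k \<and> k < length lam \<and> sum_list (take k lam) < row_filling D (a, b)} = {1..a - 1}"
  proof (rule Set.set_eqI, rule iffI)
    fix k assume k: "k \<in> {k. 1 \<le> k \<and> k < length lam \<and> sum_list (take k lam) < row_filling D (a, b)}"
    have "\<not> a \<le> k" using k hi sum_list_take_mono[of a k lam] by fastforce
    then show "k \<in> {1..a - 1}" using k by auto
  next
    fix k assume k: "k \<in> {1..a - 1}"
    then have "sum_list (take k lam) \<le> sum_list (take (a - 1) lam)" by (intro sum_list_take_mono) simp
    then show "k \<in> {k. 1 \<le> k \<and> k < length lam \<and> sum_list (take k lam) < row_filling D (a, b)}"
      using k a lo by auto
  qed
  then show ?thesis by (simp add: block_def)
qed

lemma diagram_position:
  assumes "D \<in> diagrams_of lam" "i \<in> {1..sum_list lam}"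
  obtains a b where "(a, b) \<in> D" "row_filling D (a, b) = i"
proof -
  have "i \<in> row_filling D ` D"
    using row_filling_bij[OF diagrams_of_facts(1)[OF assms(1)]] assms card_diagrams_of[OF assms(1)]
    by (simp add: bij_betw_def)
  then show ?thesis using that by (metis imageE prod.collapse)
qed

lemma row_filling_range:
  assumes "D \<in> diagrams_of lam" "x \<in> D"
  shows "row_filling D x \<in> {1..sum_list lam}"
  using bij_betw_apply[OF row_filling_bij[OF diagrams_of_facts(1)[OF assms(1)]] assms(2)]
    card_diagrams_of[OF assms(1)] by simp

lemma diagram_perm_facts:
  assumes "D \<in> diagrams_of lam"
  shows "diagram_perm D permutes {1..sum_list lam}"
    and "x \<in> D \<Longrightarrow> diagram_perm D (row_filling D x) = col_filling D x"
  using diagram_perm[OF diagrams_of_facts(1)[OF assms]] card_diagrams_of[OF assms] by auto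

text \<open>The entries of a row of the diagram form a block, and the filling by columns increases along it.\<close>

lemma diagram_perm_min_reps:
  assumes D: "D \<in> diagrams_of lam"
  shows "diagram_perm D \<in> min_reps lam"
  unfolding min_reps_iff
proof (intro conjI allI impI)
  note f = diagrams_of_facts[OF D]
  show "diagram_perm D permutes {1..sum_list lam}" using diagram_perm_facts(1)[OF D] .
  fix i j assume ij: "1 \<le> i" "i < j" "j \<le> sum_list lam" "block lam i = block lam j"
  obtain a b where x: "(a, b) \<in> D" "row_filling D (a, b) = i" using diagram_position[OF D, of i] ij by auto
  obtain a' b' where y: "(a', b') \<in> D" "row_filling D (a', b') = j" using diagram_position[OF D, of j] ij by auto
  have "1 \<le> a" "1 \<le> a'" using diagrams_of_range[OF D x(1)] diagrams_of_range[OF D y(1)] by simp_all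
  moreover have "a - 1 = a' - 1" using ij(4) block_row_filling[OF D] x y by metis
  ultimately have "a = a'" by simp
  then have "b < b'" using row_filling_less[OF f(1) x(1) y(1)] ij x y by simp
  then have "col_filling D (a, b) < col_filling D (a', b')" using col_filling_less[OF f(1) x(1) y(1)] by simp
  then show "diagram_perm D i < diagram_perm D j" using diagram_perm_facts(2)[OF D] x y by metis
qed

text \<open>Nodes give an inversion if and only if the second lies strictly below and strictly to the left
  of the first.\<close>

lemma inversions_diagram_perm:
  assumes D: "D \<in> diagrams_of lam" and x: "(a, b) \<in> D" "(a', b') \<in> D"
  shows "(row_filling D (a, b), row_filling D (a', b')) \<in> inversions (sum_list lam) (diagram_perm D)
    \<longleftrightarrow> a < a' \<and> b' < b"
proof -
  note f = diagrams_of_facts[OF D]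
  have "(row_filling D (a, b), row_filling D (a', b')) \<in> inversions (sum_list lam) (diagram_perm D) \<longleftrightarrow>
      row_filling D (a, b) < row_filling D (a', b') \<and> col_filling D (a', b') < col_filling D (a, b)"
    using row_filling_range[OF D x(1)] row_filling_range[OF D x(2)]
      diagram_perm_facts(2)[OF D x(1)] diagram_perm_facts(2)[OF D x(2)] by (auto simp: inversions_def)
  then show ?thesis
    unfolding row_filling_less[OF f(1) x(1) x(2)] col_filling_less[OF f(1) x(2) x(1)] by auto
qed

text \<open>A row that meets every column determines the diagram. The length of this row is a lower bound for the
  number of columns of any diagram with the same row lengths, and if the bound is attained, then the
  column of every other node can be read off by comparing its entry with the entries of the full row.\<close>

lemma min_diagram_full_row:
  assumes D: "D \<in> diagrams_of lam" and r: "1 \<le> r" "r \<le> length lam"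
    and full: "\<And>j. 1 \<le> j \<Longrightarrow> j \<le> ncols D \<Longrightarrow> (r, j) \<in> D"
  shows "min_diagram (diagram_perm D) lam = D"
proof -
  note f = diagrams_of_facts[OF D]
  have rowD: "{b. (r, b) \<in> D} = {1..ncols D}" using full diagrams_of_range(3,4)[OF D] by auto
  then have lamr: "lam ! (r - 1) = ncols D" using f(5)[OF r] by simp
  have main: "ncols D \<le> ncols E \<and> (ncols E = ncols D \<longrightarrow> E = D)"
    if E: "E \<in> diagrams_of lam" and eq: "diagram_perm E = diagram_perm D" for E
  proof
    note g = diagrams_of_facts[OF E]
    have sub: "{b. (r, b) \<in> E} \<subseteq> {1..ncols E}" using diagrams_of_range(3,4)[OF E] by auto
    then have "card {b. (r, b) \<in> E} \<le> ncols E" using card_mono[OF _ sub] by simp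
    then show "ncols D \<le> ncols E" using g(5)[OF r] lamr by simp
    show "ncols E = ncols D \<longrightarrow> E = D"
    proof
      assume nc: "ncols E = ncols D"
      have rowE: "{b. (r, b) \<in> E} = {1..ncols D}"
        using sub g(5)[OF r] lamr nc by (intro card_subset_eq) auto
      have "E \<subseteq> D"
      proof clarify
        fix a b assume ab: "(a, b) \<in> E"
        have b: "b \<in> {1..ncols D}" using diagrams_of_range(3,4)[OF E ab] nc by simp
        obtain a' b' where x: "(a', b') \<in> D" "row_filling D (a', b') = row_filling E (a, b)"
          using diagram_position[OF D row_filling_range[OF E ab]] .
        have "1 \<le> a" "1 \<le> a'"
          using diagrams_of_range(1)[OF E ab] diagrams_of_range(1)[OF D x(1)] by simp_all
        then have aa: "a' = a" using block_row_filling[OF D x(1)] block_row_filling[OF E ab] x(2) by simp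
        have b': "b' \<in> {1..ncols D}" using diagrams_of_range(3,4)[OF D x(1)] by simp
        \<comment> \<open>Both diagrams contain the full row, with the same entries.\<close>
        have key: "(r, j) \<in> D \<and> (r, j) \<in> E \<and> col_filling E (r, j) = col_filling D (r, j)" if "j \<in> {1..ncols D}" for j
        proof -
          have j: "(r, j) \<in> D" "(r, j) \<in> E" using rowD rowE that by auto
          have "(r, b') \<in> D \<longleftrightarrow> (r, b') \<in> E" for b' using rowD rowE by blast
          then have "row_filling D (r, j) = row_filling E (r, j)"
            using row_filling_eq[OF D j(1)] row_filling_eq[OF E j(2)] by simp
          then show ?thesis using j diagram_perm_facts(2)[OF D j(1)] diagram_perm_facts(2)[OF E j(2)] eq by metis
        qed
        have col: "col_filling E (a, b) = col_filling D (a, b')"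
          using diagram_perm_facts(2)[OF D x(1)] diagram_perm_facts(2)[OF E ab] eq x(2) aa by metis
        have xD: "(a, b') \<in> D" using x aa by simp
        have "b' = b"
        proof (cases "a \<le> r")
          case True
          have "b' \<le> b"
            using col_filling_le[OF f(1) xD, of r b] col_filling_le[OF g(1) ab, of r b] key[OF b] col True by auto
          moreover have "b \<le> b'"
            using col_filling_le[OF f(1) xD, of r b'] col_filling_le[OF g(1) ab, of r b'] key[OF b'] col True by auto
          ultimately show ?thesis by simp
        next
          case False
          have "b \<le> b'"
            using col_filling_le[OF f(1) _ xD, of r b] col_filling_le[OF g(1) _ ab, of r b] key[OF b] col False by auto
          moreover have "b' \<le> b"
            using col_filling_le[OF f(1) _ xD, of r b'] col_filling_le[OF g(1) _ ab, of r b'] key[OF b'] col False by auto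
          ultimately show ?thesis by simp
        qed
        then show "(a, b) \<in> D" using xD by simp
      qed
      then show "E = D" using f(1) card_diagrams_of[OF D] card_diagrams_of[OF E] by (intro card_subset_eq) auto
    qed
  qed
  show ?thesis unfolding min_diagram_def
  proof (rule the_equality)
    show "D \<in> diagrams_of lam \<and> diagram_perm D = diagram_perm D \<and>
      (\<forall>E\<in>diagrams_of lam. diagram_perm E = diagram_perm D \<longrightarrow> ncols D \<le> ncols E)"
      using D main by blast
    fix E assume E: "E \<in> diagrams_of lam \<and> diagram_perm E = diagram_perm D \<and>
      (\<forall>F\<in>diagrams_of lam. diagram_perm F = diagram_perm D \<longrightarrow> ncols E \<le> ncols F)"
    then have "ncols E \<le> ncols D" using D by blast
    then show "E = D" using main[of E] E by auto
  qed
qed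

section \<open>Rotation\<close>

text \<open>The reversal of \<open>{1..n}\<close>, extended by the identity so that it is a permutation in the sense of
  \<open>permutes\<close>.\<close>

definition reflect :: "nat \<Rightarrow> nat \<Rightarrow> nat" where
  "reflect n i = (if 1 \<le> i \<and> i \<le> n then n + 1 - i else i)"

lemma reflect_reflect [simp]: "reflect n (reflect n i) = i"
  by (auto simp: reflect_def)

lemma reflect_in: "i \<in> {1..n} \<Longrightarrow> reflect n i \<in> {1..n}"
  by (auto simp: reflect_def)

lemma reflect_less: "i \<in> {1..n} \<Longrightarrow> j \<in> {1..n} \<Longrightarrow> reflect n i < reflect n j \<longleftrightarrow> j < i"
  by (auto simp: reflect_def)

lemma reflect_le: "i \<in> {1..n} \<Longrightarrow> j \<in> {1..n} \<Longrightarrow> reflect n i \<le> reflect n j \<longleftrightarrow> j \<le> i"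
  by (auto simp: reflect_def)

lemma reflect_bij: "bij_betw (reflect n) {1..n} {1..n}"
  by (rule bij_betwI[of _ _ _ "reflect n"]) (auto simp: reflect_def)

lemma reflect_inj: "inj (reflect n)"
  by (rule inj_on_inverseI[of _ "reflect n"]) simp

lemma reflect_permutes: "reflect n permutes {1..n}"
  using reflect_bij by (rule bij_imp_permutes) (auto simp: reflect_def)

text \<open>Conjugation by the longest element of the symmetric group. It corresponds to rotating diagrams.\<close>

definition rotate_perm :: "nat \<Rightarrow> (nat \<Rightarrow> nat) \<Rightarrow> nat \<Rightarrow> nat" where
  "rotate_perm n w = (\<lambda>i. reflect n (w (reflect n i)))"

lemma rotate_perm_rotate_perm [simp]: "rotate_perm n (rotate_perm n w) = w"
  by (simp add: rotate_perm_def)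

lemma rotate_perm_permutes:
  assumes "w permutes {1..n}"
  shows "rotate_perm n w permutes {1..n}"
proof -
  have "reflect n \<circ> (w \<circ> reflect n) permutes {1..n}"
    by (rule permutes_compose[OF permutes_compose[OF reflect_permutes assms] reflect_permutes])
  then show ?thesis by (simp add: rotate_perm_def o_def)
qed

lemma inversions_rotate_perm:
  assumes "w permutes {1..n}"
  shows "(i, j) \<in> inversions n (rotate_perm n w) \<longleftrightarrow> (reflect n j, reflect n i) \<in> inversions n w"
proof (cases "i \<in> {1..n} \<and> j \<in> {1..n}")
  case True
  then have "w (reflect n i) \<in> {1..n}" "w (reflect n j) \<in> {1..n}"
    using permutes_in_image[OF assms] reflect_in by blast+
  then show ?thesis
    using True reflect_in[of i n] reflect_in[of j n] reflect_less[of i n j] reflect_less[of j n i]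
      reflect_less[of "w (reflect n i)" n "w (reflect n j)"]
      reflect_less[of "w (reflect n j)" n "w (reflect n i)"]
    by (auto simp: inversions_def rotate_perm_def)
next
  case False
  then show ?thesis by (auto simp: inversions_def reflect_def)
qed

lemma cox_prefix_rotate:
  assumes "x permutes {1..n}" "y permutes {1..n}"
  shows "cox_prefix n (rotate_perm n x) (rotate_perm n y) \<longleftrightarrow> cox_prefix n x y"
proof -
  have "inversions n (rotate_perm n x) \<subseteq> inversions n (rotate_perm n y) \<longleftrightarrow> inversions n x \<subseteq> inversions n y"
    unfolding subset_iff split_paired_All inversions_rotate_perm[OF assms(1)] inversions_rotate_perm[OF assms(2)]
    by (metis reflect_reflect)
  then show ?thesis using cox_prefix_iff rotate_perm_permutes assms by simp
qed

lemma rotate_diagram_eq: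
  assumes "is_diagram D"
  shows "rotate_diagram D = map_prod (reflect (nrows D)) (reflect (ncols D)) ` D"
  unfolding rotate_diagram_def
proof (rule image_cong[OF refl])
  fix x assume x: "x \<in> D"
  have "fst x \<in> {1..nrows D}" "snd x \<in> {1..ncols D}" using is_diagram_range[OF assms] x by blast+
  then show "(case x of (a, b) \<Rightarrow> (nrows D + 1 - a, ncols D + 1 - b)) = map_prod (reflect (nrows D)) (reflect (ncols D)) x"
    by (cases x) (auto simp: reflect_def)
qed

lemma rotate_diagram_facts:
  assumes "is_diagram D"
  shows "fst ` rotate_diagram D = {1..nrows D}" "snd ` rotate_diagram D = {1..ncols D}"
    "nrows (rotate_diagram D) = nrows D" "ncols (rotate_diagram D) = ncols D"
    "is_diagram (rotate_diagram D)" "rotate_diagram (rotate_diagram D) = D"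
proof -
  let ?R = "reflect (nrows D)" and ?C = "reflect (ncols D)"
  have D: "fst ` D = {1..nrows D}" "snd ` D = {1..ncols D}" "finite D" "D \<noteq> {}"
    using is_diagram_range[OF assms] assms by (simp_all add: is_diagram_def)
  have "fst ` rotate_diagram D = ?R ` fst ` D" "snd ` rotate_diagram D = ?C ` snd ` D"
    unfolding rotate_diagram_eq[OF assms] by (simp_all add: image_image)
  then show r: "fst ` rotate_diagram D = {1..nrows D}" "snd ` rotate_diagram D = {1..ncols D}"
    using D reflect_bij by (simp_all add: bij_betw_def)
  then show n: "nrows (rotate_diagram D) = nrows D" "ncols (rotate_diagram D) = ncols D"
    by (simp_all add: nrows_def[of "rotate_diagram D"] ncols_def[of "rotate_diagram D"])
  have "finite (rotate_diagram D)" "rotate_diagram D \<noteq> {}"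
    using D by (simp_all add: rotate_diagram_def)
  then show d: "is_diagram (rotate_diagram D)" unfolding is_diagram_def using r by blast
  show "rotate_diagram (rotate_diagram D) = D"
    unfolding rotate_diagram_eq[OF d] n unfolding rotate_diagram_eq[OF assms]
    by (simp add: image_image prod.map_comp o_def prod.map_ident)
qed

lemma rotate_in_diagrams_of:
  assumes D: "D \<in> diagrams_of lam"
  shows "rotate_diagram D \<in> diagrams_of (rev lam)"
proof -
  note f = diagrams_of_facts[OF D] and g = rotate_diagram_facts[OF diagrams_of_facts(2)[OF D]]
  have nr: "nrows D = length lam" using D by (simp add: diagrams_of_def)
  have "card {b. (k, b) \<in> rotate_diagram D} = rev lam ! (k - 1)" if k: "k \<in> {1..length lam}" for k
  proof -
    have k': "length lam + 1 - k \<in> {1..length lam}" using k by auto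
    have "{b. (k, b) \<in> rotate_diagram D} = reflect (ncols D) ` {b. (length lam + 1 - k, b) \<in> D}"
    proof -
      have "(k, b) \<in> rotate_diagram D \<longleftrightarrow> (reflect (nrows D) k, reflect (ncols D) b) \<in> D" for b
        unfolding rotate_diagram_eq[OF f(2)] by (force simp: image_iff)
      moreover have "reflect (nrows D) k = length lam + 1 - k" using k nr by (auto simp: reflect_def)
      ultimately show ?thesis by (force simp: image_iff)
    qed
    then have "card {b. (k, b) \<in> rotate_diagram D} = card {b. (length lam + 1 - k, b) \<in> D}"
      using inj_on_subset[OF reflect_inj] by (simp add: card_image)
    also have "\<dots> = lam ! (length lam - k)" using f(5)[of "length lam + 1 - k"] k' by simp
    also have "\<dots> = rev lam ! (k - 1)" using k by (subst rev_nth) auto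
    finally show ?thesis .
  qed
  then show ?thesis using g(3,5) nr by (simp add: diagrams_of_def)
qed

lemma diagram_perm_rotate:
  assumes D: "D \<in> diagrams_of lam"
  shows "diagram_perm (rotate_diagram D) = rotate_perm (sum_list lam) (diagram_perm D)"
proof -
  let ?n = "sum_list lam" and ?E = "rotate_diagram D"
  let ?f = "map_prod (reflect (nrows D)) (reflect (ncols D))"
  note f = diagrams_of_facts[OF D] and E = rotate_in_diagrams_of[OF D]
  note g = diagrams_of_facts[OF E] and c = card_diagrams_of[OF D] and cE = card_diagrams_of[OF E]
  have Eeq: "?E = ?f ` D" by (rule rotate_diagram_eq[OF f(2)])
  have inj: "inj ?f" by (rule prod.inj_map[OF reflect_inj reflect_inj])
  have rng: "fst x \<in> {1..nrows D}" "snd x \<in> {1..ncols D}" if "x \<in> D" for x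
    using is_diagram_range[OF f(2)] that by blast+
  have le1: "?f z \<le> ?f x \<longleftrightarrow> x \<le> z" if "x \<in> D" "z \<in> D" for x z
    using rng[OF that(1)] rng[OF that(2)]
    by (cases x; cases z) (simp add: less_eq_prod_def reflect_le reflect_less)
  have le2: "prod.swap (?f z) \<le> prod.swap (?f x) \<longleftrightarrow> prod.swap x \<le> prod.swap z" if "x \<in> D" "z \<in> D" for x z
    using rng[OF that(1)] rng[OF that(2)]
    by (cases x; cases z) (simp add: less_eq_prod_def reflect_le reflect_less)
  have row: "row_filling ?E (?f x) = reflect ?n (row_filling D x)" if x: "x \<in> D" for x
  proof -
    have "{z \<in> ?E. z \<le> ?f x} = ?f ` {z \<in> D. x \<le> z}" unfolding Eeq using le1[OF x] by auto
    then have "row_filling ?E (?f x) = card {z \<in> D. x \<le> z}"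
      unfolding row_filling_rank using inj_on_subset[OF inj] by (simp add: card_image)
    moreover have "card {z \<in> D. x \<le> z} + row_filling D x = Suc ?n"
      using rank_reverse[of D "\<lambda>x. x" x] x f(1) c by (simp add: row_filling_rank)
    ultimately show ?thesis using row_filling_range[OF D x] by (auto simp: reflect_def)
  qed
  have colr: "col_filling D x \<in> {1..?n}" if "x \<in> D" for x
    using bij_betw_apply[OF col_filling_bij[OF f(1)] that] c by simp
  have col: "col_filling ?E (?f x) = reflect ?n (col_filling D x)" if x: "x \<in> D" for x
  proof -
    have "{z \<in> ?E. prod.swap z \<le> prod.swap (?f x)} = ?f ` {z \<in> D. prod.swap x \<le> prod.swap z}"
      unfolding Eeq using le2[OF x] by auto
    then have "col_filling ?E (?f x) = card {z \<in> D. prod.swap x \<le> prod.swap z}"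
      unfolding col_filling_rank using inj_on_subset[OF inj] by (simp add: card_image)
    moreover have "card {z \<in> D. prod.swap x \<le> prod.swap z} + col_filling D x = Suc ?n"
      using rank_reverse[of D prod.swap x] x f(1) c by (simp add: col_filling_rank)
    ultimately show ?thesis using colr[OF x] by (auto simp: reflect_def)
  qed
  show ?thesis
  proof (rule diagram_perm_eqI)
    show "finite ?E" using g(1) .
    show "rotate_perm ?n (diagram_perm D) permutes {1..card ?E}"
      using rotate_perm_permutes[OF diagram_perm_facts(1)[OF D]] cE by (simp add: sum_list_rev)
    fix y assume "y \<in> ?E"
    then have "y \<in> ?f ` D" by (simp only: Eeq)
    then obtain x where x: "x \<in> D" "y = ?f x" by (rule imageE)
    have "rotate_perm ?n (diagram_perm D) (row_filling ?E (?f x)) = col_filling ?E (?f x)"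
      by (simp only: row[OF x(1)] col[OF x(1)] rotate_perm_def reflect_reflect
          diagram_perm_facts(2)[OF D x(1)])
    then show "rotate_perm ?n (diagram_perm D) (row_filling ?E y) = col_filling ?E y"
      by (simp only: x(2))
  qed
qed

lemma special_rotate:
  assumes "special_diagram D"
  shows "special_diagram (rotate_diagram D)"
proof -
  have D: "is_diagram D" using assms by (simp add: special_diagram_def)
  obtain \<mu> \<sigma> \<tau> where m: "is_partition \<mu>" "\<sigma> permutes (fst ` young_diagram \<mu>)"
    "\<tau> permutes (snd ` young_diagram \<mu>)" "D = (\<lambda>(a, b). (\<sigma> a, \<tau> b)) ` young_diagram \<mu>"
    using assms by (auto simp: special_diagram_def)
  have Deq: "D = map_prod \<sigma> \<tau> ` young_diagram \<mu>" using m(4) by (simp add: map_prod_def)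
  have "fst ` D = \<sigma> ` fst ` young_diagram \<mu>" "snd ` D = \<tau> ` snd ` young_diagram \<mu>"
    unfolding Deq by (simp_all add: image_image)
  then have "fst ` D = fst ` young_diagram \<mu>" "snd ` D = snd ` young_diagram \<mu>"
    using permutes_image m by metis+
  moreover have "fst ` D = {1..nrows D}" "snd ` D = {1..ncols D}"
    using is_diagram_range[OF D] by simp_all
  ultimately have r: "fst ` young_diagram \<mu> = {1..nrows D}" "snd ` young_diagram \<mu> = {1..ncols D}" by auto
  have "rotate_diagram D = (\<lambda>(a, b). ((reflect (nrows D) \<circ> \<sigma>) a, (reflect (ncols D) \<circ> \<tau>) b)) ` young_diagram \<mu>"
    unfolding rotate_diagram_eq[OF D] unfolding Deq image_image by (intro image_cong) auto
  moreover have "reflect (nrows D) \<circ> \<sigma> permutes (fst ` young_diagram \<mu>)"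
    "reflect (ncols D) \<circ> \<tau> permutes (snd ` young_diagram \<mu>)"
    using m(2,3) unfolding r by (auto intro!: permutes_compose reflect_permutes)
  ultimately show ?thesis unfolding special_diagram_def
    using rotate_diagram_facts(5)[OF D] m(1) by blast
qed

section \<open>Compositions with three parts\<close>

lemma block_three: "block [a, b, c] i = (if i \<le> a then 0 else if i \<le> a + b then 1 else 2)"
proof -
  have "k \<in> {k. 1 \<le> k \<and> k < length [a, b, c] \<and> sum_list (take k [a, b, c]) < i} \<longleftrightarrow>
      k = 1 \<and> a < i \<or> k = 2 \<and> a + b < i" for k
  proof -
    consider "k = 0" | "k = 1" | "k = 2" | "3 \<le> k" by linarith
    then show ?thesis by cases (auto simp: take_Cons' numeral_2_eq_2)
  qed
  then have "{k. 1 \<le> k \<and> k < length [a, b, c] \<and> sum_list (take k [a, b, c]) < i} =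
      (if i \<le> a then {} else if i \<le> a + b then {1} else {1, 2})" by auto
  then show ?thesis by (simp add: block_def)
qed

text \<open>The longest element of the parabolic subgroup of the composition \<open>[a, b, c]\<close>.\<close>

definition block_reversal :: "nat \<Rightarrow> nat \<Rightarrow> nat \<Rightarrow> nat \<Rightarrow> nat" where
  "block_reversal a b c i =
    (if 1 \<le> i \<and> i \<le> a then a + 1 - i
     else if a < i \<and> i \<le> a + b then 2 * a + b + 1 - i
     else if a + b < i \<and> i \<le> a + b + c then 2 * (a + b) + c + 1 - i else i)"

lemma three_blocks_cases:
  fixes i :: nat
  assumes "i \<in> {1..a + b + c}"
  obtains "1 \<le> i" "i \<le> a" | "a < i" "i \<le> a + b" | "a + b < i" "i \<le> a + b + c"
proof -
  have "1 \<le> i \<and> i \<le> a \<or> a < i \<and> i \<le> a + b \<or> a + b < i \<and> i \<le> a + b + c"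
    using assms by auto
  then show ?thesis using that by blast
qed

lemma block_reversal_in:
  assumes "i \<in> {1..a + b + c}"
  shows "block_reversal a b c i \<in> {1..a + b + c}"
    "block_reversal a b c (block_reversal a b c i) = i"
    "block [a, b, c] (block_reversal a b c i) = block [a, b, c] i"
  using assms by (cases rule: three_blocks_cases; auto simp: block_reversal_def block_three)+

lemma block_reversal_permutes: "block_reversal a b c permutes {1..a + b + c}"
proof (rule bij_imp_permutes)
  show "bij_betw (block_reversal a b c) {1..a + b + c} {1..a + b + c}"
    using block_reversal_in by (intro bij_betwI[of _ _ _ "block_reversal a b c"]) blast+
qed (auto simp: block_reversal_def)

lemmas block_block_reversal = block_reversal_in(3)

lemma block_reversal_less:
  assumes "1 \<le> i" "i < j" "j \<le> a + b + c" "block [a, b, c] i = block [a, b, c] j"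
  shows "block_reversal a b c j < block_reversal a b c i"
proof -
  consider "j \<le> a" | "a < i" "j \<le> a + b" | "a + b < i"
    using assms(2,4) by (fastforce simp: block_three split: if_splits)
  then show ?thesis using assms(1-3) by cases (auto simp: block_reversal_def)
qed

lemma longest_J_three: "longest_J [a, b, c] = block_reversal a b c"
proof (rule longest_J_eq)
  have n: "sum_list [a, b, c] = a + b + c" by simp
  show "block_reversal a b c permutes {1..sum_list [a, b, c]}"
    unfolding n by (rule block_reversal_permutes)
  show "block [a, b, c] (block_reversal a b c i) = block [a, b, c] i" if "i \<in> {1..sum_list [a, b, c]}" for i
    using that unfolding n by (rule block_block_reversal)
  show "block_reversal a b c j < block_reversal a b c i"
    if "1 \<le> i" "i < j" "j \<le> sum_list [a, b, c]" "block [a, b, c] i = block [a, b, c] j" for i j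
    using that unfolding n by (rule block_reversal_less)
qed

lemma block_reversal_rotate:
  "block_reversal c b a = rotate_perm (a + b + c) (block_reversal a b c)"
proof
  fix i
  consider "i = 0 \<or> a + b + c < i" | "1 \<le> i" "i \<le> c" | "c < i" "i \<le> c + b" | "c + b < i" "i \<le> a + b + c"
    by linarith
  then show "block_reversal c b a i = rotate_perm (a + b + c) (block_reversal a b c) i"
    by cases (auto simp: rotate_perm_def reflect_def block_reversal_def)
qed

lemma min_reps_run:
  assumes "e \<in> min_reps lam" "1 \<le> i" "i < j" "j \<le> sum_list lam" "block lam i = block lam j"
  shows "e i < e j"
  using assms unfolding min_reps_iff by blast

lemma min_reps_permutes: "e \<in> min_reps lam \<Longrightarrow> e permutes {1..sum_list lam}"
  unfolding min_reps_iff by blast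

lemma id_min_reps: "id \<in> min_reps lam"
  unfolding min_reps_iff by (simp add: permutes_id)

section \<open>Columns are increasing chains\<close>

text \<open>The nodes of a column of \<open>D\<close> lie in different blocks. If \<open>e\<close> increases down the columns, then they
  give increasing subsequences of \<open>e\<close> after the blocks have been reversed by \<open>v\<close>, and \<open>k\<close> decreasing
  subsequences meet such a column at most \<open>k\<close> times.\<close>

lemma column_chain_bound:
  assumes D: "D \<in> diagrams_of lam" and v: "v permutes {1..sum_list lam}"
    and bl: "\<And>i. i \<in> {1..sum_list lam} \<Longrightarrow> block lam (v i) = block lam i"
    and e: "\<And>a a' b. (a, b) \<in> D \<Longrightarrow> (a', b) \<in> D \<Longrightarrow> a < a' \<Longrightarrow>
      e (row_filling D (a, b)) < e (row_filling D (a', b))"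
    and f: "pos_colouring (sum_list lam) k (\<lambda>i. e (v i)) f"
  shows "card {i \<in> {1..sum_list lam}. f i < k} \<le> (\<Sum>j\<in>{1..ncols D}. min k (card {a. (a, j) \<in> D}))"
proof -
  let ?n = "sum_list lam"
  define g where "g = (\<lambda>i. inv_into D (row_filling D) (v i))"
  have "bij_betw (inv_into D (row_filling D)) {1..?n} D"
    using bij_betw_inv_into[OF row_filling_bij[OF diagrams_of_facts(1)[OF D]]] card_diagrams_of[OF D] by simp
  from bij_betw_trans[OF permutes_imp_bij[OF v] this]
  have g: "bij_betw g {1..?n} D" by (simp add: g_def o_def)
  have vi: "v i \<in> {1..?n}" if "i \<in> {1..?n}" for i using permutes_in_image[OF v] that by blast
  have rg: "row_filling D (g i) = v i" if "i \<in> {1..?n}" for i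
    using bij_betw_inv_into_right[OF row_filling_bij[OF diagrams_of_facts(1)[OF D]]] vi[OF that]
      card_diagrams_of[OF D] by (simp add: g_def)
  have gD: "g i \<in> D" if "i \<in> {1..?n}" for i using bij_betw_apply[OF g that] .
  have "e (v i) < e (v j)" if ij: "1 \<le> i" "i < j" "j \<le> ?n" "snd (g i) = snd (g j)" for i j
  proof -
    have i: "i \<in> {1..?n}" and j: "j \<in> {1..?n}" using ij by auto
    obtain a b where x: "g i = (a, b)" by fastforce
    then obtain a' where y: "g j = (a', b)" using ij(4) by (metis prod.collapse snd_conv)
    have "g i \<noteq> g j" using inj_onD[OF bij_betw_imp_inj_on[OF g] _ i j] ij(2) by auto
    then have ne: "a \<noteq> a'" using x y by simp
    have "block lam (v i) = a - 1" "block lam (v j) = a' - 1"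
      using block_row_filling[OF D, of a b] block_row_filling[OF D, of a' b] gD[OF i] gD[OF j] rg[OF i] rg[OF j] x y
      by simp_all
    moreover have "block lam i \<le> block lam j" using ij by (intro block_mono) simp
    moreover have "1 \<le> a" "1 \<le> a'" using diagrams_of_range(1)[OF D] gD[OF i] gD[OF j] x y by metis+
    ultimately have "a < a'" using bl[OF i] bl[OF j] ne by simp
    then show ?thesis using e[of a b a'] gD[OF i] gD[OF j] rg[OF i] rg[OF j] x y by simp
  qed
  from chain_bound[OF f this]
  have le: "card {i \<in> {1..?n}. f i < k}
    \<le> (\<Sum>x\<in>(\<lambda>i. snd (g i)) ` {1..?n}. min k (card {i \<in> {1..?n}. snd (g i) = x}))" by simp
  have im: "(\<lambda>i. snd (g i)) ` {1..?n} = {1..ncols D}"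
    using g diagrams_of_facts(4)[OF D] by (simp add: bij_betw_def image_image[of snd g, symmetric])
  have "card {i \<in> {1..?n}. snd (g i) = x} = card {a. (a, x) \<in> D}" for x
  proof -
    have "inj_on g {i \<in> {1..?n}. snd (g i) = x}"
      by (rule inj_on_subset[OF bij_betw_imp_inj_on[OF g]]) auto
    then have "card {i \<in> {1..?n}. snd (g i) = x} = card (g ` {i \<in> {1..?n}. snd (g i) = x})"
      by (simp add: card_image)
    also have "g ` {i \<in> {1..?n}. snd (g i) = x} = {z \<in> g ` {1..?n}. snd z = x}" by auto
    also have "\<dots> = (\<lambda>a. (a, x)) ` {a. (a, x) \<in> D}"
      unfolding bij_betw_imp_surj_on[OF g] by (auto simp: image_iff)
    also have "card \<dots> = card {a. (a, x) \<in> D}" by (simp add: card_image inj_on_def)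
    finally show ?thesis .
  qed
  then show ?thesis using le unfolding im by simp
qed

section \<open>Nested diagrams\<close>

text \<open>Diagrams with three rows, in some order, of which the longest is full and the others are nested in it.
  The numbers \<open>s\<close>, \<open>t\<close>, \<open>u\<close> are the row lengths.\<close>

definition nested_diagram :: "nat \<Rightarrow> nat \<Rightarrow> nat \<Rightarrow> diagram \<Rightarrow> bool" where
  "nested_diagram s t u D \<longleftrightarrow> (\<exists>p q r T U. {p, q, r} = {1, 2, 3} \<and> U \<subseteq> T \<and> T \<subseteq> {1..s} \<and>
     card T = t \<and> card U = u \<and> D = {p} \<times> {1..s} \<union> {q} \<times> T \<union> {r} \<times> U)"

lemma nested_diagramE:
  assumes "nested_diagram s t u D" "1 \<le> u"
  obtains p q r T U where "{p, q, r} = {1, 2, 3}" "p \<noteq> q" "p \<noteq> r" "q \<noteq> r" "U \<subseteq> T" "T \<subseteq> {1..s}"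
     "card T = t" "card U = u" "D = {p} \<times> {1..s} \<union> {q} \<times> T \<union> {r} \<times> U"
     "finite T" "finite U" "u \<le> t" "t \<le> s" "T \<noteq> {}" "U \<noteq> {}"
proof -
  obtain p q r T U where *: "{p, q, r} = {1, 2, 3 :: nat}" "U \<subseteq> T" "T \<subseteq> {1..s}"
     "card T = t" "card U = u" "D = {p} \<times> {1..s} \<union> {q} \<times> T \<union> {r} \<times> U"
    using assms(1) unfolding nested_diagram_def by blast
  have "card {p, q, r} = 3" unfolding *(1) by simp
  then have "p \<noteq> q" "p \<noteq> r" "q \<noteq> r" by (auto simp: card_insert_if split: if_splits)
  moreover have fin: "finite T" "finite U" using * by (meson finite_atLeastAtMost finite_subset)+
  moreover have "u \<le> t" using card_mono[OF fin(1) *(2)] * by simp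
  moreover have "t \<le> s" using card_mono[OF _ *(3)] * by simp
  moreover have "U \<noteq> {}" using *(5) assms(2) by auto
  moreover have "T \<noteq> {}" using calculation *(2) by auto
  ultimately show ?thesis using that * by blast
qed

lemma nested_diagram_facts:
  assumes "nested_diagram s t u D" "1 \<le> u"
  shows "is_diagram D" "nrows D = 3" "ncols D = s" "\<exists>p\<in>{1..3}. \<forall>j\<in>{1..s}. (p, j) \<in> D"
    "(\<Sum>j\<in>{1..s}. min 1 (card {a. (a, j) \<in> D})) = s"
    "(\<Sum>j\<in>{1..s}. min 2 (card {a. (a, j) \<in> D})) = s + t"
proof -
  obtain p q r T U where h: "{p, q, r} = {1, 2, 3}" "p \<noteq> q" "p \<noteq> r" "q \<noteq> r" "U \<subseteq> T" "T \<subseteq> {1..s}"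
     "card T = t" "card U = u" "D = {p} \<times> {1..s} \<union> {q} \<times> T \<union> {r} \<times> U"
     "finite T" "finite U" "u \<le> t" "t \<le> s" "T \<noteq> {}" "U \<noteq> {}"
    using nested_diagramE[OF assms] .
  have s: "1 \<le> s" using h assms(2) by simp
  have "fst ` D = {p, q, r}" unfolding h(9) image_Un using s h(14,15) by (simp, auto)
  also have "\<dots> = {1..3}" unfolding h(1) by auto
  finally have rows: "fst ` D = {1..3}" .
  have cols: "snd ` D = {1..s}" unfolding h(9) image_Un using h(5,6,14,15) by auto
  have "finite D" "D \<noteq> {}" using h s by auto
  then show "is_diagram D" unfolding is_diagram_def using rows cols by blast
  show "nrows D = 3" "ncols D = s" by (simp_all add: nrows_def ncols_def rows cols)
  have "p \<in> {1, 2, 3}" unfolding h(1)[symmetric] by simp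
  then have "p \<in> {1..3}" by auto
  then show "\<exists>p\<in>{1..3}. \<forall>j\<in>{1..s}. (p, j) \<in> D" unfolding h(9) by blast
  have cnt: "card {a. (a, j) \<in> D} = 1 + of_bool (j \<in> T) + of_bool (j \<in> U)" if "j \<in> {1..s}" for j
  proof -
    have "{a. (a, j) \<in> D} = {p} \<union> (if j \<in> T then {q} else {}) \<union> (if j \<in> U then {r} else {})"
      using that by (auto simp: h(9))
    then show ?thesis using h(2,3,4) by (auto simp: card_insert_if)
  qed
  show "(\<Sum>j\<in>{1..s}. min 1 (card {a. (a, j) \<in> D})) = s"
    using cnt by simp
  have "(\<Sum>j\<in>{1..s}. min 2 (card {a. (a, j) \<in> D})) = (\<Sum>j\<in>{1..s}. 1 + of_bool (j \<in> T))"
    using cnt h(5) by (intro sum.cong) (auto simp: of_bool_def)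
  also have "\<dots> = s + card ({1..s} \<inter> T)"
    by (simp add: sum.distrib of_bool_def sum.If_cases)
  also have "{1..s} \<inter> T = T" using h(6) by blast
  finally show "(\<Sum>j\<in>{1..s}. min 2 (card {a. (a, j) \<in> D})) = s + t" using h(7) by simp
qed

lemma permutation_onto_chain:
  assumes "U \<subseteq> T" "T \<subseteq> {1..s}"
  obtains \<tau> where "\<tau> permutes {1..s}" "\<tau> ` {1..card T} = T" "\<tau> ` {1..card U} = U"
proof -
  have fin: "finite T" "finite U" using assms by (meson finite_atLeastAtMost finite_subset)+
  have le: "card U \<le> card T" "card T \<le> s"
    using card_mono[OF fin(1) assms(1)] card_mono[OF _ assms(2)] by simp_all
  obtain f where f: "bij_betw f {1..card U} U"
    using finite_same_card_bij[of "{1..card U}" U] fin by auto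
  obtain g where g: "bij_betw g {card U + 1..card T} (T - U)"
    using finite_same_card_bij[of "{card U + 1..card T}" "T - U"] fin card_Diff_subset[OF fin(2) assms(1)] by auto
  obtain h where h: "bij_betw h {card T + 1..s} ({1..s} - T)"
    using finite_same_card_bij[of "{card T + 1..s}" "{1..s} - T"] card_Diff_subset[OF fin(1) assms(2)] by auto
  define \<tau> where "\<tau> i = (if i \<in> {1..card U} then f i else if i \<in> {card U + 1..card T} then g i
    else if i \<in> {card T + 1..s} then h i else i)" for i
  have 1: "bij_betw \<tau> {1..card U} U"
    by (rule bij_betw_cong[THEN iffD1, OF _ f]) (simp add: \<tau>_def)
  have 2: "bij_betw \<tau> {card U + 1..card T} (T - U)"
    by (rule bij_betw_cong[THEN iffD1, OF _ g]) (simp add: \<tau>_def)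
  have 3: "bij_betw \<tau> {card T + 1..s} ({1..s} - T)"
    using le by (intro bij_betw_cong[THEN iffD1, OF _ h]) (simp add: \<tau>_def)
  have "bij_betw \<tau> ({1..card U} \<union> {card U + 1..card T}) (U \<union> (T - U))"
    by (rule bij_betw_combine[OF 1 2]) blast
  moreover have "{1..card U} \<union> {card U + 1..card T} = {1..card T}" "U \<union> (T - U) = T" using le assms by auto
  ultimately have 4: "bij_betw \<tau> {1..card T} T" by simp
  have "bij_betw \<tau> ({1..card T} \<union> {card T + 1..s}) (T \<union> ({1..s} - T))"
    by (rule bij_betw_combine[OF 4 3]) blast
  moreover have "{1..card T} \<union> {card T + 1..s} = {1..s}" "T \<union> ({1..s} - T) = {1..s}" using le assms by auto
  ultimately have 5: "bij_betw \<tau> {1..s} {1..s}" by simp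
  then have "\<tau> permutes {1..s}" using le by (intro bij_imp_permutes) (auto simp: \<tau>_def)
  then show ?thesis using that 1 4 by (simp add: bij_betw_def)
qed

lemma young_diagram_three:
  "young_diagram [x, y, z] = {1} \<times> {1..x} \<union> {2} \<times> {1..y} \<union> {3} \<times> {1..z}"
proof -
  have "(i, j) \<in> young_diagram [x, y, z] \<longleftrightarrow> (i, j) \<in> {1} \<times> {1..x} \<union> {2} \<times> {1..y} \<union> {3} \<times> {1..z}" for i j
  proof -
    consider "i = 0" | "i = 1" | "i = 2" | "i = 3" | "4 \<le> i" by linarith
    then show ?thesis by cases (auto simp: young_diagram_def numeral_2_eq_2 numeral_3_eq_3)
  qed
  then show ?thesis by auto
qed

lemma nested_diagram_special:
  assumes "nested_diagram s t u D" "1 \<le> u"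
  shows "special_diagram D"
proof -
  obtain p q r T U where h: "{p, q, r} = {1, 2, 3}" "p \<noteq> q" "p \<noteq> r" "q \<noteq> r" "U \<subseteq> T" "T \<subseteq> {1..s}"
     "card T = t" "card U = u" "D = {p} \<times> {1..s} \<union> {q} \<times> T \<union> {r} \<times> U"
     "finite T" "finite U" "u \<le> t" "t \<le> s" "T \<noteq> {}" "U \<noteq> {}"
    using nested_diagramE[OF assms] .
  obtain \<tau> where \<tau>: "\<tau> permutes {1..s}" "\<tau> ` {1..t} = T" "\<tau> ` {1..u} = U"
    using permutation_onto_chain[OF h(5,6)] h(7,8) by metis
  define \<sigma> where "\<sigma> i = (if i = 1 then p else if i = 2 then q else if i = 3 then r else i)" for i :: nat
  have "\<sigma> permutes {1, 2, 3}"
  proof (rule bij_imp_permutes)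
    have "\<sigma> ` {1, 2, 3} = {p, q, r}" by (auto simp: \<sigma>_def)
    then show "bij_betw \<sigma> {1, 2, 3} {1, 2, 3}"
      using h(1) h(2-4) by (auto simp: bij_betw_def inj_on_def \<sigma>_def)
  qed (auto simp: \<sigma>_def)
  moreover have "fst ` young_diagram [s, t, u] = {1, 2, 3}" "snd ` young_diagram [s, t, u] = {1..s}"
    unfolding young_diagram_three image_Un using h(12,13) assms(2) by auto
  moreover have "(\<lambda>(a, b). (\<sigma> a, \<tau> b)) ` young_diagram [s, t, u] = D"
  proof -
    have "(\<lambda>(a, b). (\<sigma> a, \<tau> b)) ` ({x} \<times> Y) = {\<sigma> x} \<times> \<tau> ` Y" for x Y by auto
    then show ?thesis unfolding young_diagram_three image_Un h(9)
      using \<tau>(2,3) permutes_image[OF \<tau>(1)] by (simp add: \<sigma>_def)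
  qed
  moreover have "is_partition [s, t, u]" using h(12,13) assms(2) by (auto simp: is_partition_def composition_def)
  ultimately show ?thesis unfolding special_diagram_def
    using nested_diagram_facts(1)[OF assms] \<tau>(1) by (intro conjI exI[of _ "[s, t, u]"] exI[of _ \<sigma>] exI[of _ \<tau>]) simp_all
qed

section \<open>The set Z\<close>

text \<open>At most \<open>m\<close> letters of \<open>w 1, \<dots>, w n\<close> are covered by \<open>k\<close> disjoint decreasing subsequences.\<close>

definition bounded_colourings :: "nat \<Rightarrow> nat \<Rightarrow> nat \<Rightarrow> (nat \<Rightarrow> nat) \<Rightarrow> bool" where
  "bounded_colourings n k m w \<longleftrightarrow> (\<forall>f. pos_colouring n k w f \<longrightarrow> card {i \<in> {1..n}. f i < k} \<le> m)"

lemma bounded_colourings_nested: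
  assumes D: "D \<in> diagrams_of [a, b, c]" and N: "nested_diagram s t u D" "1 \<le> u"
    and e: "\<And>x x' y. (x, y) \<in> D \<Longrightarrow> (x', y) \<in> D \<Longrightarrow> x < x' \<Longrightarrow>
      e (row_filling D (x, y)) < e (row_filling D (x', y))"
  shows "bounded_colourings (a + b + c) 1 s (\<lambda>i. e (block_reversal a b c i))"
    and "bounded_colourings (a + b + c) 2 (s + t) (\<lambda>i. e (block_reversal a b c i))"
proof -
  have n: "sum_list [a, b, c] = a + b + c" by simp
  have "card {i \<in> {1..a + b + c}. f i < k} \<le> (\<Sum>j\<in>{1..ncols D}. min k (card {x. (x, j) \<in> D}))"
    if "pos_colouring (a + b + c) k (\<lambda>i. e (block_reversal a b c i)) f" for k f
    using column_chain_bound[of D "[a, b, c]" "block_reversal a b c" e k f, unfolded n,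
        OF D block_reversal_permutes block_block_reversal e that] .
  then show "bounded_colourings (a + b + c) 1 s (\<lambda>i. e (block_reversal a b c i))"
    and "bounded_colourings (a + b + c) 2 (s + t) (\<lambda>i. e (block_reversal a b c i))"
    unfolding bounded_colourings_def using nested_diagram_facts(3,5,6)[OF N] by fastforce+
qed

lemma diagrams_of_three:
  assumes "is_diagram D" "nrows D = 3" "card {j. (1, j) \<in> D} = a" "card {j. (2, j) \<in> D} = b" "card {j. (3, j) \<in> D} = c"
  shows "D \<in> diagrams_of [a, b, c]"
proof -
  have "card {j. (k, j) \<in> D} = [a, b, c] ! (k - 1)" if "k \<in> {1..3}" for k
  proof -
    have "k = 1 \<or> k = 2 \<or> k = 3" using that by auto
    then consider "k = 1" | "k = 2" | "k = 3" by blast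
    then show ?thesis using assms(3-5) by cases (simp_all add: numeral_2_eq_2)
  qed
  then show ?thesis using assms(1,2) by (simp add: diagrams_of_def numeral_3_eq_3)
qed

lemma mset_three:
  assumes "mset [a, b, c] = {#s, t, u#}"
  shows "(a = s \<and> b = t \<and> c = u) \<or> (a = s \<and> b = u \<and> c = t) \<or> (a = t \<and> b = s \<and> c = u)
      \<or> (a = t \<and> b = u \<and> c = s) \<or> (a = u \<and> b = s \<and> c = t) \<or> (a = u \<and> b = t \<and> c = s)"
  using assms by (auto simp: add_eq_conv_ex)

lemma nested_young_diagram:
  assumes m: "mset [a, b, c] = {#s, t, u#}" and o: "u \<le> t" "t \<le> s"
  shows "nested_diagram s t u (young_diagram [a, b, c])"
proof -
  note w = nested_diagram_def young_diagram_three
  from mset_three[OF m] show ?thesis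
  proof (elim disjE)
    assume "a = s \<and> b = t \<and> c = u"
    then show ?thesis unfolding w using o
      by (intro exI[of _ 1] exI[of _ 2] exI[of _ 3] exI[of _ "{1..t}"] exI[of _ "{1..u}"]) auto
  next
    assume "a = s \<and> b = u \<and> c = t"
    then show ?thesis unfolding w using o
      by (intro exI[of _ 1] exI[of _ 3] exI[of _ 2] exI[of _ "{1..t}"] exI[of _ "{1..u}"]) auto
  next
    assume "a = t \<and> b = s \<and> c = u"
    then show ?thesis unfolding w using o
      by (intro exI[of _ 2] exI[of _ 1] exI[of _ 3] exI[of _ "{1..t}"] exI[of _ "{1..u}"]) auto
  next
    assume "a = t \<and> b = u \<and> c = s"
    then show ?thesis unfolding w using o
      by (intro exI[of _ 3] exI[of _ 1] exI[of _ 2] exI[of _ "{1..t}"] exI[of _ "{1..u}"]) auto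
  next
    assume "a = u \<and> b = s \<and> c = t"
    then show ?thesis unfolding w using o
      by (intro exI[of _ 2] exI[of _ 3] exI[of _ 1] exI[of _ "{1..t}"] exI[of _ "{1..u}"]) auto
  next
    assume "a = u \<and> b = t \<and> c = s"
    then show ?thesis unfolding w using o
      by (intro exI[of _ 3] exI[of _ 2] exI[of _ 1] exI[of _ "{1..t}"] exI[of _ "{1..u}"]) auto
  qed
qed

lemma young_diagram_in:
  assumes m: "mset [a, b, c] = {#s, t, u#}" and o: "u \<le> t" "t \<le> s" "1 \<le> u"
  shows "young_diagram [a, b, c] \<in> diagrams_of [a, b, c]"
proof (rule diagrams_of_three)
  show "is_diagram (young_diagram [a, b, c])" "nrows (young_diagram [a, b, c]) = 3"
    using nested_diagram_facts(1,2)[OF nested_young_diagram[OF m o(1,2)] o(3)] .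
  have "{j. (1, j) \<in> young_diagram [a, b, c]} = {1..a}" "{j. (2, j) \<in> young_diagram [a, b, c]} = {1..b}"
    "{j. (3, j) \<in> young_diagram [a, b, c]} = {1..c}" by (auto simp: young_diagram_three)
  then show "card {j. (1, j) \<in> young_diagram [a, b, c]} = a" "card {j. (2, j) \<in> young_diagram [a, b, c]} = b"
    "card {j. (3, j) \<in> young_diagram [a, b, c]} = c" by (simp_all only: card_atLeastAtMost diff_Suc_1 Suc_eq_plus1 add_diff_cancel_right')
qed

text \<open>Membership of \<open>Z\<close> is the statement that the first column of the shape has length at most \<open>s\<close> and
  the first two have total length at most \<open>s + t\<close>. Both bounds hold for the longest element itself,
  because the columns of the left-justified diagram are increasing chains.\<close>

lemma Z_set_iff:
  assumes m: "mset [a, b, c] = {#s, t, u#}" and o: "u \<le> t" "t \<le> s" "1 \<le> u"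
  defines "n \<equiv> a + b + c" and "v \<equiv> block_reversal a b c"
  shows "e \<in> Z_set [a, b, c] \<longleftrightarrow> e \<in> min_reps [a, b, c] \<and>
    bounded_colourings n 1 s (\<lambda>i. e (v i)) \<and> bounded_colourings n 2 (s + t) (\<lambda>i. e (v i))"
proof (cases "e \<in> min_reps [a, b, c]")
  case e: True
  have n: "sum_list [a, b, c] = n" by (simp add: n_def)
  have v: "v permutes {1..n}" unfolding v_def n_def by (rule block_reversal_permutes)
  have inj: "inj_on (\<lambda>i. d (v i)) {1..n}" if "d \<in> min_reps [a, b, c]" for d
    using permutes_inj_on[OF permutes_compose[OF v min_reps_permutes[OF that, unfolded n]]] by (simp add: o_def)
  note Yd = young_diagram_in[OF m o]
  have "bounded_colourings n 1 s (\<lambda>i. id (v i)) \<and> bounded_colourings n 2 (s + t) (\<lambda>i. id (v i))"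
    unfolding n_def v_def
    using bounded_colourings_nested[OF Yd nested_young_diagram[OF m o(1,2)] o(3), of id]
      row_filling_less[OF diagrams_of_facts(1)[OF Yd]] by simp
  then have idb: "bounded_colourings n 1 s (\<lambda>i. id (v i))" "bounded_colourings n 2 (s + t) (\<lambda>i. id (v i))" by auto
  have col: "column_sum n k (\<lambda>i. d (v i)) \<le> x"
    if "d \<in> min_reps [a, b, c]" "bounded_colourings n k x (\<lambda>i. d (v i))" for d k x
    using greene_ex[OF inj[OF that(1)]] that(2) unfolding bounded_colourings_def by metis
  have cell: "e \<in> Z_set [a, b, c] \<longleftrightarrow> recording_tableau n (\<lambda>i. e (v i)) = recording_tableau n (\<lambda>i. id (v i))"
    unfolding Z_set_def right_cell_equiv_def longest_J_three n v_def using e by (simp add: o_def)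
  show ?thesis
  proof
    assume "e \<in> Z_set [a, b, c]"
    then have eq: "column_sum n k (\<lambda>i. e (v i)) = column_sum n k (\<lambda>i. id (v i))" for k
      using cell column_sum_recording_tableau by blast
    have "bounded_colourings n k x (\<lambda>i. e (v i))" if "bounded_colourings n k x (\<lambda>i. id (v i))" for k x
      unfolding bounded_colourings_def
      using greene_le[OF inj[OF e]] eq[of k] col[OF id_min_reps that] by (metis le_trans)
    then show "e \<in> min_reps [a, b, c] \<and>
      bounded_colourings n 1 s (\<lambda>i. e (v i)) \<and> bounded_colourings n 2 (s + t) (\<lambda>i. e (v i))"
      using e idb by blast
  next
    assume b: "e \<in> min_reps [a, b, c] \<and>
      bounded_colourings n 1 s (\<lambda>i. e (v i)) \<and> bounded_colourings n 2 (s + t) (\<lambda>i. e (v i))"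
    have rows: "new_row (\<lambda>i. d (v i)) i =
        (if i \<le> a then i - 1 else if i \<le> a + b then i - a - 1 else i - (a + b) - 1)"
      if d: "d \<in> min_reps [a, b, c]" and bd: "bounded_colourings n 1 s (\<lambda>i. d (v i))"
        "bounded_colourings n 2 (s + t) (\<lambda>i. d (v i))" and i: "1 \<le> i" "i \<le> n" for d i
    proof -
      have desc: "d (v (Suc j)) < d (v j)"
        if j: "1 \<le> j" "j < n" "block [a, b, c] j = block [a, b, c] (Suc j)" for j
      proof (rule min_reps_run[OF d])
        have "v j \<in> {1..n}" "v (Suc j) \<in> {1..n}" using permutes_in_image[OF v] j by simp_all
        then show "1 \<le> v (Suc j)" "v j \<le> sum_list [a, b, c]" using n by auto
        show "v (Suc j) < v j" unfolding v_def using j by (intro block_reversal_less) (auto simp: n_def)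
        show "block [a, b, c] (v (Suc j)) = block [a, b, c] (v j)"
          unfolding v_def using j block_block_reversal[of j a b c] block_block_reversal[of "Suc j" a b c]
          by (simp add: n_def)
      qed
      show ?thesis
      proof (rule new_row_three_runs[OF _ _ _ _ m])
        show "inj_on (\<lambda>i. d (v i)) {1..a + b + c}" using inj[OF d] by (simp add: n_def)
        show "column_sum (a + b + c) 1 (\<lambda>i. d (v i)) \<le> s" "column_sum (a + b + c) 2 (\<lambda>i. d (v i)) \<le> s + t"
          using col[OF d] bd by (simp_all add: n_def)
        show "i \<le> a + b + c" using i by (simp add: n_def)
      qed (use desc i in \<open>auto simp: block_three n_def\<close>)
    qed
    have "recording_tableau n (\<lambda>i. e (v i)) = recording_tableau n (\<lambda>i. id (v i))"
      by (rule recording_tableau_cong) (use rows[OF e] rows[OF id_min_reps idb] b in simp)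
    then show "e \<in> Z_set [a, b, c]" using cell by blast
  qed
qed (simp add: Z_set_def)

lemma diagram_perm_Z_set:
  assumes m: "mset [a, b, c] = {#s, t, u#}" and o: "u \<le> t" "t \<le> s" "1 \<le> u"
    and D: "D \<in> diagrams_of [a, b, c]" "nested_diagram s t u D"
  shows "diagram_perm D \<in> Z_set [a, b, c]"
proof -
  have "diagram_perm D (row_filling D (x, y)) < diagram_perm D (row_filling D (x', y))"
    if "(x, y) \<in> D" "(x', y) \<in> D" "x < x'" for x x' y
    using that diagram_perm_facts(2)[OF D(1)] col_filling_less[OF diagrams_of_facts(1)[OF D(1)]] by simp
  then show ?thesis
    using Z_set_iff[OF m o] diagram_perm_min_reps[OF D(1)] bounded_colourings_nested[OF D o(3)] by blast
qed

text \<open>The decreasing subsequences of the reversed word translated to \<open>e\<close>: only positions in different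
  blocks have to be compared, since inside a block every subset is decreasing after the reversal.\<close>

lemma Z_set_colouring:
  fixes g :: "nat \<Rightarrow> nat" and k x :: nat
  assumes m: "mset [a, b, c] = {#s, t, u#}" and o: "u \<le> t" "t \<le> s" "1 \<le> u"
    and e: "e \<in> Z_set [a, b, c]"
    and g: "\<And>i j. 1 \<le> i \<Longrightarrow> i < j \<Longrightarrow> j \<le> a + b + c \<Longrightarrow> block [a, b, c] i < block [a, b, c] j \<Longrightarrow>
      g i = g j \<Longrightarrow> g i < k \<Longrightarrow> e j < e i"
    and k: "k = 1 \<and> x = s \<or> k = 2 \<and> x = s + t"
  shows "card {i \<in> {1..a + b + c}. g i < k} \<le> x"
proof -
  let ?n = "a + b + c" and ?v = "block_reversal a b c"
  have v: "bij_betw ?v {1..?n} {1..?n}" using permutes_imp_bij[OF block_reversal_permutes] .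
  have em: "e \<in> min_reps [a, b, c]" using e by (simp add: Z_set_def)
  have "pos_colouring ?n k (\<lambda>i. e (?v i)) (\<lambda>i. g (?v i))"
    unfolding pos_colouring_def
  proof (intro allI impI)
    fix i j assume ij: "1 \<le> i \<and> i < j \<and> j \<le> ?n \<and> g (?v i) = g (?v j) \<and> g (?v i) < k"
    have r: "?v i \<in> {1..?n}" "?v j \<in> {1..?n}" using bij_betw_apply[OF v] ij by simp_all
    have bl: "block [a, b, c] (?v i) = block [a, b, c] i" "block [a, b, c] (?v j) = block [a, b, c] j"
      using block_block_reversal[of _ a b c] ij by simp_all
    show "e (?v j) < e (?v i)"
    proof (cases "block [a, b, c] i = block [a, b, c] j")
      case True
      then have "?v j < ?v i" using block_reversal_less[of i j a b c] ij by simp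
      then show ?thesis using r bl True by (intro min_reps_run[OF em]) (simp_all add: add.assoc)
    next
      case False
      then have lt: "block [a, b, c] i < block [a, b, c] j" using block_mono[of i j "[a, b, c]"] ij by simp
      then have "?v i < ?v j" using bl block_mono[of "?v j" "?v i" "[a, b, c]"] by (metis not_le)
      then show ?thesis using g[of "?v i" "?v j"] r lt bl ij by simp
    qed
  qed
  then have "card {i \<in> {1..?n}. g (?v i) < k} \<le> x"
    using Z_set_iff[OF m o] e k unfolding bounded_colourings_def by blast
  moreover have "?v ` {i \<in> {1..?n}. g (?v i) < k} = {i \<in> ?v ` {1..?n}. g i < k}" by auto
  then have "?v ` {i \<in> {1..?n}. g (?v i) < k} = {i \<in> {1..?n}. g i < k}"
    using bij_betw_imp_surj_on[OF v] by simp
  then have "card {i \<in> {1..?n}. g i < k} = card {i \<in> {1..?n}. g (?v i) < k}"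
    using card_image[OF inj_on_subset[OF bij_betw_imp_inj_on[OF v]], of "{i \<in> {1..?n}. g (?v i) < k}"]
    by (metis (no_types, lifting) mem_Collect_eq subsetI)
  ultimately show ?thesis by simp
qed

text \<open>The bounds on colourings are invariant under rotation. This replaces the evacuation of the
  recording tableau.\<close>

lemma Z_set_rotate:
  assumes m: "mset [a, b, c] = {#s, t, u#}" and o: "u \<le> t" "t \<le> s" "1 \<le> u"
    and e: "e \<in> Z_set [a, b, c]"
  shows "rotate_perm (a + b + c) e \<in> Z_set [c, b, a]"
proof -
  let ?n = "a + b + c" and ?v = "block_reversal a b c"
  have em: "e \<in> min_reps [a, b, c]" using e by (simp add: Z_set_def)
  have ep: "e permutes {1..?n}" using min_reps_permutes[OF em] by (simp add: add.assoc)
  have mr: "mset [c, b, a] = {#s, t, u#}" using m by (simp add: add_mset_commute)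
  have blr: "block [c, b, a] i = 2 - block [a, b, c] (reflect ?n i)" if "i \<in> {1..?n}" for i
    using that by (auto simp: block_three reflect_def)
  have b2: "block [a, b, c] i \<le> 2" for i by (simp add: block_three)
  have R: "rotate_perm ?n e \<in> min_reps [c, b, a]"
    unfolding min_reps_iff
  proof (intro conjI allI impI)
    show "rotate_perm ?n e permutes {1..sum_list [c, b, a]}"
      using rotate_perm_permutes[OF ep] by (simp add: ac_simps)
    fix i j assume ij: "1 \<le> i" "i < j" "j \<le> sum_list [c, b, a]" "block [c, b, a] i = block [c, b, a] j"
    then have r: "i \<in> {1..?n}" "j \<in> {1..?n}" by auto
    have ri: "reflect ?n i \<in> {1..?n}" "reflect ?n j \<in> {1..?n}" using r by (blast intro: reflect_in)+
    have "block [a, b, c] (reflect ?n i) = block [a, b, c] (reflect ?n j)"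
      using ij(4) blr[OF r(1)] blr[OF r(2)] b2[of "reflect ?n i"] b2[of "reflect ?n j"] by linarith
    then have "e (reflect ?n j) < e (reflect ?n i)"
      using ri ij(2) reflect_less[OF r(2,1)] by (intro min_reps_run[OF em]) (simp_all add: add.assoc)
    moreover have "e (reflect ?n i) \<in> {1..?n}" "e (reflect ?n j) \<in> {1..?n}"
      using permutes_in_image[OF ep] ri by blast+
    ultimately show "rotate_perm ?n e i < rotate_perm ?n e j"
      unfolding rotate_perm_def by (simp add: reflect_less)
  qed
  have B: "bounded_colourings ?n k x (\<lambda>i. rotate_perm ?n e (block_reversal c b a i))"
    if b: "bounded_colourings ?n k x (\<lambda>i. e (?v i))" for k x
    unfolding bounded_colourings_def
  proof (intro allI impI)
    fix f assume f: "pos_colouring ?n k (\<lambda>i. rotate_perm ?n e (block_reversal c b a i)) f"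
    have "pos_colouring ?n k (\<lambda>i. e (?v i)) (\<lambda>i. f (reflect ?n i))"
      unfolding pos_colouring_def
    proof (intro allI impI)
      fix i j assume ij: "1 \<le> i \<and> i < j \<and> j \<le> ?n \<and> f (reflect ?n i) = f (reflect ?n j) \<and> f (reflect ?n i) < k"
      have r: "i \<in> {1..?n}" "j \<in> {1..?n}" using ij by auto
      have ri: "reflect ?n i \<in> {1..?n}" "reflect ?n j \<in> {1..?n}" using r by (blast intro: reflect_in)+
      have "reflect ?n j < reflect ?n i" using reflect_less[OF r(2,1)] ij by simp
      then have "rotate_perm ?n e (block_reversal c b a (reflect ?n i)) < rotate_perm ?n e (block_reversal c b a (reflect ?n j))"
        using f ij ri unfolding pos_colouring_def by (metis atLeastAtMost_iff)
      then have lt: "reflect ?n (e (?v i)) < reflect ?n (e (?v j))"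
        by (simp add: block_reversal_rotate[of c b a] rotate_perm_def)
      have "?v i \<in> {1..?n}" "?v j \<in> {1..?n}" using permutes_in_image[OF block_reversal_permutes] r by blast+
      then have "e (?v i) \<in> {1..?n}" "e (?v j) \<in> {1..?n}" using permutes_in_image[OF ep] by blast+
      then show "e (?v j) < e (?v i)" using lt reflect_less by blast
    qed
    then have "card {i \<in> {1..?n}. f (reflect ?n i) < k} \<le> x" using b unfolding bounded_colourings_def by blast
    moreover have "reflect ?n ` {i \<in> {1..?n}. f (reflect ?n i) < k} = {i \<in> reflect ?n ` {1..?n}. f i < k}" by auto
    then have "reflect ?n ` {i \<in> {1..?n}. f (reflect ?n i) < k} = {i \<in> {1..?n}. f i < k}"
      using bij_betw_imp_surj_on[OF reflect_bij] by simp
    then have "card {i \<in> {1..?n}. f i < k} = card {i \<in> {1..?n}. f (reflect ?n i) < k}"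
      using card_image[OF inj_on_subset[OF reflect_inj subset_UNIV], of ?n "{i \<in> {1..?n}. f (reflect ?n i) < k}"]
      by simp
    ultimately show "card {i \<in> {1..?n}. f i < k} \<le> x" by simp
  qed
  have n: "c + b + a = ?n" by simp
  show ?thesis using Z_set_iff[OF mr o, of "rotate_perm ?n e", unfolded n] Z_set_iff[OF m o, of e] R B e
    by blast
qed

section \<open>Inequalities satisfied by the elements of Z\<close>

text \<open>The number of positions in the block \<open>{p + 1..p + m}\<close> with value less than \<open>v\<close>.\<close>

definition cnt :: "(nat \<Rightarrow> nat) \<Rightarrow> nat \<Rightarrow> nat \<Rightarrow> nat \<Rightarrow> nat" where
  "cnt e p m v = card {i \<in> {p + 1..p + m}. e i < v}"

lemma cnt_le: "cnt e p m v \<le> m"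
proof -
  have "cnt e p m v \<le> card {p + 1..p + m}" unfolding cnt_def by (intro card_mono) auto
  then show ?thesis by simp
qed

lemma cnt_mono: "v \<le> v' \<Longrightarrow> cnt e p m v \<le> cnt e p m v'"
  unfolding cnt_def by (intro card_mono) auto

lemma cnt_0 [simp]: "cnt e p m 0 = 0"
  by (simp add: cnt_def)

lemma cnt_ge: "card {i \<in> {p + 1..p + m}. v \<le> e i} = m - cnt e p m v"
proof -
  have "{i \<in> {p + 1..p + m}. v \<le> e i} = {p + 1..p + m} - {i \<in> {p + 1..p + m}. e i < v}" by auto
  moreover have "card ({p + 1..p + m} - {i \<in> {p + 1..p + m}. e i < v}) = card {p + 1..p + m} - cnt e p m v"
    unfolding cnt_def by (rule card_Diff_subset) auto
  ultimately have "card {i \<in> {p + 1..p + m}. v \<le> e i} = card {p + 1..p + m} - cnt e p m v" by (simp only:)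
  then show ?thesis by simp
qed

lemma cnt_between:
  assumes "v \<le> v'"
  shows "card {i \<in> {p + 1..p + m}. v \<le> e i \<and> e i < v'} = cnt e p m v' - cnt e p m v"
proof -
  have "{i \<in> {p + 1..p + m}. v \<le> e i \<and> e i < v'}
    = {i \<in> {p + 1..p + m}. e i < v'} - {i \<in> {p + 1..p + m}. e i < v}" by auto
  moreover have "card ({i \<in> {p + 1..p + m}. e i < v'} - {i \<in> {p + 1..p + m}. e i < v})
    = cnt e p m v' - cnt e p m v"
    unfolding cnt_def using assms by (intro card_Diff_subset) auto
  ultimately show ?thesis by (simp only:)
qed

lemma card_three_blocks:
  fixes a b c :: nat
  shows "card {i \<in> {1..a + b + c}. P i} =
    card {i \<in> {0 + 1..0 + a}. P i} + card {i \<in> {a + 1..a + b}. P i} + card {i \<in> {a + b + 1..a + b + c}. P i}"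
proof -
  let ?A = "{i \<in> {0 + 1..0 + a}. P i}" and ?B = "{i \<in> {a + 1..a + b}. P i}"
    and ?C = "{i \<in> {a + b + 1..a + b + c}. P i}"
  have "{i \<in> {1..a + b + c}. P i} = (?A \<union> ?B) \<union> ?C" by auto
  moreover have "?A \<inter> ?B = {}" "(?A \<union> ?B) \<inter> ?C = {}" by auto
  moreover have "finite ?A" "finite ?B" "finite ?C" by simp_all
  ultimately show ?thesis by (simp only: card_Un_disjoint finite_Un simp_thms)
qed

text \<open>The first bound, applied to the decreasing subsequence that consists of the values at least \<open>p\<close> in the
  first block, the values from \<open>q\<close> to \<open>p - 1\<close> in the second and the values less than \<open>q\<close> in the third.\<close>

lemma Z_set_ineq1:
  assumes m: "mset [a, b, c] = {#s, t, u#}" and o: "u \<le> t" "t \<le> s" "1 \<le> u"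
    and e: "e \<in> Z_set [a, b, c]" and qp: "q \<le> p"
  shows "(a - cnt e 0 a p) + (cnt e a b p - cnt e a b q) + cnt e (a + b) c q \<le> s"
proof -
  define g :: "nat \<Rightarrow> nat" where
    "g i = (if (if i \<le> a then p \<le> e i else if i \<le> a + b then q \<le> e i \<and> e i < p else e i < q)
      then 0 else 1)" for i
  have "card {i \<in> {1..a + b + c}. g i < 1} \<le> s"
  proof (rule Z_set_colouring[OF m o e])
    fix i j assume "1 \<le> i" "i < j" "j \<le> a + b + c" "block [a, b, c] i < block [a, b, c] j" "g i = g j" "g i < 1"
    then show "e j < e i" using qp by (auto simp: block_three g_def split: if_splits)
  qed simp
  moreover have "{i \<in> {0 + 1..0 + a}. g i < 1} = {i \<in> {0 + 1..0 + a}. p \<le> e i}"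
    "{i \<in> {a + 1..a + b}. g i < 1} = {i \<in> {a + 1..a + b}. q \<le> e i \<and> e i < p}"
    "{i \<in> {a + b + 1..a + b + c}. g i < 1} = {i \<in> {a + b + 1..a + b + c}. e i < q}"
    by (auto simp: g_def)
  ultimately show ?thesis
    unfolding card_three_blocks by (simp only: cnt_ge cnt_between[OF qp] cnt_def[of e "a + b" c q, symmetric])
qed

text \<open>The second bound, applied to two decreasing subsequences: the values at least \<open>q\<close> in the first block
  with those less than \<open>q\<close> in the second, and the values at least \<open>p\<close> in the second block with those less
  than \<open>p\<close> in the third.\<close>

lemma Z_set_ineq2:
  assumes m: "mset [a, b, c] = {#s, t, u#}" and o: "u \<le> t" "t \<le> s" "1 \<le> u"
    and e: "e \<in> Z_set [a, b, c]" and qp: "q \<le> p"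
  shows "cnt e (a + b) c p + u \<le> c + cnt e 0 a q + (cnt e a b p - cnt e a b q)"
proof -
  define g :: "nat \<Rightarrow> nat" where
    "g i = (if i \<le> a then (if q \<le> e i then 0 else 2)
      else if i \<le> a + b then (if e i < q then 0 else if p \<le> e i then 1 else 2)
      else (if e i < p then 1 else 2))" for i
  have le: "card {i \<in> {1..a + b + c}. g i < 2} \<le> s + t"
  proof (rule Z_set_colouring[OF m o e])
    fix i j assume "1 \<le> i" "i < j" "j \<le> a + b + c" "block [a, b, c] i < block [a, b, c] j" "g i = g j" "g i < 2"
    then show "e j < e i" using qp by (auto simp: block_three g_def split: if_splits)
  qed simp
  have "{i \<in> {0 + 1..0 + a}. g i < 2} = {i \<in> {0 + 1..0 + a}. q \<le> e i}"
    "{i \<in> {a + b + 1..a + b + c}. g i < 2} = {i \<in> {a + b + 1..a + b + c}. e i < p}"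
    by (auto simp: g_def)
  moreover have Y: "{i \<in> {a + 1..a + b}. g i < 2} = {i \<in> {a + 1..a + b}. e i < q} \<union> {i \<in> {a + 1..a + b}. p \<le> e i}"
    using qp by (auto simp: g_def)
  moreover have "card {i \<in> {a + 1..a + b}. g i < 2} = card {i \<in> {a + 1..a + b}. e i < q} + card {i \<in> {a + 1..a + b}. p \<le> e i}"
  proof -
    have "{i \<in> {a + 1..a + b}. e i < q} \<inter> {i \<in> {a + 1..a + b}. p \<le> e i} = {}" using qp by auto
    then show ?thesis unfolding Y by (intro card_Un_disjoint) simp_all
  qed
  ultimately have "(a - cnt e 0 a q) + (cnt e a b q + (b - cnt e a b p)) + cnt e (a + b) c p \<le> s + t"
    using le unfolding card_three_blocks by (simp only: cnt_ge cnt_def[symmetric])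
  moreover have "a + b + c = s + t + u" using mset_three[OF m] by auto
  moreover have "cnt e 0 a q \<le> a" "cnt e a b p \<le> b" "cnt e a b q \<le> cnt e a b p"
    using cnt_le cnt_mono[OF qp] by blast+
  ultimately show ?thesis by linarith
qed

text \<open>The word \<open>e\<close> increases on the block \<open>{p + 1..p + m}\<close>.\<close>

definition increasing_run :: "(nat \<Rightarrow> nat) \<Rightarrow> nat \<Rightarrow> nat \<Rightarrow> bool" where
  "increasing_run e p m \<longleftrightarrow> (\<forall>i j. p < i \<longrightarrow> i < j \<longrightarrow> j \<le> p + m \<longrightarrow> e i < e j)"

lemma increasing_runD: "increasing_run e p m \<Longrightarrow> p < i \<Longrightarrow> i < j \<Longrightarrow> j \<le> p + m \<Longrightarrow> e i < e j"
  by (simp add: increasing_run_def)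

lemma less_iff_cnt:
  assumes run: "increasing_run e p m" and l: "1 \<le> l" "l \<le> m"
  shows "e (p + l) < v \<longleftrightarrow> l \<le> cnt e p m v"
proof
  assume v: "e (p + l) < v"
  have "e i < v" if i: "i \<in> {p + 1..p + l}" for i
  proof (cases "i = p + l")
    case False
    then have "e i < e (p + l)" using increasing_runD[OF run, of i "p + l"] i l by simp
    then show ?thesis using v by simp
  qed (use v in simp)
  then have "{p + 1..p + l} \<subseteq> {i \<in> {p + 1..p + m}. e i < v}" using l by auto
  then have "card {p + 1..p + l} \<le> cnt e p m v" unfolding cnt_def by (intro card_mono) auto
  then show "l \<le> cnt e p m v" by simp
next
  assume "l \<le> cnt e p m v"
  show "e (p + l) < v"
  proof (rule ccontr)
    assume v: "\<not> e (p + l) < v"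
    have "{i \<in> {p + 1..p + m}. e i < v} \<subseteq> {p + 1..p + (l - 1)}"
    proof
      fix i assume i: "i \<in> {i \<in> {p + 1..p + m}. e i < v}"
      have "\<not> p + l < i" using increasing_runD[OF run, of "p + l" i] i v l by auto
      moreover have "i \<noteq> p + l" using i v by auto
      ultimately show "i \<in> {p + 1..p + (l - 1)}" using i by auto
    qed
    then have "cnt e p m v \<le> card {p + 1..p + (l - 1)}" unfolding cnt_def by (intro card_mono) auto
    then show False using \<open>l \<le> cnt e p m v\<close> l by simp
  qed
qed

lemma cnt_self:
  assumes run: "increasing_run e p m" and l: "1 \<le> l" "l \<le> m"
  shows "cnt e p m (e (p + l)) = l - 1" "cnt e p m (Suc (e (p + l))) = l"
proof -
  have "\<not> l \<le> cnt e p m (e (p + l))" using less_iff_cnt[OF run l] by blast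
  moreover have "l - 1 \<le> cnt e p m (e (p + l))"
  proof (cases "l = 1")
    case False
    then have "e (p + (l - 1)) < e (p + l)" using l by (intro increasing_runD[OF run]) auto
    then show ?thesis using less_iff_cnt[OF run, of "l - 1" "e (p + l)"] l False by simp
  qed simp
  ultimately show "cnt e p m (e (p + l)) = l - 1" by simp
  have "l \<le> cnt e p m (Suc (e (p + l)))" using less_iff_cnt[OF run l] by blast
  moreover have "\<not> Suc l \<le> cnt e p m (Suc (e (p + l)))"
  proof
    assume h: "Suc l \<le> cnt e p m (Suc (e (p + l)))"
    then have lm: "Suc l \<le> m" using cnt_le le_trans by blast
    then have "e (p + Suc l) < Suc (e (p + l))" using less_iff_cnt[OF run, of "Suc l"] h by simp
    moreover have "e (p + l) < e (p + Suc l)" using l lm by (intro increasing_runD[OF run]) auto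
    ultimately show False by simp
  qed
  ultimately show "cnt e p m (Suc (e (p + l))) = l" by simp
qed

lemma cnt_Suc_other:
  assumes "inj e" "i \<notin> {p + 1..p + m}"
  shows "cnt e p m (Suc (e i)) = cnt e p m (e i)"
proof -
  have "e j < Suc (e i) \<longleftrightarrow> e j < e i" if "j \<in> {p + 1..p + m}" for j
    using that assms injD[OF assms(1), of j i] by (auto simp: less_Suc_eq)
  then have "{j \<in> {p + 1..p + m}. e j < Suc (e i)} = {j \<in> {p + 1..p + m}. e j < e i}" by blast
  then show ?thesis by (simp only: cnt_def)
qed

text \<open>A strictly increasing sequence between given bounds exists as soon as every lower bound, propagated
  with slope 1, stays below the later upper bounds; the smallest one is chosen.\<close>

lemma greedy_sequence:
  fixes L U :: "nat \<Rightarrow> nat"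
  assumes LU: "\<And>k i. 1 \<le> k \<Longrightarrow> k \<le> i \<Longrightarrow> i \<le> u \<Longrightarrow> L k + (i - k) < U i"
  obtains f where "strict_mono_on {1..u} f" "\<And>i. i \<in> {1..u} \<Longrightarrow> L i < f i" "\<And>i. i \<in> {1..u} \<Longrightarrow> f i \<le> U i"
proof -
  define f where "f i = Max ((\<lambda>k. L k + 1 + (i - k)) ` {1..i})" for i
  have ge: "L k + 1 + (i - k) \<le> f i" if "1 \<le> k" "k \<le> i" for k i
    unfolding f_def using that by (intro Max_ge) auto
  have ex: "\<exists>k\<ge>1. k \<le> i \<and> f i = L k + 1 + (i - k)" if "1 \<le> i" for i
  proof -
    have "f i \<in> (\<lambda>k. L k + 1 + (i - k)) ` {1..i}" unfolding f_def using that by (intro Max_in) auto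
    then show ?thesis by auto
  qed
  have "f i < f j" if "1 \<le> i" "i < j" for i j
  proof -
    obtain k where "1 \<le> k" "k \<le> i" "f i = L k + 1 + (i - k)" using ex[OF \<open>1 \<le> i\<close>] by blast
    then show ?thesis using ge[of k j] that by simp
  qed
  then have "strict_mono_on {1..u} f" by (intro strict_mono_onI) simp
  moreover have "L i < f i" if "i \<in> {1..u}" for i using ge[of i i] that by simp
  moreover have "f i \<le> U i" if "i \<in> {1..u}" for i
  proof -
    obtain k where "1 \<le> k" "k \<le> i" "f i = L k + 1 + (i - k)" using ex[of i] \<open>i \<in> {1..u}\<close> by auto
    then show ?thesis using LU[of k i] that by simp
  qed
  ultimately show ?thesis using that by blast
qed

section \<open>Diagrams with three rows\<close>

text \<open>The diagram whose rows are the images of \<open>f\<close>, \<open>g\<close> and \<open>h\<close>, so that strictly increasing functions list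
  the columns of the nodes of each row from left to right.\<close>

definition three_rows :: "nat \<Rightarrow> nat \<Rightarrow> nat \<Rightarrow> (nat \<Rightarrow> nat) \<Rightarrow> (nat \<Rightarrow> nat) \<Rightarrow> (nat \<Rightarrow> nat) \<Rightarrow> diagram" where
  "three_rows a b c f g h = {1} \<times> f ` {1..a} \<union> {2} \<times> g ` {1..b} \<union> {3} \<times> h ` {1..c}"

text \<open>The \<open>l\<close>-th node of row \<open>k\<close> carries the \<open>l\<close>-th number of block \<open>k\<close>.\<close>

lemma row_filling_run:
  assumes D: "D \<in> diagrams_of lam" and row: "\<And>j. (k, j) \<in> D \<longleftrightarrow> j \<in> f ` {1..m}"
    and f: "strict_mono_on {1..m} f" and l: "1 \<le> l" "l \<le> m"
  shows "row_filling D (k, f l) = sum_list (take (k - 1) lam) + l"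
proof -
  have "{j. (k, j) \<in> D \<and> j \<le> f l} = f ` {1..l}"
    unfolding row using strict_mono_on_leD[OF f] strict_mono_on_less[OF f] l
    by (auto simp: image_iff) (metis atLeastAtMost_iff le_trans linorder_not_le)+
  moreover have "inj_on f {1..l}"
    using strict_mono_on_imp_inj_on[OF f] by (rule inj_on_subset) (use l in auto)
  ultimately have "card {j. (k, j) \<in> D \<and> j \<le> f l} = l" by (simp add: card_image)
  moreover have "(k, f l) \<in> D" using row l by auto
  ultimately show ?thesis using row_filling_eq[OF D] by simp
qed

context
  fixes a b c :: nat and f g h :: "nat \<Rightarrow> nat" and D :: diagram
  assumes D: "D \<in> diagrams_of [a, b, c]" and Deq: "D = three_rows a b c f g h"
    and f: "strict_mono_on {1..a} f" and g: "strict_mono_on {1..b} g" and h: "strict_mono_on {1..c} h"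
begin

lemma three_rows_filling:
  "1 \<le> l \<Longrightarrow> l \<le> a \<Longrightarrow> (1, f l) \<in> D \<and> row_filling D (1, f l) = l"
  "1 \<le> l \<Longrightarrow> l \<le> b \<Longrightarrow> (2, g l) \<in> D \<and> row_filling D (2, g l) = a + l"
  "1 \<le> l \<Longrightarrow> l \<le> c \<Longrightarrow> (3, h l) \<in> D \<and> row_filling D (3, h l) = a + b + l"
proof -
  have r: "(1, j) \<in> D \<longleftrightarrow> j \<in> f ` {1..a}" "(2, j) \<in> D \<longleftrightarrow> j \<in> g ` {1..b}" "(3, j) \<in> D \<longleftrightarrow> j \<in> h ` {1..c}" for j
    by (simp_all add: Deq three_rows_def)
  have tk: "sum_list (take (1 - 1) [a, b, c]) = 0" "sum_list (take (2 - 1) [a, b, c]) = a"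
    "sum_list (take (3 - 1) [a, b, c]) = a + b"
    by (simp_all add: take_Cons')
  show "1 \<le> l \<Longrightarrow> l \<le> a \<Longrightarrow> (1, f l) \<in> D \<and> row_filling D (1, f l) = l"
    using row_filling_run[OF D r(1) f] r(1) unfolding tk by simp
  show "1 \<le> l \<Longrightarrow> l \<le> b \<Longrightarrow> (2, g l) \<in> D \<and> row_filling D (2, g l) = a + l"
    using row_filling_run[OF D r(2) g] r(2) unfolding tk by simp
  show "1 \<le> l \<Longrightarrow> l \<le> c \<Longrightarrow> (3, h l) \<in> D \<and> row_filling D (3, h l) = a + b + l"
    using row_filling_run[OF D r(3) h] r(3) unfolding tk by simp
qed

lemma three_rows_inversions:
  "1 \<le> l \<Longrightarrow> l \<le> a \<Longrightarrow> 1 \<le> m \<Longrightarrow> m \<le> b \<Longrightarrow> (l, a + m) \<in> inversions (a + b + c) (diagram_perm D) \<longleftrightarrow> g m < f l"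
  "1 \<le> l \<Longrightarrow> l \<le> a \<Longrightarrow> 1 \<le> m \<Longrightarrow> m \<le> c \<Longrightarrow> (l, a + b + m) \<in> inversions (a + b + c) (diagram_perm D) \<longleftrightarrow> h m < f l"
  "1 \<le> l \<Longrightarrow> l \<le> b \<Longrightarrow> 1 \<le> m \<Longrightarrow> m \<le> c \<Longrightarrow> (a + l, a + b + m) \<in> inversions (a + b + c) (diagram_perm D) \<longleftrightarrow> h m < g l"
proof -
  have n: "sum_list [a, b, c] = a + b + c" by simp
  note inv = inversions_diagram_perm[OF D, unfolded n]
  show "1 \<le> l \<Longrightarrow> l \<le> a \<Longrightarrow> 1 \<le> m \<Longrightarrow> m \<le> b \<Longrightarrow> (l, a + m) \<in> inversions (a + b + c) (diagram_perm D) \<longleftrightarrow> g m < f l"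
    using three_rows_filling(1)[of l] three_rows_filling(2)[of m] inv[of 1 "f l" 2 "g m"] by simp
  show "1 \<le> l \<Longrightarrow> l \<le> a \<Longrightarrow> 1 \<le> m \<Longrightarrow> m \<le> c \<Longrightarrow> (l, a + b + m) \<in> inversions (a + b + c) (diagram_perm D) \<longleftrightarrow> h m < f l"
    using three_rows_filling(1)[of l] three_rows_filling(3)[of m] inv[of 1 "f l" 3 "h m"] by simp
  show "1 \<le> l \<Longrightarrow> l \<le> b \<Longrightarrow> 1 \<le> m \<Longrightarrow> m \<le> c \<Longrightarrow> (a + l, a + b + m) \<in> inversions (a + b + c) (diagram_perm D) \<longleftrightarrow> h m < g l"
    using three_rows_filling(2)[of l] three_rows_filling(3)[of m] inv[of 2 "g l" 3 "h m"] by simp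
qed

lemma three_rows_dominates:
  assumes e: "e \<in> min_reps [a, b, c]"
    and fg: "\<And>l m. 1 \<le> l \<Longrightarrow> l \<le> a \<Longrightarrow> 1 \<le> m \<Longrightarrow> m \<le> b \<Longrightarrow> e (a + m) < e l \<Longrightarrow> g m < f l"
    and fh: "\<And>l m. 1 \<le> l \<Longrightarrow> l \<le> a \<Longrightarrow> 1 \<le> m \<Longrightarrow> m \<le> c \<Longrightarrow> e (a + b + m) < e l \<Longrightarrow> h m < f l"
    and gh: "\<And>l m. 1 \<le> l \<Longrightarrow> l \<le> b \<Longrightarrow> 1 \<le> m \<Longrightarrow> m \<le> c \<Longrightarrow> e (a + b + m) < e (a + l) \<Longrightarrow> h m < g l"
  shows "inversions (a + b + c) e \<subseteq> inversions (a + b + c) (diagram_perm D)"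
proof clarify
  fix i j assume "(i, j) \<in> inversions (a + b + c) e"
  then have ij: "1 \<le> i" "i < j" "j \<le> a + b + c" "e j < e i" by (auto simp: inversions_def)
  have ne: "block [a, b, c] i \<noteq> block [a, b, c] j"
    using min_reps_run[OF e ij(1,2)] ij(3,4) by fastforce
  then consider "i \<le> a" "a < j" "j \<le> a + b" | "i \<le> a" "a + b < j" | "a < i" "i \<le> a + b" "a + b < j"
    using ij(2) by (fastforce simp: block_three split: if_splits)
  then show "(i, j) \<in> inversions (a + b + c) (diagram_perm D)"
  proof cases
    case 1
    then show ?thesis using three_rows_inversions(1)[of i "j - a"] fg[of i "j - a"] ij by simp
  next
    case 2
    then show ?thesis using three_rows_inversions(2)[of i "j - (a + b)"] fh[of i "j - (a + b)"] ij by simp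
  next
    case 3
    then show ?thesis
      using three_rows_inversions(3)[of "i - a" "j - (a + b)"] gh[of "i - a" "j - (a + b)"] ij by simp
  qed
qed

end

lemma three_rows_in_diagrams_of:
  assumes "nested_diagram s t u (three_rows a b c f g h)" "1 \<le> u"
    and f: "strict_mono_on {1..a} f" and g: "strict_mono_on {1..b} g" and h: "strict_mono_on {1..c} h"
  shows "three_rows a b c f g h \<in> diagrams_of [a, b, c]"
proof (rule diagrams_of_three)
  let ?D = "three_rows a b c f g h"
  show "is_diagram ?D" "nrows ?D = 3" using nested_diagram_facts(1,2)[OF assms(1,2)] .
  have "{j. (1, j) \<in> ?D} = f ` {1..a}" "{j. (2, j) \<in> ?D} = g ` {1..b}" "{j. (3, j) \<in> ?D} = h ` {1..c}"
    by (auto simp: three_rows_def)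
  then show "card {j. (1, j) \<in> ?D} = a" "card {j. (2, j) \<in> ?D} = b" "card {j. (3, j) \<in> ?D} = c"
    using strict_mono_on_imp_inj_on[OF f] strict_mono_on_imp_inj_on[OF g] strict_mono_on_imp_inj_on[OF h]
    by (simp_all add: card_image)
qed

section \<open>Maximal elements\<close>

lemma inversions_eqD:
  assumes "x permutes {1..n}" "y permutes {1..n}" "inversions n x = inversions n y"
  shows "x = y"
proof (rule ccontr)
  assume "x \<noteq> y"
  then obtain i where "card (inversions n (simple_refl i \<circ> x)) = Suc (card (inversions n x))"
    "inversions n (simple_refl i \<circ> x) \<subseteq> inversions n y"
    using inversions_ascent[OF assms(1,2)] assms(3) by blast
  then show False using card_mono[of "inversions n y" "inversions n (simple_refl i \<circ> x)"] assms(3) by simp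
qed

text \<open>A set of diagrams whose permutations are pairwise incomparable and dominate all of \<open>Z\<close>. Being nested,
  the diagrams yield elements of \<open>Z\<close>, so the permutations are exactly the maximal elements.\<close>

definition rim_family :: "nat \<Rightarrow> nat \<Rightarrow> nat \<Rightarrow> nat list \<Rightarrow> diagram set \<Rightarrow> bool" where
  "rim_family s t u lam \<D> \<longleftrightarrow>
     (\<forall>D\<in>\<D>. D \<in> diagrams_of lam \<and> nested_diagram s t u D) \<and>
     (\<forall>e\<in>Z_set lam. \<exists>D\<in>\<D>. inversions (sum_list lam) e \<subseteq> inversions (sum_list lam) (diagram_perm D)) \<and>
     (\<forall>D\<in>\<D>. \<forall>D'\<in>\<D>. inversions (sum_list lam) (diagram_perm D) \<subseteq> inversions (sum_list lam) (diagram_perm D') \<longrightarrow> D = D')"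

lemma rim_familyI:
  assumes "\<And>D. D \<in> \<D> \<Longrightarrow> D \<in> diagrams_of lam \<and> nested_diagram s t u D"
    and "\<And>e. e \<in> Z_set lam \<Longrightarrow>
      \<exists>D\<in>\<D>. inversions (sum_list lam) e \<subseteq> inversions (sum_list lam) (diagram_perm D)"
    and "\<And>D D'. D \<in> \<D> \<Longrightarrow> D' \<in> \<D> \<Longrightarrow>
      inversions (sum_list lam) (diagram_perm D) \<subseteq> inversions (sum_list lam) (diagram_perm D') \<Longrightarrow> D = D'"
  shows "rim_family s t u lam \<D>"
  unfolding rim_family_def
proof (intro conjI ballI impI)
  fix D assume "D \<in> \<D>"
  then show "D \<in> diagrams_of lam" "nested_diagram s t u D" using assms(1) by blast+
qed (fact assms(2) assms(3))+

lemma Z_set_permutes: "e \<in> Z_set lam \<Longrightarrow> e permutes {1..sum_list lam}"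
  unfolding Z_set_def by (auto dest: min_reps_permutes)

lemma min_diagram_nested:
  assumes "D \<in> diagrams_of [a, b, c]" "nested_diagram s t u D" "1 \<le> u"
  shows "min_diagram (diagram_perm D) [a, b, c] = D"
    and "min_diagram (diagram_perm (rotate_diagram D)) [c, b, a] = rotate_diagram D"
proof -
  note N = nested_diagram_facts[OF assms(2,3)] and R = rotate_diagram_facts[OF nested_diagram_facts(1)[OF assms(2,3)]]
  obtain p where p: "p \<in> {1..3}" "\<And>j. j \<in> {1..s} \<Longrightarrow> (p, j) \<in> D" using N(4) by blast
  show "min_diagram (diagram_perm D) [a, b, c] = D"
    using p N(3) by (intro min_diagram_full_row[OF assms(1), of p]) auto
  have rD: "rotate_diagram D \<in> diagrams_of [c, b, a]" using rotate_in_diagrams_of[OF assms(1)] by simp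
  have "(reflect 3 p, j) \<in> rotate_diagram D" if "j \<in> {1..s}" for j
  proof -
    have "(p, reflect s j) \<in> D" using p(2) reflect_in[OF that] by blast
    then have "map_prod (reflect (nrows D)) (reflect (ncols D)) (p, reflect s j) \<in> rotate_diagram D"
      unfolding rotate_diagram_eq[OF N(1)] by (rule imageI)
    then show ?thesis by (simp add: N(2,3))
  qed
  then show "min_diagram (diagram_perm (rotate_diagram D)) [c, b, a] = rotate_diagram D"
    using reflect_in[OF p(1)] R(4) N(3) by (intro min_diagram_full_row[OF rD, of "reflect 3 p"]) auto
qed

lemma Y_set_rim_family:
  assumes m: "mset [a, b, c] = {#s, t, u#}" and o: "u \<le> t" "t \<le> s" "1 \<le> u"
    and F: "rim_family s t u [a, b, c] \<D>"
  shows "Y_set [a, b, c] = diagram_perm ` \<D>"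
proof
  let ?n = "sum_list [a, b, c]"
  have D: "D \<in> diagrams_of [a, b, c]" "nested_diagram s t u D" if "D \<in> \<D>" for D
    using F that unfolding rim_family_def by blast+
  have DZ: "diagram_perm D \<in> Z_set [a, b, c]" if "D \<in> \<D>" for D
    using diagram_perm_Z_set[OF m o D[OF that]] .
  have dom: "\<exists>D\<in>\<D>. inversions ?n e \<subseteq> inversions ?n (diagram_perm D)" if "e \<in> Z_set [a, b, c]" for e
    using F that unfolding rim_family_def by blast
  note pre = cox_prefix_iff[OF Z_set_permutes Z_set_permutes]
  show "Y_set [a, b, c] \<subseteq> diagram_perm ` \<D>"
  proof
    fix x assume "x \<in> Y_set [a, b, c]"
    then have x: "x \<in> Z_set [a, b, c]" "\<And>y. y \<in> Z_set [a, b, c] \<Longrightarrow> cox_prefix ?n x y \<Longrightarrow> y = x"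
      unfolding Y_set_def by blast+
    obtain E where E: "E \<in> \<D>" "inversions ?n x \<subseteq> inversions ?n (diagram_perm E)" using dom[OF x(1)] by blast
    then have "cox_prefix ?n x (diagram_perm E)" using pre[OF x(1) DZ[OF E(1)]] by blast
    then show "x \<in> diagram_perm ` \<D>" using x(2)[OF DZ[OF E(1)]] E(1) by blast
  qed
  show "diagram_perm ` \<D> \<subseteq> Y_set [a, b, c]"
  proof clarify
    fix E assume E: "E \<in> \<D>"
    have "y = diagram_perm E" if y: "y \<in> Z_set [a, b, c]" "cox_prefix ?n (diagram_perm E) y" for y
    proof -
      have 1: "inversions ?n (diagram_perm E) \<subseteq> inversions ?n y" using pre[OF DZ[OF E] y(1)] y(2) by blast
      obtain E' where E': "E' \<in> \<D>" "inversions ?n y \<subseteq> inversions ?n (diagram_perm E')" using dom[OF y(1)] by blast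
      have "inversions ?n (diagram_perm E) \<subseteq> inversions ?n (diagram_perm E')" using 1 E'(2) by (rule order_trans)
      then have "E = E'" using F E E'(1) unfolding rim_family_def by simp
      then have "inversions ?n y = inversions ?n (diagram_perm E)" using 1 E' by blast
      then show ?thesis using inversions_eqD[OF Z_set_permutes[OF y(1)] Z_set_permutes[OF DZ[OF E]]] by blast
    qed
    then show "diagram_perm E \<in> Y_set [a, b, c]" using DZ[OF E] unfolding Y_set_def by blast
  qed
qed

lemma Y_set_rotate:
  assumes m: "mset [a, b, c] = {#s, t, u#}" and o: "u \<le> t" "t \<le> s" "1 \<le> u"
  shows "rotate_perm (a + b + c) ` Y_set [a, b, c] \<subseteq> Y_set [c, b, a]"
proof clarify
  let ?n = "a + b + c"
  have n: "sum_list [a, b, c] = ?n" "sum_list [c, b, a] = ?n" "c + b + a = ?n" by simp_all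
  have m': "mset [c, b, a] = {#s, t, u#}" using m by (simp add: add_mset_commute)
  fix x assume "x \<in> Y_set [a, b, c]"
  then have x: "x \<in> Z_set [a, b, c]" "\<And>y. y \<in> Z_set [a, b, c] \<Longrightarrow> cox_prefix ?n x y \<Longrightarrow> y = x"
    unfolding Y_set_def n by blast+
  have "y = rotate_perm ?n x" if y: "y \<in> Z_set [c, b, a]" "cox_prefix ?n (rotate_perm ?n x) y" for y
  proof -
    have ry: "rotate_perm ?n y \<in> Z_set [a, b, c]" using Z_set_rotate[OF m' o y(1)] unfolding n .
    have "cox_prefix ?n (rotate_perm ?n x) (rotate_perm ?n (rotate_perm ?n y))" using y(2) by simp
    then have "cox_prefix ?n x (rotate_perm ?n y)"
      using cox_prefix_rotate Z_set_permutes[OF x(1)] Z_set_permutes[OF ry] unfolding n by blast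
    then have "rotate_perm ?n y = x" using x(2)[OF ry] by blast
    then show ?thesis by (metis rotate_perm_rotate_perm)
  qed
  then show "rotate_perm ?n x \<in> Y_set [c, b, a]"
    unfolding Y_set_def n using Z_set_rotate[OF m o x(1)] by blast
qed

lemma E_set_rim_family:
  assumes m: "mset [a, b, c] = {#s, t, u#}" and o: "u \<le> t" "t \<le> s" "1 \<le> u"
    and F: "rim_family s t u [a, b, c] \<D>"
  shows "E_set [a, b, c] = \<D>" "E_set [c, b, a] = rotate_diagram ` \<D>" "inj_on rotate_diagram \<D>"
    "\<And>D. D \<in> \<D> \<Longrightarrow> special_diagram D" "\<And>D. D \<in> \<D> \<Longrightarrow> special_diagram (rotate_diagram D)"
proof -
  let ?n = "a + b + c"
  have m': "mset [c, b, a] = {#s, t, u#}" using m by (simp add: add_mset_commute)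
  have D: "D \<in> diagrams_of [a, b, c]" "nested_diagram s t u D" if "D \<in> \<D>" for D
    using F that unfolding rim_family_def by blast+
  note Y = Y_set_rim_family[OF m o F]
  show "E_set [a, b, c] = \<D>"
    unfolding E_set_def Y image_image using min_diagram_nested(1)[OF D o(3)] by simp
  have "rotate_perm ?n ` Y_set [a, b, c] = Y_set [c, b, a]"
  proof
    show "rotate_perm ?n ` Y_set [a, b, c] \<subseteq> Y_set [c, b, a]" by (rule Y_set_rotate[OF m o])
    show "Y_set [c, b, a] \<subseteq> rotate_perm ?n ` Y_set [a, b, c]"
    proof
      fix y assume "y \<in> Y_set [c, b, a]"
      moreover have n: "c + b + a = ?n" by simp
      ultimately have "rotate_perm ?n y \<in> Y_set [a, b, c]" using Y_set_rotate[OF m' o] unfolding n by blast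
      then show "y \<in> rotate_perm ?n ` Y_set [a, b, c]" by (metis imageI rotate_perm_rotate_perm)
    qed
  qed
  then have "Y_set [c, b, a] = (\<lambda>D. rotate_perm ?n (diagram_perm D)) ` \<D>"
    unfolding Y image_image by simp
  also have "\<dots> = (\<lambda>D. diagram_perm (rotate_diagram D)) ` \<D>"
    using diagram_perm_rotate[OF D(1)] by (intro image_cong) (simp_all add: add.assoc)
  finally show "E_set [c, b, a] = rotate_diagram ` \<D>"
    unfolding E_set_def image_image by (simp add: image_image min_diagram_nested(2)[OF D o(3)])
  show "inj_on rotate_diagram \<D>"
    using rotate_diagram_facts(6)[OF nested_diagram_facts(1)[OF D(2) o(3)]] by (metis inj_on_inverseI)
  show sp: "special_diagram D" if "D \<in> \<D>" for D using nested_diagram_special[OF D(2)[OF that] o(3)] .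
  show "special_diagram (rotate_diagram D)" if "D \<in> \<D>" for D using special_rotate[OF sp[OF that]] .
qed

section \<open>The three families of diagrams\<close>

lemma min_reps_three_inc:
  assumes "e \<in> min_reps [a, b, c]"
  shows "increasing_run e 0 a" "increasing_run e a b" "increasing_run e (a + b) c"
proof -
  have "e i < e j" if "1 \<le> i" "i < j" "j \<le> a + b + c" "block [a, b, c] i = block [a, b, c] j" for i j
    using min_reps_run[OF assms that(1,2) _ that(4)] that(3) by simp
  then show "increasing_run e 0 a" "increasing_run e a b" "increasing_run e (a + b) c"
    unfolding increasing_run_def by (auto simp: block_three)
qed

text \<open>For the partition itself, the Young diagram has all inversions that the inequalities permit.\<close>

lemma rim_family_young:
  assumes o: "u \<le> t" "t \<le> s" "1 \<le> u"
  shows "rim_family s t u [s, t, u] {young_diagram [s, t, u]}"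
proof -
  let ?D = "young_diagram [s, t, u]"
  have m: "mset [s, t, u] = {#s, t, u#}" by simp
  have D: "?D \<in> diagrams_of [s, t, u]" by (rule young_diagram_in[OF m o])
  have N: "nested_diagram s t u ?D" by (rule nested_young_diagram[OF m o(1,2)])
  have eq: "?D = three_rows s t u (\<lambda>i. i) (\<lambda>i. i) (\<lambda>i. i)"
    by (simp add: young_diagram_three three_rows_def)
  have sm: "strict_mono_on A (\<lambda>i. i :: nat)" for A by (simp add: strict_mono_on_def)
  have n: "sum_list [s, t, u] = s + t + u" by simp
  have "inversions (s + t + u) e \<subseteq> inversions (s + t + u) (diagram_perm ?D)" if e: "e \<in> Z_set [s, t, u]" for e
  proof (rule three_rows_dominates[OF D eq sm sm sm])
    show em: "e \<in> min_reps [s, t, u]" using e by (simp add: Z_set_def)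
    note inc = min_reps_three_inc[OF em]
    note d1 = Z_set_ineq1[OF m o e] and d2 = Z_set_ineq2[OF m o e]
    fix l k :: nat assume l: "1 \<le> l" and k: "1 \<le> k"
    show "k < l" if "l \<le> s" "k \<le> t" "e (s + k) < e l"
    proof -
      have "k \<le> cnt e s t (e l)" using less_iff_cnt[OF inc(2) k] that by blast
      moreover have "cnt e 0 s (e l) = l - 1" using cnt_self(1)[OF inc(1) l] that by simp
      ultimately show ?thesis using d1[of 0 "e l"] l that by simp
    qed
    show "k < l" if "l \<le> s" "k \<le> u" "e (s + t + k) < e l"
    proof -
      have "k \<le> cnt e (s + t) u (e l)" using less_iff_cnt[OF inc(3) k] that by blast
      moreover have "cnt e 0 s (e l) = l - 1" using cnt_self(1)[OF inc(1) l] that by simp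
      ultimately show ?thesis using d2[of "e l" "e l"] l by simp
    qed
    show "k < l" if "l \<le> t" "k \<le> u" "e (s + t + k) < e (s + l)"
    proof -
      have "k \<le> cnt e (s + t) u (e (s + l))" using less_iff_cnt[OF inc(3) k] that by blast
      moreover have "cnt e s t (e (s + l)) = l - 1" using cnt_self(1)[OF inc(2) l] that by simp
      ultimately show ?thesis using d2[of 0 "e (s + l)"] l by simp
    qed
  qed
  then show ?thesis unfolding rim_family_def n using D N by blast
qed

lemma G_diagram_rows:
  assumes "u \<le> t" "t \<le> s"
  shows "G_diagram s t u (f ` {1..u}) = three_rows t s u (\<lambda>l. if l \<le> u then f l else s - t + l) (\<lambda>l. l) f"
proof -
  have "(\<lambda>l. if l \<le> u then f l else s - t + l) ` {1..t} = f ` {1..u} \<union> {s - t + u + 1..s}" (is "?g ` _ = _")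
  proof -
    have "{1..t} = {1..u} \<union> {u + 1..t}" using assms by auto
    then have "?g ` {1..t} = ?g ` {1..u} \<union> ?g ` {u + 1..t}" by (simp only: image_Un)
    moreover have "?g ` {1..u} = f ` {1..u}" by (intro image_cong) auto
    moreover have "?g ` {u + 1..t} = (\<lambda>l. (s - t) + l) ` {u + 1..t}" by (intro image_cong) auto
    moreover have "(\<lambda>l. (s - t) + l) ` {u + 1..t} = {s - t + (u + 1)..s - t + t}"
      by (simp add: add.commute[of "s - t"])
    ultimately show ?thesis using assms by (simp add: add.assoc)
  qed
  then show ?thesis unfolding G_diagram_def three_rows_def by auto
qed

lemma H_diagram_rows:
  assumes "t \<le> s"
  shows "H_diagram s t (f ` {1..u}) = three_rows t u s (\<lambda>l. s - t + l) f (\<lambda>l. l)"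
proof -
  have "(\<lambda>l. (s - t) + l) ` {1..t} = {s - t + 1..s - t + t}"
    by (simp add: add.commute[of "s - t"])
  then have "(\<lambda>l. (s - t) + l) ` {1..t} = {s - t + 1..s}" using assms by simp
  then show ?thesis unfolding H_diagram_def three_rows_def by auto
qed

lemma strict_mono_enumeration:
  fixes C :: "nat set"
  assumes "finite C"
  obtains f where "strict_mono_on {1..card C} f" "f ` {1..card C} = C"
proof -
  obtain h where h: "bij_betw h {..<card C} C" "strict_mono_on {..<card C} h"
    using ex_bij_betw_strict_mono_card[OF assms] by blast
  define f where "f = (\<lambda>i. h (i - 1))"
  have "strict_mono_on {1..card C} f"
    using strict_mono_onD[OF h(2)] by (intro strict_mono_onI) (auto simp: f_def)
  moreover have "f ` {1..card C} = C"
  proof -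
    have "(\<lambda>i. i - 1) ` {1..card C} = {..<card C}"
    proof
      show "{..<card C} \<subseteq> (\<lambda>i. i - 1) ` {1..card C}"
      proof
        fix x assume "x \<in> {..<card C}"
        then have "x = Suc x - 1" "Suc x \<in> {1..card C}" by auto
        then show "x \<in> (\<lambda>i. i - 1) ` {1..card C}" by blast
      qed
    qed auto
    moreover have "f ` {1..card C} = h ` (\<lambda>i. i - 1) ` {1..card C}" by (simp only: f_def image_image)
    ultimately show ?thesis using bij_betw_imp_surj_on[OF h(1)] by simp
  qed
  ultimately show ?thesis using that by blast
qed

lemma nested_G_diagram:
  assumes o: "u \<le> t" "t \<le> s" and C: "C \<subseteq> {1..s - t + u}" "card C = u"
  shows "nested_diagram s t u (G_diagram s t u C)"
proof -
  have fin: "finite C" using C(1) finite_subset by blast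
  have "card (C \<union> {s - t + u + 1..s}) = card C + card {s - t + u + 1..s}"
    using fin C(1) by (intro card_Un_disjoint) auto
  then have c: "card (C \<union> {s - t + u + 1..s}) = t" using C(2) o by simp
  have "G_diagram s t u C = {2} \<times> {1..s} \<union> {1} \<times> (C \<union> {s - t + u + 1..s}) \<union> {3} \<times> C"
    by (auto simp: G_diagram_def)
  moreover have "{1..s - t + u} \<subseteq> {1..s}" "{s - t + u + 1..s} \<subseteq> {1..s}" using o by auto
  then have "C \<union> {s - t + u + 1..s} \<subseteq> {1..s}" using C(1) by blast
  moreover have "{2, 1, 3} = {1, 2, 3 :: nat}" by auto
  ultimately show ?thesis unfolding nested_diagram_def using c C(2)
    by (intro exI[of _ 2] exI[of _ 1] exI[of _ 3] exI[of _ "C \<union> {s - t + u + 1..s}"] exI[of _ C] conjI Un_upper1)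
qed

lemma nested_H_diagram:
  assumes o: "u \<le> t" "t \<le> s" and C: "C \<subseteq> {s - t + 1..s}" "card C = u"
  shows "nested_diagram s t u (H_diagram s t C)"
proof -
  have "H_diagram s t C = {3} \<times> {1..s} \<union> {1} \<times> {s - t + 1..s} \<union> {2} \<times> C"
    by (auto simp: H_diagram_def)
  moreover have "card {s - t + 1..s} = t" using o by simp
  moreover have "{s - t + 1..s} \<subseteq> {1..s}" by auto
  moreover have "{3, 1, 2} = {1, 2, 3 :: nat}" by auto
  ultimately show ?thesis unfolding nested_diagram_def using C
    by (intro exI[of _ 3] exI[of _ 1] exI[of _ 2] exI[of _ "{s - t + 1..s}"] exI[of _ C] conjI)
qed

lemma strict_mono_G_row:
  fixes f :: "nat \<Rightarrow> nat"
  assumes f: "strict_mono_on {1..u} f" "f ` {1..u} \<subseteq> {1..s - t + u}" and o: "u \<le> t" "t \<le> s"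
  shows "strict_mono_on {1..t} (\<lambda>l. if l \<le> u then f l else s - t + l)"
proof (rule strict_mono_onI)
  fix i j assume ij: "i \<in> {1..t}" "j \<in> {1..t}" "i < j"
  show "(if i \<le> u then f i else s - t + i) < (if j \<le> u then f j else s - t + j)"
  proof (cases "i \<le> u")
    case True
    then have "i \<in> {1..u}" using ij by simp
    then have "f i \<in> {1..s - t + u}" using f(2) by blast
    then show ?thesis using strict_mono_onD[OF f(1), of i j] True ij by auto
  qed (use ij in auto)
qed

text \<open>The permutation of \<open>G_diagram s t u {f 1, \<dots>, f u}\<close> dominates \<open>e\<close> if \<open>f i\<close> exceeds the number \<open>A i\<close> of
  values in the second block that are less than the \<open>i\<close>-th value of the first block, and is at most the
  number \<open>B i\<close> of values in the second block that are less than the \<open>i\<close>-th value of the third. The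
  inequalities for \<open>Z\<close> are what the greedy choice of \<open>f\<close> requires. The inversions of the permutation
  determine every \<open>f i\<close>, which gives incomparability.\<close>

lemma rim_family_G:
  assumes o: "u \<le> t" "t \<le> s" "1 \<le> u"
  shows "rim_family s t u [t, s, u] {G_diagram s t u C |C. C \<subseteq> {1..s - t + u} \<and> card C = u}"
proof -
  let ?\<D> = "{G_diagram s t u C |C. C \<subseteq> {1..s - t + u} \<and> card C = u}"
  let ?f = "\<lambda>f l. if l \<le> u then f l else s - t + l"
  have m: "mset [t, s, u] = {#s, t, u#}" by simp
  have n: "sum_list [t, s, u] = t + s + u" by simp
  have sm: "strict_mono_on A (\<lambda>i. i :: nat)" for A by (simp add: strict_mono_on_def)
  have D: "G_diagram s t u (f ` {1..u}) \<in> diagrams_of [t, s, u] \<and> G_diagram s t u (f ` {1..u}) \<in> ?\<D>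
      \<and> nested_diagram s t u (G_diagram s t u (f ` {1..u}))"
    if f: "strict_mono_on {1..u} f" "f ` {1..u} \<subseteq> {1..s - t + u}" for f
  proof -
    have c: "card (f ` {1..u}) = u" using strict_mono_on_imp_inj_on[OF f(1)] by (simp add: card_image)
    have N: "nested_diagram s t u (G_diagram s t u (f ` {1..u}))" by (rule nested_G_diagram[OF o(1,2) f(2) c])
    then have "G_diagram s t u (f ` {1..u}) \<in> diagrams_of [t, s, u]"
      using three_rows_in_diagrams_of[OF _ o(3) strict_mono_G_row[OF f o(1,2)] sm f(1)]
      unfolding G_diagram_rows[OF o(1,2)] by blast
    then show ?thesis using N f(2) c by blast
  qed
  have ex: "\<exists>f. E = G_diagram s t u (f ` {1..u}) \<and> strict_mono_on {1..u} f \<and> f ` {1..u} \<subseteq> {1..s - t + u}"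
    if E: "E \<in> ?\<D>" for E
  proof -
    obtain C where C: "E = G_diagram s t u C" "C \<subseteq> {1..s - t + u}" "card C = u" using E by blast
    have "finite C" using C(2) finite_subset by blast
    then obtain f where "strict_mono_on {1..card C} f" "f ` {1..card C} = C" by (rule strict_mono_enumeration)
    then show ?thesis using C by (intro exI[of _ f]) simp
  qed
  have dom: "\<exists>E\<in>?\<D>. inversions (t + s + u) e \<subseteq> inversions (t + s + u) (diagram_perm E)"
    if e: "e \<in> Z_set [t, s, u]" for e
  proof -
    have em: "e \<in> min_reps [t, s, u]" using e by (simp add: Z_set_def)
    have inj: "inj e" using permutes_inj[OF min_reps_permutes[OF em]] .
    note inc = min_reps_three_inc[OF em]
    note d1 = Z_set_ineq1[OF m o e] and d2 = Z_set_ineq2[OF m o e]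
    define A where "A k = cnt e t s (e k)" for k
    define B where "B k = cnt e t s (e (t + s + k))" for k
    have self1: "cnt e 0 t (e l) = l - 1" if "1 \<le> l" "l \<le> t" for l using cnt_self(1)[OF inc(1) that] by simp
    have A: "A l + 1 \<le> s - t + l" if "1 \<le> l" "l \<le> t" for l
      using d1[of 0 "e l"] self1[OF that] that o by (simp add: A_def)
    have h31: "k < l" if "1 \<le> l" "l \<le> t" "1 \<le> k" "k \<le> u" "e (t + s + k) < e l" for l k
    proof -
      have "k \<le> cnt e (t + s) u (e l)" using less_iff_cnt[OF inc(3), of k "e l"] that by blast
      then show ?thesis using d2[of "e l" "e l"] self1[of l] that by simp
    qed
    have AB: "A k + (i - k) < min (B i) (s - t + i)" if k: "1 \<le> k" "k \<le> i" "i \<le> u" for k i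
    proof -
      have "\<not> e (t + s + i) < e k" using h31[of k i] k o by auto
      then have le: "e k \<le> Suc (e (t + s + i))" by simp
      have "cnt e (t + s) u (Suc (e (t + s + i))) = i" using cnt_self(2)[OF inc(3), of i] k by simp
      moreover have "cnt e t s (Suc (e (t + s + i))) = B i"
        unfolding B_def using k by (intro cnt_Suc_other[OF inj]) simp
      ultimately have "i + u \<le> u + (k - 1) + (B i - A k)"
        using d2[OF le] self1[of k] k o by (simp add: A_def)
      then have "A k + (i - k) < B i" using k by linarith
      moreover have "A k + (i - k) < s - t + i" using A[of k] k o by linarith
      ultimately show ?thesis by simp
    qed
    obtain f where f: "strict_mono_on {1..u} f" "\<And>i. i \<in> {1..u} \<Longrightarrow> A i < f i"
      "\<And>i. i \<in> {1..u} \<Longrightarrow> f i \<le> min (B i) (s - t + i)"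
      using greedy_sequence[of u A "\<lambda>i. min (B i) (s - t + i)"] AB by blast
    have fle: "f i \<le> s - t + u" "1 \<le> f i" if "i \<in> {1..u}" for i using f(2,3)[OF that] that by auto
    then have fC: "f ` {1..u} \<subseteq> {1..s - t + u}" by auto
    note Df = D[OF f(1) fC]
    have "inversions (t + s + u) e \<subseteq> inversions (t + s + u) (diagram_perm (G_diagram s t u (f ` {1..u})))"
    proof (rule three_rows_dominates[OF _ G_diagram_rows[OF o(1,2)] strict_mono_G_row[OF f(1) fC o(1,2)] sm f(1) em])
      show "G_diagram s t u (f ` {1..u}) \<in> diagrams_of [t, s, u]" using Df by blast
      fix l k :: nat assume l: "1 \<le> l" and k: "1 \<le> k"
      show "k < ?f f l" if "l \<le> t" "k \<le> s" "e (t + k) < e l"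
      proof -
        have "k \<le> A l" unfolding A_def using less_iff_cnt[OF inc(2) k, of "e l"] that by blast
        then show ?thesis using f(2)[of l] A[OF l] l that by auto
      qed
      show "f k < ?f f l" if "l \<le> t" "k \<le> u" "e (t + s + k) < e l"
      proof -
        have "k < l" using h31[OF l _ k] that by blast
        then show ?thesis using strict_mono_onD[OF f(1), of k l] fle[of k] l k that by auto
      qed
      show "f k < l" if "l \<le> s" "k \<le> u" "e (t + s + k) < e (t + l)"
      proof -
        have "\<not> l \<le> B k" unfolding B_def using less_iff_cnt[OF inc(2) l, of "e (t + s + k)"] that by auto
        then show ?thesis using f(3)[of k] k that by auto
      qed
    qed
    then show ?thesis using Df by blast
  qed
  have anti: "E = E'" if E: "E \<in> ?\<D>" and E': "E' \<in> ?\<D>"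
    and sub: "inversions (t + s + u) (diagram_perm E) \<subseteq> inversions (t + s + u) (diagram_perm E')" for E E'
  proof -
    obtain f where f: "E = G_diagram s t u (f ` {1..u})" "strict_mono_on {1..u} f" "f ` {1..u} \<subseteq> {1..s - t + u}"
      using ex[OF E] by blast
    obtain f' where f': "E' = G_diagram s t u (f' ` {1..u})" "strict_mono_on {1..u} f'" "f' ` {1..u} \<subseteq> {1..s - t + u}"
      using ex[OF E'] by blast
    have "E \<in> diagrams_of [t, s, u]" "E' \<in> diagrams_of [t, s, u]"
      using D[OF f(2,3)] D[OF f'(2,3)] f(1) f'(1) by blast+
    note I = three_rows_inversions[OF this(1) f(1)[unfolded G_diagram_rows[OF o(1,2)]]
        strict_mono_G_row[OF f(2,3) o(1,2)] sm f(2)]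
      and I' = three_rows_inversions[OF this(2) f'(1)[unfolded G_diagram_rows[OF o(1,2)]]
        strict_mono_G_row[OF f'(2,3) o(1,2)] sm f'(2)]
    have "f k = f' k" if k: "k \<in> {1..u}" for k
    proof -
      have fk: "f k \<in> {1..s - t + u}" "f' k \<in> {1..s - t + u}" using f(3) f'(3) k by blast+
      then have fb: "1 \<le> f k" "f k \<le> s" "1 \<le> f' k" "f' k \<le> s" using o by auto
      have kb: "1 \<le> k" "k \<le> u" "k \<le> t" using k o by auto
      have "f' k \<le> f k"
      proof (cases "f k = s")
        case False
        define l where "l = f k + 1"
        have l: "1 \<le> l" "l \<le> s" "f k < l" using fb False by (auto simp: l_def)
        have "(t + l, t + s + k) \<in> inversions (t + s + u) (diagram_perm E)"
          using I(3)[OF l(1,2) kb(1,2)] l(3) by blast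
        then have "f' k < l" using I'(3)[OF l(1,2) kb(1,2)] sub by blast
        then show ?thesis by (simp add: l_def)
      qed (use fb in simp)
      moreover have "f k \<le> f' k"
      proof (cases "f k = 1")
        case False
        define l where "l = f k - 1"
        have l: "1 \<le> l" "l \<le> s" "l < f k" using fb False by (auto simp: l_def)
        have "(k, t + l) \<in> inversions (t + s + u) (diagram_perm E)"
          using I(1)[OF kb(1,3) l(1,2)] l(3) kb by simp
        then have "l < f' k" using I'(1)[OF kb(1,3) l(1,2)] sub kb by auto
        then show ?thesis using fb by (simp add: l_def)
      qed (use fb in simp)
      ultimately show ?thesis by simp
    qed
    then have "f ` {1..u} = f' ` {1..u}" by (intro image_cong) auto
    then show ?thesis using f(1) f'(1) by simp
  qed
  have "E \<in> diagrams_of [t, s, u] \<and> nested_diagram s t u E" if "E \<in> ?\<D>" for E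
    using ex[OF that] D by blast
  from rim_familyI[where lam = "[t, s, u]", unfolded n, OF this dom anti] show ?thesis .
qed

text \<open>Here \<open>f i\<close> has to exceed \<open>s - t\<close> and the number \<open>B i\<close> of values in the third block that are less than
  the \<open>i\<close>-th value of the second, and to be at most \<open>s - t\<close> plus the number \<open>A i\<close> of values in the first
  block that are less than it.\<close>

lemma rim_family_H:
  assumes o: "u \<le> t" "t \<le> s" "1 \<le> u"
  shows "rim_family s t u [t, u, s] {H_diagram s t C |C. C \<subseteq> {s - t + 1..s} \<and> card C = u}"
proof -
  let ?\<D> = "{H_diagram s t C |C. C \<subseteq> {s - t + 1..s} \<and> card C = u}"
  let ?g = "\<lambda>l. s - t + l"
  have m: "mset [t, u, s] = {#s, t, u#}" by (simp add: add_mset_commute)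
  have n: "sum_list [t, u, s] = t + u + s" by simp
  have sm: "strict_mono_on A (\<lambda>i. i :: nat)" "strict_mono_on A ?g" for A by (simp_all add: strict_mono_on_def)
  have D: "H_diagram s t (f ` {1..u}) \<in> diagrams_of [t, u, s] \<and> H_diagram s t (f ` {1..u}) \<in> ?\<D>
      \<and> nested_diagram s t u (H_diagram s t (f ` {1..u}))"
    if f: "strict_mono_on {1..u} f" "f ` {1..u} \<subseteq> {s - t + 1..s}" for f
  proof -
    have c: "card (f ` {1..u}) = u" using strict_mono_on_imp_inj_on[OF f(1)] by (simp add: card_image)
    have N: "nested_diagram s t u (H_diagram s t (f ` {1..u}))" by (rule nested_H_diagram[OF o(1,2) f(2) c])
    then have "H_diagram s t (f ` {1..u}) \<in> diagrams_of [t, u, s]"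
      using three_rows_in_diagrams_of[OF _ o(3) sm(2) f(1) sm(1)]
      unfolding H_diagram_rows[OF o(2)] by blast
    then show ?thesis using N f(2) c by blast
  qed
  have ex: "\<exists>f. E = H_diagram s t (f ` {1..u}) \<and> strict_mono_on {1..u} f \<and> f ` {1..u} \<subseteq> {s - t + 1..s}"
    if E: "E \<in> ?\<D>" for E
  proof -
    obtain C where C: "E = H_diagram s t C" "C \<subseteq> {s - t + 1..s}" "card C = u" using E by blast
    have "finite C" using C(2) finite_subset by blast
    then obtain f where "strict_mono_on {1..card C} f" "f ` {1..card C} = C" by (rule strict_mono_enumeration)
    then show ?thesis using C by (intro exI[of _ f]) simp
  qed
  have dom: "\<exists>E\<in>?\<D>. inversions (t + u + s) e \<subseteq> inversions (t + u + s) (diagram_perm E)"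
    if e: "e \<in> Z_set [t, u, s]" for e
  proof -
    have em: "e \<in> min_reps [t, u, s]" using e by (simp add: Z_set_def)
    have inj: "inj e" using permutes_inj[OF min_reps_permutes[OF em]] .
    note inc = min_reps_three_inc[OF em]
    note d1 = Z_set_ineq1[OF m o e] and d2 = Z_set_ineq2[OF m o e]
    define A where "A k = cnt e 0 t (e (t + k))" for k
    define B where "B k = cnt e (t + u) s (e (t + k))" for k
    have At: "A k \<le> t" for k unfolding A_def by (rule cnt_le)
    have A': "cnt e 0 t (Suc (e (t + k))) = A k" if "1 \<le> k" for k
      unfolding A_def by (rule cnt_Suc_other[OF inj]) (use that in simp)
    have self: "cnt e t u (e (t + k)) = k - 1" "cnt e t u (Suc (e (t + k))) = k" if "1 \<le> k" "k \<le> u" for k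
      using cnt_self[OF inc(2) that] by blast+
    have kA: "k \<le> A k" if k: "1 \<le> k" "k \<le> u" for k
    proof -
      \<comment> \<open>A threshold above all values.\<close>
      define v where "v = Suc (Max (e ` {1..t + u + s}))"
      have vv: "e i < v" if "i \<in> {1..t + u + s}" for i
        unfolding v_def using that by (intro le_imp_less_Suc Max_ge) auto
      have "{i \<in> {t + u + 1..t + u + s}. e i < v} = {t + u + 1..t + u + s}" using vv by auto
      then have "cnt e (t + u) s v = s" by (simp add: cnt_def)
      moreover have "{i \<in> {t + 1..t + u}. e i < v} = {t + 1..t + u}" using vv by auto
      then have "cnt e t u v = u" by (simp add: cnt_def)
      moreover have "Suc (e (t + k)) \<le> v" using vv[of "t + k"] k by simp
      ultimately have "s + u \<le> s + A k + (u - k)" using d2[of "Suc (e (t + k))" v] A'[of k] self(2)[of k] k by simp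
      then show ?thesis using k by linarith
    qed
    have AB: "max (B k) (s - t) + (i - k) < s - t + A i" if k: "1 \<le> k" "k \<le> i" "i \<le> u" for k i
    proof -
      have "e (t + k) \<le> e (t + i)" using increasing_runD[OF inc(2), of "t + k" "t + i"] k by (cases "k = i") auto
      then have le: "e (t + k) \<le> Suc (e (t + i))" by simp
      have "(t - A i) + (i - (k - 1)) + B k \<le> s"
        using d1[OF le] A'[of i] self(1)[of k] self(2)[of i] k by (simp add: B_def)
      then have "B k + (i - k) < s - t + A i" using At[of i] k o by linarith
      moreover have "s - t + (i - k) < s - t + A i" using kA[of i] k by linarith
      ultimately show ?thesis by (simp add: max_def)
    qed
    obtain f where f: "strict_mono_on {1..u} f" "\<And>i. i \<in> {1..u} \<Longrightarrow> max (B i) (s - t) < f i"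
      "\<And>i. i \<in> {1..u} \<Longrightarrow> f i \<le> s - t + A i"
      using greedy_sequence[of u "\<lambda>i. max (B i) (s - t)" "\<lambda>i. s - t + A i"] AB by blast
    have "f i \<in> {s - t + 1..s}" if "i \<in> {1..u}" for i using f(2,3)[OF that] At[of i] o by auto
    then have fC: "f ` {1..u} \<subseteq> {s - t + 1..s}" by blast
    note Df = D[OF f(1) fC]
    have "inversions (t + u + s) e \<subseteq> inversions (t + u + s) (diagram_perm (H_diagram s t (f ` {1..u})))"
    proof (rule three_rows_dominates[OF _ H_diagram_rows[OF o(2)] sm(2) f(1) sm(1) em])
      show "H_diagram s t (f ` {1..u}) \<in> diagrams_of [t, u, s]" using Df by blast
      fix l k :: nat assume l: "1 \<le> l" and k: "1 \<le> k"
      show "f k < s - t + l" if "l \<le> t" "k \<le> u" "e (t + k) < e l"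
      proof -
        have "\<not> l \<le> A k" unfolding A_def using less_iff_cnt[OF inc(1) l, of "e (t + k)"] that by auto
        then show ?thesis using f(3)[of k] k that by auto
      qed
      show "k < s - t + l" if "l \<le> t" "k \<le> s" "e (t + u + k) < e l"
      proof -
        have "k \<le> cnt e (t + u) s (e l)" using less_iff_cnt[OF inc(3) k] that by blast
        moreover have "cnt e 0 t (e l) = l - 1" using cnt_self(1)[OF inc(1) l] that by simp
        ultimately show ?thesis using d1[of "e l" "e l"] l that o by simp
      qed
      show "k < f l" if "l \<le> u" "k \<le> s" "e (t + u + k) < e (t + l)"
      proof -
        have "k \<le> B l" unfolding B_def using less_iff_cnt[OF inc(3) k] that by blast
        then show ?thesis using f(2)[of l] l that by auto
      qed
    qed
    then show ?thesis using Df by blast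
  qed
  have anti: "E = E'" if E: "E \<in> ?\<D>" and E': "E' \<in> ?\<D>"
    and sub: "inversions (t + u + s) (diagram_perm E) \<subseteq> inversions (t + u + s) (diagram_perm E')" for E E'
  proof -
    obtain f where f: "E = H_diagram s t (f ` {1..u})" "strict_mono_on {1..u} f" "f ` {1..u} \<subseteq> {s - t + 1..s}"
      using ex[OF E] by blast
    obtain f' where f': "E' = H_diagram s t (f' ` {1..u})" "strict_mono_on {1..u} f'" "f' ` {1..u} \<subseteq> {s - t + 1..s}"
      using ex[OF E'] by blast
    have "E \<in> diagrams_of [t, u, s]" "E' \<in> diagrams_of [t, u, s]"
      using D[OF f(2,3)] D[OF f'(2,3)] f(1) f'(1) by blast+
    note I = three_rows_inversions[OF this(1) f(1)[unfolded H_diagram_rows[OF o(2)]] sm(2) f(2) sm(1)]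
      and I' = three_rows_inversions[OF this(2) f'(1)[unfolded H_diagram_rows[OF o(2)]] sm(2) f'(2) sm(1)]
    have "f k = f' k" if k: "k \<in> {1..u}" for k
    proof -
      have fk: "f k \<in> {s - t + 1..s}" "f' k \<in> {s - t + 1..s}" using f(3) f'(3) k by blast+
      have "f' k \<le> f k"
      proof (cases "f k = s")
        case False
        define l where "l = f k + 1 - (s - t)"
        have l: "1 \<le> l" "l \<le> t" "s - t + l = f k + 1" using fk False o by (auto simp: l_def)
        have "(l, t + k) \<in> inversions (t + u + s) (diagram_perm E)" using I(1)[of l k] l k by simp
        then have "(l, t + k) \<in> inversions (t + u + s) (diagram_perm E')" using sub by blast
        then show ?thesis using I'(1)[of l k] l k by simp
      qed (use fk in simp)
      moreover have "f k \<le> f' k"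
      proof (cases "f k = 1")
        case False
        define l where "l = f k - 1"
        have l: "1 \<le> l" "l \<le> s" "l < f k" using fk False by (auto simp: l_def)
        have kb: "1 \<le> k" "k \<le> u" using k by auto
        have "(t + k, t + u + l) \<in> inversions (t + u + s) (diagram_perm E)"
          using I(3)[OF kb l(1,2)] l(3) by blast
        then have "l < f' k" using I'(3)[OF kb l(1,2)] sub by blast
        then show ?thesis using fk by (simp add: l_def)
      qed (use fk in simp)
      ultimately show ?thesis by simp
    qed
    then have "f ` {1..u} = f' ` {1..u}" by (intro image_cong) auto
    then show ?thesis using f(1) f'(1) by simp
  qed
  have "E \<in> diagrams_of [t, u, s] \<and> nested_diagram s t u E" if "E \<in> ?\<D>" for E
    using ex[OF that] D by blast
  from rim_familyI[where lam = "[t, u, s]", unfolded n, OF this dom anti] show ?thesis .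
qed

lemma card_G_family: "card {G_diagram s t u C |C. C \<subseteq> {1..s - t + u} \<and> card C = u} = (s - t + u) choose u"
proof -
  have "{G_diagram s t u C |C. C \<subseteq> {1..s - t + u} \<and> card C = u}
    = G_diagram s t u ` {C. C \<subseteq> {1..s - t + u} \<and> card C = u}" by auto
  moreover have "inj_on (G_diagram s t u) A" for A
  proof (rule inj_onI)
    fix C C' assume "G_diagram s t u C = G_diagram s t u C'"
    then have "{i. (3, i) \<in> G_diagram s t u C} = {i. (3, i) \<in> G_diagram s t u C'}" by simp
    then show "C = C'" by (simp add: G_diagram_def)
  qed
  ultimately show ?thesis using n_subsets[of "{1..s - t + u}" u] by (simp add: card_image)
qed

lemma card_H_family:
  assumes "t \<le> s"
  shows "card {H_diagram s t C |C. C \<subseteq> {s - t + 1..s} \<and> card C = u} = t choose u"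
proof -
  have "{H_diagram s t C |C. C \<subseteq> {s - t + 1..s} \<and> card C = u}
    = H_diagram s t ` {C. C \<subseteq> {s - t + 1..s} \<and> card C = u}" by auto
  moreover have "inj_on (H_diagram s t) A" for A
  proof (rule inj_onI)
    fix C C' assume "H_diagram s t C = H_diagram s t C'"
    then have "{i. (2, i) \<in> H_diagram s t C} = {i. (2, i) \<in> H_diagram s t C'}" by simp
    then show "C = C'" by (simp add: H_diagram_def)
  qed
  ultimately show ?thesis using n_subsets[of "{s - t + 1..s}" u] assms by (simp add: card_image)
qed

theorem theorem4p6:
  fixes s t u :: nat and lam :: "nat list"
  assumes "t \<le> s" and "u \<le> t" and "1 \<le> u"
    and "mset lam = {#s, t, u#}"
  shows
    "(lam = [s, t, u] \<longrightarrow> E_set lam = {young_diagram lam}) \<and>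
     (lam = [t, s, u] \<longrightarrow> E_set lam = {G_diagram s t u C | C. C \<subseteq> {1..s - t + u} \<and> card C = u}) \<and>
     (lam = [t, u, s] \<longrightarrow> E_set lam = {H_diagram s t C | C. C \<subseteq> {s - t + 1..s} \<and> card C = u}) \<and>
     (lam = [u, t, s] \<or> lam = [u, s, t] \<or> lam = [s, u, t] \<longrightarrow>
        E_set lam = {rotate_diagram M | M. M \<in> E_set (rev lam)}) \<and>
     E_set lam = Es_set lam \<and>
     (lam = [s, t, u] \<longrightarrow> card (E_set lam) = 1) \<and>
     (lam = [s, u, t] \<longrightarrow> card (E_set lam) = t choose u) \<and>
     (lam = [t, s, u] \<longrightarrow> card (E_set lam) = (s - t + u) choose u) \<and>
     (lam = [t, u, s] \<longrightarrow> card (E_set lam) = t choose u) \<and>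
     (lam = [u, s, t] \<longrightarrow> card (E_set lam) = (s - t + u) choose u) \<and>
     (lam = [u, t, s] \<longrightarrow> card (E_set lam) = 1)"
proof -
  note o = assms(2,1,3)
  let ?G = "{G_diagram s t u C | C. C \<subseteq> {1..s - t + u} \<and> card C = u}"
  let ?H = "{H_diagram s t C | C. C \<subseteq> {s - t + 1..s} \<and> card C = u}"
  have ms: "mset [s, t, u] = {#s, t, u#}" "mset [t, s, u] = {#s, t, u#}" "mset [t, u, s] = {#s, t, u#}"
    by (simp_all add: add_mset_commute)
  note Y = E_set_rim_family[OF ms(1) o rim_family_young[OF o]]
    and G = E_set_rim_family[OF ms(2) o rim_family_G[OF o]]
    and H = E_set_rim_family[OF ms(3) o rim_family_H[OF o]]
  have cards: "card (E_set [s, t, u]) = 1" "card (E_set [u, t, s]) = 1"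
    "card (E_set [t, s, u]) = (s - t + u) choose u" "card (E_set [u, s, t]) = (s - t + u) choose u"
    "card (E_set [t, u, s]) = t choose u" "card (E_set [s, u, t]) = t choose u"
    unfolding Y(1,2) G(1,2) H(1,2) card_image[OF G(3)] card_image[OF H(3)]
    using card_G_family card_H_family[OF assms(1)] by simp_all
  have rot: "E_set [u, t, s] = {rotate_diagram M | M. M \<in> E_set [s, t, u]}"
    "E_set [u, s, t] = {rotate_diagram M | M. M \<in> E_set [t, s, u]}"
    "E_set [s, u, t] = {rotate_diagram M | M. M \<in> E_set [t, u, s]}"
    unfolding Y(1,2) G(1,2) H(1,2) by blast+
  have "length lam = 3" using arg_cong[OF assms(4), of size] by simp
  then obtain a b c where "lam = [a, b, c]"
    by (auto simp: numeral_3_eq_3 length_Suc_conv)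
  then consider "lam = [s, t, u]" | "lam = [s, u, t]" | "lam = [t, s, u]" | "lam = [t, u, s]"
    | "lam = [u, s, t]" | "lam = [u, t, s]"
    using mset_three[of a b c s t u] assms(4) by blast
  moreover have "\<forall>M\<in>E_set [s, t, u]. special_diagram M" "\<forall>M\<in>E_set [t, s, u]. special_diagram M"
    "\<forall>M\<in>E_set [t, u, s]. special_diagram M"
    unfolding Y(1) G(1) H(1) using Y(4) G(4) H(4) by blast+
  moreover have "\<forall>M\<in>E_set [u, t, s]. special_diagram M" "\<forall>M\<in>E_set [u, s, t]. special_diagram M"
    "\<forall>M\<in>E_set [s, u, t]. special_diagram M"
    unfolding Y(2) G(2) H(2) using Y(5) G(5) H(5) by blast+
  ultimately have "\<forall>M\<in>E_set lam. special_diagram M" by cases simp_all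
  then have special: "E_set lam = Es_set lam" unfolding Es_set_def by blast
  have rotated: "E_set lam = {rotate_diagram M | M. M \<in> E_set (rev lam)}"
    if "lam = [u, t, s] \<or> lam = [u, s, t] \<or> lam = [s, u, t]"
    using that rot by auto
  show ?thesis
    by (intro conjI impI; (rule special | erule rotated | (simp only: cards; fail)
      | (simp only: Y(1); fail) | (simp only: G(1); fail) | (simp only: H(1); fail)))
qed

end
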